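(* Let $(M,\kappa)$ be a symplectic manifold of dimension $2n$, let $J$ be a $\kappa$-calibrated complex structure on $M$, let $g=g_J$ with Levi-Civita connection $\nabla$, and let $o$ be an arbitrary point of $M$. Then there exists a local complex $(1,0)$-frame $\{W_1,\dots,W_n\}$ around $o$ such that: 1. $\nabla_{W_k}\overline{W}_i(o)=0$ for $1\le k,i\le n$; 2. $\nabla_{W_k}W_i(o)\in T_oM^{(0,1)}$ for $1\le k,i\le n$; 3. if $G_{rs}:=g(W_r,\overline{W}_s)$, then $G_{rs}(o)=\delta_{rs}$ and $dG_{rs}[o]=0$ for $1\le r,s\le n$; 4. $\nabla_{W_r}\nabla_{\overline{W}_k}W_i(o)=0$ for $1\le r,k,i\le n$.
   Context: A complex structure on a $2n$-dimensional manifold $M$ means here a smooth section $J$ of $\mathrm{End}(TM)$ with $J^2=-\mathrm{Id}$ (i.e. an almost complex structure; integrability is not assumed). It gives a splitting $TM\otimes\mathbb{C}=TM^{(1,0)}\oplus TM^{(0,1)}$ into the eigenbundles of $J$ for the eigenvalues $i$ and $-i$ respectively. A symplectic manifold is a pair $(M,\kappa)$ with $\kappa$ a closed non-degenerate 2-form. A complex structure $J$ on $(M,\kappa)$ is $\kappa$-calibrated if $\kappa(J\cdot,J\cdot)=\kappa(\cdot,\cdot)$ and $g_J(\cdot,\cdot):=\kappa(J\cdot,\cdot)$ is positive definite; then $g_J$ is a $J$-invariant Riemannian metric. The metric $g$, the Levi-Civita connection $\nabla$ and $J$ are extended complex-(bi)linearly to $TM\otimes\mathbb{C}$. A local complex $(1,0)$-frame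 around $o$ is a family $\{W_1,\dots,W_n\}$ of smooth sections of $TM^{(1,0)}$ defined on a neighbourhood of $o$ which form a complex basis of $TM^{(1,0)}$ at every point of that neighbourhood. *)

theory Defs
  imports "HOL-Analysis.Analysis"
begin

section \<open>Smooth manifolds\<close>

text \<open>Only meant for open \<open>S\<close>.\<close>

primrec C_k_on :: "nat \<Rightarrow> 'a::euclidean_space set \<Rightarrow> ('a \<Rightarrow> 'b::real_normed_vector) \<Rightarrow> bool" where
  "C_k_on 0 S f \<longleftrightarrow> continuous_on S f"
| "C_k_on (Suc k) S f \<longleftrightarrow>
     (\<forall>x\<in>S. f differentiable (at x)) \<and>
     (\<forall>v. C_k_on k S (\<lambda>x. frechet_derivative f (at x) v))"

definition smooth_on :: "'a::euclidean_space set \<Rightarrow> ('a \<Rightarrow> 'b::real_normed_vector) \<Rightarrow> bool" where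
  "smooth_on S f \<longleftrightarrow> (\<forall>k. C_k_on k S f)"

text \<open>A chart is a pair of its domain and its coordinate map; the values of the coordinate map
  outside the domain are irrelevant.\<close>

type_synonym ('m, 'd) chart = "'m set \<times> ('m \<Rightarrow> real^'d)"

abbreviation dom_of :: "('m, 'd) chart \<Rightarrow> 'm set" where
  "dom_of c \<equiv> fst c"

abbreviation coord :: "('m, 'd) chart \<Rightarrow> 'm \<Rightarrow> real^'d" where
  "coord c \<equiv> snd c"

definition param :: "('m, 'd) chart \<Rightarrow> real^'d \<Rightarrow> 'm" where
  "param c = inv_into (dom_of c) (coord c)"

definition is_chart :: "('m::topological_space, 'd::finite) chart \<Rightarrow> bool" where
  "is_chart c \<longleftrightarrow>
     open (dom_of c) \<and> open (coord c ` dom_of c) \<and>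
     homeomorphism (dom_of c) (coord c ` dom_of c) (coord c) (param c)"

text \<open>The manifold is the whole (Hausdorff, second countable) type \<open>'m\<close>; its smooth structure is
  the one generated by the atlas.\<close>

definition smooth_atlas ::
    "('m::{t2_space,second_countable_topology}, 'd::finite) chart set \<Rightarrow> bool" where
  "smooth_atlas A \<longleftrightarrow>
     (\<forall>c\<in>A. is_chart c) \<and> (\<Union>c\<in>A. dom_of c) = UNIV \<and>
     (\<forall>c\<in>A. \<forall>c'\<in>A.
        smooth_on (coord c ` (dom_of c \<inter> dom_of c')) (coord c' \<circ> param c))"

definition smooth_fun_on ::
    "('m, 'd::finite) chart set \<Rightarrow> 'm set \<Rightarrow> ('m \<Rightarrow> 'b::real_normed_vector) \<Rightarrow> bool" where
  "smooth_fun_on A U f \<longleftrightarrow>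
     (\<forall>c\<in>A. smooth_on (coord c ` (dom_of c \<inter> U)) (f \<circ> param c))"


section \<open>Tangent vectors and vector fields\<close>

text \<open>For every point \<open>p\<close> a chart of the atlas around \<open>p\<close> is fixed once and for all, and the tangent
  space at \<open>p\<close> is taken to be \<open>\<real>\<^sup>d\<close>, a vector being identified with its components in
  that preferred chart. Accordingly the complexified tangent space is \<open>\<complex>\<^sup>d\<close>.
  The preferred chart need not depend continuously on \<open>p\<close>, so smoothness of fields is always
  tested after passing to the components in a fixed chart \<open>c\<close>: \<open>tcoord A c p\<close> maps a tangent vector
  at \<open>p\<close> to its components in \<open>c\<close>, and \<open>tvec A c p\<close> is the inverse map.\<close>

definition chart_at :: "('m, 'd) chart set \<Rightarrow> 'm \<Rightarrow> ('m, 'd) chart" where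
  "chart_at A p = (SOME c. c \<in> A \<and> p \<in> dom_of c)"

definition tcoord ::
    "('m, 'd::finite) chart set \<Rightarrow> ('m, 'd) chart \<Rightarrow> 'm \<Rightarrow> real^'d \<Rightarrow> real^'d" where
  "tcoord A c p =
     frechet_derivative (coord c \<circ> param (chart_at A p)) (at (coord (chart_at A p) p))"

definition tvec ::
    "('m, 'd::finite) chart set \<Rightarrow> ('m, 'd) chart \<Rightarrow> 'm \<Rightarrow> real^'d \<Rightarrow> real^'d" where
  "tvec A c p =
     frechet_derivative (coord (chart_at A p) \<circ> param c) (at (coord c p))"

text \<open>\<open>differential A f p v\<close> is \<open>df[p](v)\<close>.\<close>

definition differential ::
    "('m, 'd::finite) chart set \<Rightarrow> ('m \<Rightarrow> 'b::real_normed_vector) \<Rightarrow> 'm \<Rightarrow> real^'d \<Rightarrow> 'b" where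
  "differential A f p =
     frechet_derivative (f \<circ> param (chart_at A p)) (at (coord (chart_at A p) p))"

definition field_rep ::
    "('m, 'd::finite) chart set \<Rightarrow> ('m, 'd) chart \<Rightarrow> ('m \<Rightarrow> real^'d) \<Rightarrow> real^'d \<Rightarrow> real^'d" where
  "field_rep A c X y = tcoord A c (param c y) (X (param c y))"

definition smooth_field_on ::
    "('m, 'd::finite) chart set \<Rightarrow> 'm set \<Rightarrow> ('m \<Rightarrow> real^'d) \<Rightarrow> bool" where
  "smooth_field_on A U X \<longleftrightarrow>
     (\<forall>c\<in>A. smooth_on (coord c ` (dom_of c \<inter> U)) (field_rep A c X))"

text \<open>The usual coordinate expression \<open>DY(X) - DX(Y)\<close>, in the preferred chart at \<open>p\<close>.\<close>

definition lie_bracket ::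
    "('m, 'd::finite) chart set \<Rightarrow> ('m \<Rightarrow> real^'d) \<Rightarrow> ('m \<Rightarrow> real^'d) \<Rightarrow> 'm \<Rightarrow> real^'d" where
  "lie_bracket A X Y p =
     (let c = chart_at A p in
        frechet_derivative (field_rep A c Y) (at (coord c p)) (X p)
      - frechet_derivative (field_rep A c X) (at (coord c p)) (Y p))"


section \<open>Symplectic forms and calibrated complex structures\<close>

text \<open>The component of a (0,2)-tensor field along the coordinate fields \<open>\<partial>\<^sub>u\<close>, \<open>\<partial>\<^sub>v\<close> of the chart
  \<open>c\<close>.\<close>

definition form_rep ::
    "('m, 'd::finite) chart set \<Rightarrow> ('m, 'd) chart \<Rightarrow> ('m \<Rightarrow> real^'d \<Rightarrow> real^'d \<Rightarrow> real)
       \<Rightarrow> real^'d \<Rightarrow> real^'d \<Rightarrow> real^'d \<Rightarrow> real" where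
  "form_rep A c \<omega> u v y =
     \<omega> (param c y) (tvec A c (param c y) u) (tvec A c (param c y) v)"

definition two_form ::
    "('m, 'd::finite) chart set \<Rightarrow> ('m \<Rightarrow> real^'d \<Rightarrow> real^'d \<Rightarrow> real) \<Rightarrow> bool" where
  "two_form A \<omega> \<longleftrightarrow>
     (\<forall>p. bilinear (\<omega> p)) \<and> (\<forall>p v. \<omega> p v v = 0) \<and>
     (\<forall>c\<in>A. \<forall>u v. smooth_on (coord c ` dom_of c) (form_rep A c \<omega> u v))"

text \<open>\<open>d\<omega>(\<partial>\<^sub>u, \<partial>\<^sub>v, \<partial>\<^sub>w) = \<partial>\<^sub>u \<omega>(\<partial>\<^sub>v, \<partial>\<^sub>w) + \<partial>\<^sub>v \<omega>(\<partial>\<^sub>w, \<partial>\<^sub>u) + \<partial>\<^sub>w \<omega>(\<partial>\<^sub>u, \<partial>\<^sub>v)\<close>\<close>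

definition closed_two_form ::
    "('m, 'd::finite) chart set \<Rightarrow> ('m \<Rightarrow> real^'d \<Rightarrow> real^'d \<Rightarrow> real) \<Rightarrow> bool" where
  "closed_two_form A \<omega> \<longleftrightarrow>
     two_form A \<omega> \<and>
     (\<forall>c\<in>A. \<forall>y\<in>coord c ` dom_of c. \<forall>u v w.
          frechet_derivative (form_rep A c \<omega> v w) (at y) u
        + frechet_derivative (form_rep A c \<omega> w u) (at y) v
        + frechet_derivative (form_rep A c \<omega> u v) (at y) w = 0)"

definition symplectic_form ::
    "('m, 'd::finite) chart set \<Rightarrow> ('m \<Rightarrow> real^'d \<Rightarrow> real^'d \<Rightarrow> real) \<Rightarrow> bool" where
  "symplectic_form A \<kappa> \<longleftrightarrow>
     closed_two_form A \<kappa> \<and> (\<forall>p u. (\<forall>v. \<kappa> p u v = 0) \<longrightarrow> u = 0)"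

text \<open>No integrability is required.\<close>

definition complex_structure ::
    "('m, 'd::finite) chart set \<Rightarrow> ('m \<Rightarrow> real^'d \<Rightarrow> real^'d) \<Rightarrow> bool" where
  "complex_structure A J \<longleftrightarrow>
     (\<forall>p. linear (J p)) \<and> (\<forall>p v. J p (J p v) = - v) \<and>
     (\<forall>c\<in>A. \<forall>u. smooth_on (coord c ` dom_of c)
        (\<lambda>y. tcoord A c (param c y) (J (param c y) (tvec A c (param c y) u))))"

definition g_of ::
    "('m \<Rightarrow> real^'d \<Rightarrow> real^'d \<Rightarrow> real) \<Rightarrow> ('m \<Rightarrow> real^'d \<Rightarrow> real^'d) \<Rightarrow>
       'm \<Rightarrow> real^'d \<Rightarrow> real^'d \<Rightarrow> real" where
  "g_of \<kappa> J p u v = \<kappa> p (J p u) v"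

definition calibrated ::
    "('m \<Rightarrow> real^'d \<Rightarrow> real^'d \<Rightarrow> real) \<Rightarrow> ('m \<Rightarrow> real^'d \<Rightarrow> real^'d) \<Rightarrow> bool" where
  "calibrated \<kappa> J \<longleftrightarrow>
     (\<forall>p u v. \<kappa> p (J p u) (J p v) = \<kappa> p u v) \<and> (\<forall>p v. v \<noteq> 0 \<longrightarrow> g_of \<kappa> J p v v > 0)"


section \<open>The Levi-Civita connection\<close>

text \<open>A connection is given as an operator \<open>nabla p v Y\<close> acting on a tangent vector \<open>v\<close> at \<open>p\<close> and a vector field
  \<open>Y\<close> that is smooth on some neighbourhood of \<open>p\<close>; it depends only on the germ of \<open>Y\<close> at \<open>p\<close>.
  Nothing is required of its values at fields that are not smooth near \<open>p\<close>.\<close>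

type_synonym ('m, 'd) connection = "'m \<Rightarrow> real^'d \<Rightarrow> ('m \<Rightarrow> real^'d) \<Rightarrow> real^'d"

definition affine_connection ::
    "('m::topological_space, 'd::finite) chart set \<Rightarrow> ('m, 'd) connection \<Rightarrow> bool" where
  "affine_connection A nabla \<longleftrightarrow>
     (\<forall>U. open U \<longrightarrow>
        (\<forall>Y. smooth_field_on A U Y \<longrightarrow> (\<forall>p\<in>U. linear (\<lambda>v. nabla p v Y))) \<and>
        (\<forall>Y Z. smooth_field_on A U Y \<and> smooth_field_on A U Z \<longrightarrow>
           (\<forall>p\<in>U. \<forall>v. nabla p v (\<lambda>q. Y q + Z q) = nabla p v Y + nabla p v Z)) \<and>
        (\<forall>f Y. smooth_fun_on A U (f :: 'm \<Rightarrow> real) \<and> smooth_field_on A U Y \<longrightarrow>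
           (\<forall>p\<in>U. \<forall>v. nabla p v (\<lambda>q. f q *\<^sub>R Y q)
                        = differential A f p v *\<^sub>R Y p + f p *\<^sub>R nabla p v Y)) \<and>
        (\<forall>Y Z. smooth_field_on A U Y \<and> smooth_field_on A U Z \<and> (\<forall>q\<in>U. Y q = Z q) \<longrightarrow>
           (\<forall>p\<in>U. \<forall>v. nabla p v Y = nabla p v Z)) \<and>
        (\<forall>X Y. smooth_field_on A U X \<and> smooth_field_on A U Y \<longrightarrow>
           smooth_field_on A U (\<lambda>p. nabla p (X p) Y)))"

definition levi_civita ::
    "('m::topological_space, 'd::finite) chart set \<Rightarrow> ('m \<Rightarrow> real^'d \<Rightarrow> real^'d \<Rightarrow> real)
       \<Rightarrow> ('m, 'd) connection \<Rightarrow> bool" where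
  "levi_civita A g nabla \<longleftrightarrow>
     affine_connection A nabla \<and>
     (\<forall>U X Y. open U \<and> smooth_field_on A U X \<and> smooth_field_on A U Y \<longrightarrow>
        (\<forall>p\<in>U. nabla p (X p) Y - nabla p (Y p) X = lie_bracket A X Y p)) \<and>
     (\<forall>U Y Z. open U \<and> smooth_field_on A U Y \<and> smooth_field_on A U Z \<longrightarrow>
        (\<forall>p\<in>U. \<forall>v. differential A (\<lambda>q. g q (Y q) (Z q)) p v
                     = g p (nabla p v Y) (Z p) + g p (Y p) (nabla p v Z)))"


section \<open>Complexification\<close>

definition Re_vec :: "complex^'d \<Rightarrow> real^'d" where
  "Re_vec w = (\<chi> i. Re (w $ i))"

definition Im_vec :: "complex^'d \<Rightarrow> real^'d" where
  "Im_vec w = (\<chi> i. Im (w $ i))"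

definition Complex_vec :: "real^'d \<Rightarrow> real^'d \<Rightarrow> complex^'d" where
  "Complex_vec u v = (\<chi> i. Complex (u $ i) (v $ i))"

definition cnj_vec :: "complex^'d \<Rightarrow> complex^'d" where
  "cnj_vec w = (\<chi> i. cnj (w $ i))"

definition linear_ext :: "(real^'d \<Rightarrow> real^'d) \<Rightarrow> complex^'d \<Rightarrow> complex^'d" where
  "linear_ext L w = Complex_vec (L (Re_vec w)) (L (Im_vec w))"

definition bilinear_ext ::
    "(real^'d \<Rightarrow> real^'d \<Rightarrow> real) \<Rightarrow> complex^'d \<Rightarrow> complex^'d \<Rightarrow> complex" where
  "bilinear_ext B w z =
     Complex (B (Re_vec w) (Re_vec z) - B (Im_vec w) (Im_vec z))
             (B (Re_vec w) (Im_vec z) + B (Im_vec w) (Re_vec z))"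

definition connection_ext ::
    "('m, 'd) connection \<Rightarrow> 'm \<Rightarrow> complex^'d \<Rightarrow> ('m \<Rightarrow> complex^'d) \<Rightarrow> complex^'d" where
  "connection_ext nabla p w Y =
     Complex_vec
       (nabla p (Re_vec w) (\<lambda>q. Re_vec (Y q)) - nabla p (Im_vec w) (\<lambda>q. Im_vec (Y q)))
       (nabla p (Re_vec w) (\<lambda>q. Im_vec (Y q)) + nabla p (Im_vec w) (\<lambda>q. Re_vec (Y q)))"

definition smooth_complex_field_on ::
    "('m, 'd::finite) chart set \<Rightarrow> 'm set \<Rightarrow> ('m \<Rightarrow> complex^'d) \<Rightarrow> bool" where
  "smooth_complex_field_on A U W \<longleftrightarrow>
     smooth_field_on A U (\<lambda>q. Re_vec (W q)) \<and> smooth_field_on A U (\<lambda>q. Im_vec (W q))"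

definition T10 :: "('m \<Rightarrow> real^'d \<Rightarrow> real^'d) \<Rightarrow> 'm \<Rightarrow> (complex^'d) set" where
  "T10 J p = {w. linear_ext (J p) w = \<i> *s w}"

definition T01 :: "('m \<Rightarrow> real^'d \<Rightarrow> real^'d) \<Rightarrow> 'm \<Rightarrow> (complex^'d) set" where
  "T01 J p = {w. linear_ext (J p) w = (- \<i>) *s w}"

definition local_10_frame ::
    "('m::topological_space, 'd::finite) chart set \<Rightarrow> ('m \<Rightarrow> real^'d \<Rightarrow> real^'d) \<Rightarrow> nat \<Rightarrow>
       'm \<Rightarrow> 'm set \<Rightarrow> (nat \<Rightarrow> 'm \<Rightarrow> complex^'d) \<Rightarrow> bool" where
  "local_10_frame A J n x U W \<longleftrightarrow>
     open U \<and> x \<in> U \<and>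
     (\<forall>i\<in>{1..n}. smooth_complex_field_on A U (W i)) \<and>
     (\<forall>p\<in>U. inj_on (\<lambda>i. W i p) {1..n} \<and>
            vec.independent ((\<lambda>i. W i p) ` {1..n}) \<and>
            vec.span ((\<lambda>i. W i p) ` {1..n}) = T10 J p)"

end

theory Submission
  imports Defs
begin

text \<open>
  Write \<open>\<Pi>\<close> for the projection of the complexified tangent bundle onto the vectors of type (1,0). The
  proof rests on two properties of the tensor \<open>\<nabla>J\<close>. It anticommutes with \<open>J\<close>, because \<open>J\<^sup>2 = -1\<close>, so
  \<open>\<nabla>\<^sub>X J\<close> exchanges the two types. And closedness of \<open>\<kappa>\<close>, together with the absence of torsion, gives
  \<open>(\<nabla>\<^sub>J\<^sub>X J)(JY) = -(\<nabla>\<^sub>X J)Y\<close> (lemma \<open>quasi_kaehler\<close>), so \<open>(\<nabla>\<^sub>X J)Y = 0\<close> for \<open>X\<close> of type (0,1) and \<open>Y\<close>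
  of type (1,0).

  Let \<open>W\<close> be a section of type (1,0) with \<open>\<Pi>\<nabla>W = 0\<close> at \<open>x\<close>. Differentiating \<open>JW = \<i>W\<close> gives
  \<open>\<nabla>\<^sub>X W = -(\<i>/2)(\<nabla>\<^sub>X J)W\<close> at \<open>x\<close>: a vector of type (0,1), and zero if \<open>X\<close> is of type (0,1). For a
  family of such sections that is unitary at \<open>x\<close> this contains everything that is claimed about first
  derivatives. The statement on the conjugates follows by conjugation, and \<open>dG = 0\<close> because \<open>g\<close> is
  parallel and its bilinear extension vanishes on two vectors of the same type. Such a section through
  any given vector is \<open>\<Pi>\<close> applied to a field with affine components (lemma \<open>first_order_section\<close>).

  For the second derivatives, let \<open>X\<close> be a field of type (0,1). Then \<open>\<nabla>\<^sub>X W\<close> is again a section of type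
  (1,0), and it vanishes at \<open>x\<close>. Hence \<open>C(u,X) = \<nabla>\<^sub>u\<nabla>\<^sub>X W\<close> at \<open>x\<close> is of type (1,0), depends only on the value
  of \<open>X\<close> at \<open>x\<close>, and is complex bilinear. In a chart, with \<open>v\<close> the displacement from \<open>x\<close>, subtract from
  \<open>W\<close> the section \<open>\<Pi> C(\<Pi>v, v - \<Pi>v)\<close>. It vanishes to second order at \<open>x\<close>, so the values and first
  derivatives at \<open>x\<close> do not change, while the mixed derivative of this quadratic expression in the
  directions \<open>u\<close> of type (1,0) and \<open>X\<close> is precisely \<open>C(u,X)\<close> (lemmas \<open>quadratic_correction\<close> and
  \<open>second_order_section\<close>). Linear independence near \<open>x\<close> follows from continuity of the Gram matrix.

  This construction takes place in an open subset of \<open>\<real>\<^sup>d\<close> and uses only the Christoffel symbols and the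
  components of \<open>g\<close> and \<open>J\<close> (locale \<open>almost_kaehler_patch\<close>). To place the manifold in this setting,
  the connection, given by its axioms, is expressed by Christoffel symbols (lemma \<open>nabla_chart_field\<close>).
  Their symmetry rests on the symmetry of second derivatives.
\<close>

section \<open>Calculus of smooth functions\<close>

lemma C_k_on_Suc_imp_C_k_on: "C_k_on (Suc k) S f \<Longrightarrow> C_k_on k S f"
proof (induction k arbitrary: f)
  case 0
  then show ?case
    by (simp add: continuous_at_imp_continuous_on differentiable_imp_continuous_within)
next
  case (Suc k)
  then show ?case by (metis C_k_on.simps(2))
qed

lemma frechet_derivative_eqI: "(f has_derivative f') (at x) \<Longrightarrow> frechet_derivative f (at x) = f'"
  using frechet_derivative_at by metis

lemma has_derivative_frechet:
  "f differentiable (at x) \<Longrightarrow> (f has_derivative frechet_derivative f (at x)) (at x)"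
  by (simp add: frechet_derivative_works)

lemma C_k_on_cong:
  assumes "open S" "\<And>x. x \<in> S \<Longrightarrow> f x = g x" "C_k_on k S f"
  shows "C_k_on k S g"
  using assms
proof (induction k arbitrary: f g)
  case 0
  then show ?case using continuous_on_cong by (metis C_k_on.simps(1))
next
  case (Suc k)
  have d: "(g has_derivative frechet_derivative f (at x)) (at x)" if "x \<in> S" for x
    by (rule has_derivative_transform_within_open[OF has_derivative_frechet \<open>open S\<close> that])
      (use Suc.prems that in auto)
  have "C_k_on k S (\<lambda>x. frechet_derivative g (at x) v)" for v
  proof (rule Suc.IH[OF \<open>open S\<close>])
    show "frechet_derivative f (at x) v = frechet_derivative g (at x) v" if "x \<in> S" for x
      by (simp add: frechet_derivative_eqI[OF d[OF that]])
    show "C_k_on k S (\<lambda>x. frechet_derivative f (at x) v)" using Suc.prems(3) by simp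
  qed
  with d show ?case by (auto simp: differentiable_def)
qed

text \<open>The definition of \<open>C_k_on (Suc k)\<close> speaks of \<open>frechet_derivative\<close>; this rule lets a derivative that is known
  on \<open>S\<close> by a formula stand in for it, and the closure properties below all go through it.\<close>
lemma C_k_on_SucI:
  assumes "open S" "\<And>x. x \<in> S \<Longrightarrow> (f has_derivative f' x) (at x)" "\<And>v. C_k_on k S (\<lambda>x. f' x v)"
  shows "C_k_on (Suc k) S f"
proof -
  have "C_k_on k S (\<lambda>x. frechet_derivative f (at x) v)" for v
    by (rule C_k_on_cong[OF assms(1) _ assms(3)[of v]]) (simp add: frechet_derivative_eqI[OF assms(2)])
  then show ?thesis using assms(2) by (auto simp: differentiable_def)
qed

lemma C_k_on_derivative:
  assumes "C_k_on (Suc k) S f"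
  shows "x \<in> S \<Longrightarrow> (f has_derivative frechet_derivative f (at x)) (at x)"
    and "C_k_on k S (\<lambda>x. frechet_derivative f (at x) v)"
  using assms by (auto intro: has_derivative_frechet)

lemma C_k_on_const: "open S \<Longrightarrow> C_k_on k S (\<lambda>x. c)"
proof (induction k arbitrary: c)
  case (Suc k)
  show ?case by (rule C_k_on_SucI[OF Suc.prems, where f' = "\<lambda>_ _. 0"]) (auto intro: Suc)
qed auto

lemma C_k_on_bounded_linear:
  assumes L: "bounded_linear L" and "open S" "C_k_on k S f"
  shows "C_k_on k S (\<lambda>x. L (f x))"
  using assms(3)
proof (induction k arbitrary: f)
  case 0
  then show ?case by (simp add: bounded_linear.continuous_on[OF L])
next
  case (Suc k)
  show ?case
    by (rule C_k_on_SucI[OF assms(2) bounded_linear.has_derivative[OF L C_k_on_derivative(1)[OF Suc.prems]]])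
       (simp, rule Suc.IH, rule C_k_on_derivative(2)[OF Suc.prems])
qed

lemma C_k_on_add:
  assumes "open S" "C_k_on k S f" "C_k_on k S g"
  shows "C_k_on k S (\<lambda>x. f x + g x)"
  using assms
proof (induction k arbitrary: f g)
  case 0
  then show ?case by (auto intro: continuous_on_add)
next
  case (Suc k)
  show ?case
    by (rule C_k_on_SucI[OF assms(1) has_derivative_add[OF C_k_on_derivative(1)[OF Suc.prems(2)]
           C_k_on_derivative(1)[OF Suc.prems(3)]]])
       (simp_all, intro Suc.IH C_k_on_derivative(2) Suc.prems)
qed

lemma C_k_on_scaleR:
  fixes f :: "'a::euclidean_space \<Rightarrow> real"
  assumes "open S" "C_k_on k S f" "C_k_on k S g"
  shows "C_k_on k S (\<lambda>x. f x *\<^sub>R g x)"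
  using assms
proof (induction k arbitrary: f g)
  case 0
  then show ?case by (auto intro: continuous_on_scaleR)
next
  case (Suc k)
  show ?case
    by (rule C_k_on_SucI[OF assms(1) has_derivative_scaleR[OF C_k_on_derivative(1)[OF Suc.prems(2)]
           C_k_on_derivative(1)[OF Suc.prems(3)]]])
       (assumption, assumption, intro C_k_on_add[OF assms(1)] Suc.IH[OF assms(1)] C_k_on_derivative(2)
          C_k_on_Suc_imp_C_k_on[OF Suc.prems(2)] C_k_on_Suc_imp_C_k_on[OF Suc.prems(3)] Suc.prems)
qed

lemma C_k_on_sum:
  assumes "open S" "\<And>i. i \<in> I \<Longrightarrow> C_k_on k S (f i)"
  shows "C_k_on k S (\<lambda>x. \<Sum>i\<in>I. f i x)"
  using assms(2)
proof (induction I rule: infinite_finite_induct)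
  case (insert i I)
  then have "C_k_on k S (f i)" "C_k_on k S (\<lambda>x. \<Sum>i\<in>I. f i x)" by simp_all
  from C_k_on_add[OF assms(1) this] show ?case by (simp add: insert.hyps)
qed (auto intro: C_k_on_const assms(1))

lemma linear_eq_sum_Basis:
  fixes f :: "'a::euclidean_space \<Rightarrow> 'b::real_vector"
  assumes "linear f" shows "f v = (\<Sum>b\<in>Basis. (v \<bullet> b) *\<^sub>R f b)"
proof -
  have "f v = f (\<Sum>b\<in>Basis. (v \<bullet> b) *\<^sub>R b)" by (simp add: euclidean_representation)
  also have "\<dots> = (\<Sum>b\<in>Basis. (v \<bullet> b) *\<^sub>R f b)"
    by (simp add: linear_sum[OF assms] linear_scale[OF assms])
  finally show ?thesis .
qed

text \<open>The derivative of \<open>f\<close> is only known to be of class \<open>C_k_on k\<close> when applied to a fixed vector. In the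
  chain rule it is applied to the moving vector \<open>g'(x)v\<close>, which is therefore expanded in the standard
  basis; the product rule and the induction hypothesis then apply to every summand.\<close>
lemma C_k_on_compose:
  fixes g :: "'a::euclidean_space \<Rightarrow> 'c::euclidean_space"
  assumes "open S" "open T" "C_k_on k T f" "C_k_on k S g" "g ` S \<subseteq> T"
  shows "C_k_on k S (\<lambda>x. f (g x))"
  using assms(3-)
proof (induction k arbitrary: f)
  case 0
  then show ?case by (auto intro: continuous_on_compose2)
next
  case (Suc k)
  let ?f' = "\<lambda>y. frechet_derivative f (at y)" and ?g' = "\<lambda>x. frechet_derivative g (at x)"
  have f': "(f has_derivative ?f' (g x)) (at (g x))" if "x \<in> S" for x
    using C_k_on_derivative(1)[OF Suc.prems(1)] Suc.prems(3) that by auto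
  have exp: "?f' (g x) (?g' x v) = (\<Sum>b\<in>Basis. (?g' x v \<bullet> b) *\<^sub>R ?f' (g x) b)" if "x \<in> S" for x v
    by (rule linear_eq_sum_Basis) (use f'[OF that] has_derivative_linear in blast)
  show ?case
  proof (rule C_k_on_SucI[OF assms(1)])
    show "((\<lambda>x. f (g x)) has_derivative (\<lambda>v. ?f' (g x) (?g' x v))) (at x)" if "x \<in> S" for x
      by (rule has_derivative_compose[OF C_k_on_derivative(1)[OF Suc.prems(2) that] f'[OF that]])
    show "C_k_on k S (\<lambda>x. ?f' (g x) (?g' x v))" for v
    proof (rule C_k_on_cong[OF assms(1) exp[symmetric]])
      have "C_k_on k S g" by (rule C_k_on_Suc_imp_C_k_on[OF Suc.prems(2)])
      then show "C_k_on k S (\<lambda>x. \<Sum>b\<in>Basis. (?g' x v \<bullet> b) *\<^sub>R ?f' (g x) b)"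
        using Suc.prems
        by (intro C_k_on_sum C_k_on_scaleR assms(1) Suc.IH C_k_on_derivative(2)
            C_k_on_bounded_linear[OF bounded_linear_inner_left]) auto
    qed
  qed
qed

lemma smooth_on_cong:
  "open S \<Longrightarrow> (\<And>x. x \<in> S \<Longrightarrow> f x = g x) \<Longrightarrow> smooth_on S f \<Longrightarrow> smooth_on S g"
  unfolding smooth_on_def using C_k_on_cong by blast

lemma smooth_on_const: "open S \<Longrightarrow> smooth_on S (\<lambda>x. c)"
  by (simp add: smooth_on_def C_k_on_const)

lemma smooth_on_bounded_linear:
  "bounded_linear L \<Longrightarrow> open S \<Longrightarrow> smooth_on S f \<Longrightarrow> smooth_on S (\<lambda>x. L (f x))"
  by (simp add: smooth_on_def C_k_on_bounded_linear)

lemma smooth_on_add: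
  "open S \<Longrightarrow> smooth_on S f \<Longrightarrow> smooth_on S g \<Longrightarrow> smooth_on S (\<lambda>x. f x + g x)"
  by (simp add: smooth_on_def C_k_on_add)

lemma smooth_on_scaleR:
  fixes f :: "'a::euclidean_space \<Rightarrow> real"
  shows "open S \<Longrightarrow> smooth_on S f \<Longrightarrow> smooth_on S g \<Longrightarrow> smooth_on S (\<lambda>x. f x *\<^sub>R g x)"
  by (simp add: smooth_on_def C_k_on_scaleR)

lemma smooth_on_sum:
  "open S \<Longrightarrow> (\<And>i. i \<in> I \<Longrightarrow> smooth_on S (f i)) \<Longrightarrow> smooth_on S (\<lambda>x. \<Sum>i\<in>I. f i x)"
  by (simp add: smooth_on_def C_k_on_sum)

lemma smooth_on_compose:
  fixes g :: "'a::euclidean_space \<Rightarrow> 'c::euclidean_space"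
  shows "open S \<Longrightarrow> open T \<Longrightarrow> smooth_on T f \<Longrightarrow> smooth_on S g \<Longrightarrow> g ` S \<subseteq> T
    \<Longrightarrow> smooth_on S (\<lambda>x. f (g x))"
  by (simp add: smooth_on_def C_k_on_compose)

lemma smooth_on_uminus: "open S \<Longrightarrow> smooth_on S f \<Longrightarrow> smooth_on S (\<lambda>x. - f x)"
  using smooth_on_bounded_linear[OF bounded_linear_minus[OF bounded_linear_ident]] by blast

lemma smooth_on_diff:
  "open S \<Longrightarrow> smooth_on S f \<Longrightarrow> smooth_on S g \<Longrightarrow> smooth_on S (\<lambda>x. f x - g x)"
  using smooth_on_add[OF _ _ smooth_on_uminus] by fastforce

lemma smooth_on_has_derivative:
  "smooth_on S f \<Longrightarrow> x \<in> S \<Longrightarrow> (f has_derivative frechet_derivative f (at x)) (at x)"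
  unfolding smooth_on_def using C_k_on_derivative(1)[of 0] by blast

lemma smooth_on_frechet_derivative:
  "smooth_on S f \<Longrightarrow> smooth_on S (\<lambda>x. frechet_derivative f (at x) v)"
  unfolding smooth_on_def using C_k_on_derivative(2) by blast

lemma smooth_on_continuous_on: "smooth_on S f \<Longrightarrow> continuous_on S f"
  unfolding smooth_on_def using C_k_on.simps(1) by blast

lemma smooth_on_ident: "open S \<Longrightarrow> smooth_on S (\<lambda>x. x)"
proof -
  assume S: "open S"
  have "C_k_on k S (\<lambda>x. x)" for k
  proof (cases k)
    case (Suc j)
    show ?thesis unfolding Suc
      by (rule C_k_on_SucI[OF S has_derivative_ident]) (rule C_k_on_const[OF S])
  qed (auto intro: continuous_on_id)
  then show ?thesis by (simp add: smooth_on_def)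
qed

lemma C_k_on_subset: "C_k_on k S f \<Longrightarrow> T \<subseteq> S \<Longrightarrow> C_k_on k T f"
proof (induction k arbitrary: f)
  case 0
  then show ?case using continuous_on_subset by auto
next
  case (Suc k)
  then show ?case by (metis C_k_on.simps(2) subsetD)
qed

lemma smooth_on_subset: "smooth_on S f \<Longrightarrow> T \<subseteq> S \<Longrightarrow> smooth_on T f"
  by (auto simp: smooth_on_def intro: C_k_on_subset)

text \<open>Fields of linear maps, such as \<open>J\<close> or the Christoffel symbols, are smooth in the sense that they
  are smooth on every fixed argument. Expanding a moving argument in the standard basis reduces the
  evaluation on it, and its derivative, to the product rule.\<close>
lemma smooth_on_linear_apply:
  fixes F :: "'a::euclidean_space \<Rightarrow> 'c::euclidean_space"
  assumes "open S" "\<And>y. y \<in> S \<Longrightarrow> linear (M y)" "\<And>b. smooth_on S (\<lambda>y. M y b)" "smooth_on S F"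
  shows "smooth_on S (\<lambda>y. M y (F y))"
  by (rule smooth_on_cong[OF assms(1) linear_eq_sum_Basis[OF assms(2), symmetric]], assumption)
     (intro smooth_on_sum smooth_on_scaleR assms smooth_on_bounded_linear[OF bounded_linear_inner_left])

lemma smooth_on_bilinear_apply:
  fixes F :: "'a::euclidean_space \<Rightarrow> 'c::euclidean_space" and G :: "'a \<Rightarrow> 'd::euclidean_space"
  assumes "open S" "\<And>y. y \<in> S \<Longrightarrow> bilinear (B y)" "\<And>u v. smooth_on S (\<lambda>y. B y u v)"
    "smooth_on S F" "smooth_on S G"
  shows "smooth_on S (\<lambda>y. B y (F y) (G y))"
proof (rule smooth_on_linear_apply[OF assms(1) _ _ assms(5)])
  show "linear (\<lambda>z. B y (F y) z)" if "y \<in> S" for y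
    using assms(2)[OF that] by (simp add: bilinear_def)
  show "smooth_on S (\<lambda>y. B y (F y) b)" for b
    by (rule smooth_on_linear_apply[OF assms(1) _ assms(3) assms(4)])
       (use assms(2) in \<open>simp add: bilinear_def\<close>)
qed

lemma has_derivative_linear_apply:
  fixes F :: "'a::euclidean_space \<Rightarrow> 'c::euclidean_space" and M :: "'a \<Rightarrow> 'c \<Rightarrow> 'b::real_normed_vector"
  assumes "open S" "y \<in> S" and lin: "\<And>y. y \<in> S \<Longrightarrow> linear (M y)"
    and M: "\<And>b. ((\<lambda>y. M y b) has_derivative M' b) (at y)" and F: "(F has_derivative F') (at y)"
  shows "((\<lambda>y. M y (F y)) has_derivative (\<lambda>v. M' (F y) v + M y (F' v))) (at y)"
proof (rule has_derivative_transform_within_open[OF _ assms(1,2) linear_eq_sum_Basis[OF lin, symmetric]])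
  have M'lin: "M' u v = (\<Sum>b\<in>Basis. (u \<bullet> b) *\<^sub>R M' b v)" for u v
  proof -
    have "((\<lambda>y. M y u) has_derivative (\<lambda>v. \<Sum>b\<in>Basis. (u \<bullet> b) *\<^sub>R M' b v)) (at y)"
      by (rule has_derivative_transform_within_open[OF _ assms(1,2) linear_eq_sum_Basis[OF lin, symmetric]])
         (auto intro!: derivative_eq_intros M)
    from has_derivative_unique[OF this M[of u]] show ?thesis by metis
  qed
  have "((\<lambda>y. \<Sum>b\<in>Basis. (F y \<bullet> b) *\<^sub>R M y b) has_derivative
     (\<lambda>v. \<Sum>b\<in>Basis. (F y \<bullet> b) *\<^sub>R M' b v + (F' v \<bullet> b) *\<^sub>R M y b)) (at y)"
    by (intro has_derivative_sum has_derivative_scaleR M bounded_linear.has_derivative[OF bounded_linear_inner_left F])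
  also have "(\<lambda>v. \<Sum>b\<in>Basis. (F y \<bullet> b) *\<^sub>R M' b v + (F' v \<bullet> b) *\<^sub>R M y b)
     = (\<lambda>v. M' (F y) v + M y (F' v))"
    by (simp add: sum.distrib M'lin[of "F y"] linear_eq_sum_Basis[OF lin[OF assms(2)], of "F' _"])
  finally show "((\<lambda>y. \<Sum>b\<in>Basis. (F y \<bullet> b) *\<^sub>R M y b) has_derivative
     (\<lambda>v. M' (F y) v + M y (F' v))) (at y)" .
qed auto

lemma has_derivative_bilinear_apply:
  fixes F :: "'a::euclidean_space \<Rightarrow> 'c::euclidean_space" and G :: "'a \<Rightarrow> 'd::euclidean_space"
    and B :: "'a \<Rightarrow> 'c \<Rightarrow> 'd \<Rightarrow> 'b::real_normed_vector"
  assumes "open S" "y \<in> S" and bil: "\<And>y. y \<in> S \<Longrightarrow> bilinear (B y)"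
    and B: "\<And>u v. ((\<lambda>y. B y u v) has_derivative B' u v) (at y)"
    and F: "(F has_derivative F') (at y)" and G: "(G has_derivative G') (at y)"
  shows "((\<lambda>y. B y (F y) (G y)) has_derivative
    (\<lambda>v. B' (F y) (G y) v + B y (F' v) (G y) + B y (F y) (G' v))) (at y)"
proof -
  have 1: "((\<lambda>y. B y (F y) b) has_derivative (\<lambda>v. B' (F y) b v + B y (F' v) b)) (at y)" for b
    by (rule has_derivative_linear_apply[where M = "\<lambda>y u. B y u b", OF assms(1,2) _ B F])
       (use bil in \<open>simp add: bilinear_def\<close>)
  show ?thesis
    by (rule has_derivative_linear_apply[where M = "\<lambda>y. B y (F y)", OF assms(1,2) _ 1 G])
       (use bil in \<open>simp add: bilinear_def\<close>)
qed

text \<open>Product rule at a point where one factor vanishes to second order.\<close>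
lemma has_derivative_bilinear_vanishing:
  fixes F :: "'a::euclidean_space \<Rightarrow> 'c::euclidean_space" and G :: "'a \<Rightarrow> 'd::euclidean_space"
    and B :: "'a \<Rightarrow> 'c \<Rightarrow> 'd \<Rightarrow> 'b::real_normed_vector"
  assumes "open S" "a \<in> S" and bil: "\<And>y. y \<in> S \<Longrightarrow> bilinear (B y)"
    and B: "\<And>u v. smooth_on S (\<lambda>y. B y u v)"
    and F: "(F has_derivative F') (at a)" and G: "(G has_derivative (\<lambda>v. 0)) (at a)" "G a = 0"
  shows "((\<lambda>y. B y (F y) (G y)) has_derivative (\<lambda>v. 0)) (at a)"
proof -
  let ?B' = "\<lambda>u v. frechet_derivative (\<lambda>y. B y u v) (at a)"
  have "((\<lambda>y. B y u 0) has_derivative (\<lambda>v. 0)) (at a)" for u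
    by (rule has_derivative_transform_within_open[OF has_derivative_const[of 0] assms(1,2)])
       (simp add: bilinear_rzero[OF bil])
  then have B0: "?B' u 0 = (\<lambda>v. 0)" for u by (rule frechet_derivative_eqI)
  have "((\<lambda>y. B y (F y) (G y)) has_derivative
      (\<lambda>v. ?B' (F a) (G a) v + B a (F' v) (G a) + B a (F a) 0)) (at a)"
    by (rule has_derivative_bilinear_apply[OF assms(1,2) bil smooth_on_has_derivative[OF B assms(2)] F G(1)])
  then show ?thesis by (simp add: G B0 bilinear_rzero[OF bil[OF assms(2)]])
qed

section \<open>Symmetry of second derivatives\<close>

text \<open>The second difference of \<open>f\<close> in the directions \<open>u\<close> and \<open>v\<close> is a second derivative at an intermediate
  point: the mean value theorem is used once in each direction. The second difference is symmetric in
  \<open>u\<close> and \<open>v\<close>, and letting \<open>t\<close> tend to zero gives the symmetry of the second derivative.\<close>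
lemma second_difference_mean_value:
  fixes f :: "'a::euclidean_space \<Rightarrow> real"
  assumes f: "smooth_on S f" and "t > 0"
    and S: "\<And>r s. 0 \<le> r \<Longrightarrow> r \<le> t \<Longrightarrow> 0 \<le> s \<Longrightarrow> s \<le> t \<Longrightarrow> a + r *\<^sub>R u + s *\<^sub>R v \<in> S"
  shows "\<exists>r s. 0 \<le> r \<and> r \<le> t \<and> 0 \<le> s \<and> s \<le> t \<and>
    f (a + t *\<^sub>R u + t *\<^sub>R v) - f (a + t *\<^sub>R u) - f (a + t *\<^sub>R v) + f a =
    t * t * frechet_derivative (\<lambda>y. frechet_derivative f (at y) u) (at (a + r *\<^sub>R u + s *\<^sub>R v)) v"
proof -
  define fu where "fu = (\<lambda>y. frechet_derivative f (at y) u)"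
  have fu: "smooth_on S fu" unfolding fu_def by (rule smooth_on_frechet_derivative[OF f])
  define \<phi> where "\<phi> = (\<lambda>r. f (a + r *\<^sub>R u + t *\<^sub>R v) - f (a + r *\<^sub>R u))"
  have d1: "((\<lambda>r. f (a + r *\<^sub>R u + s *\<^sub>R v)) has_derivative (\<lambda>h. h * fu (a + r *\<^sub>R u + s *\<^sub>R v))) (at r)"
    if "0 \<le> r" "r \<le> t" "0 \<le> s" "s \<le> t" for r s
  proof -
    have *: "(f has_derivative frechet_derivative f (at (a + r *\<^sub>R u + s *\<^sub>R v))) (at (a + r *\<^sub>R u + s *\<^sub>R v))"
      by (rule smooth_on_has_derivative[OF f S[OF that]])
    have "((\<lambda>r. f (a + r *\<^sub>R u + s *\<^sub>R v)) has_derivative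
        (\<lambda>h. frechet_derivative f (at (a + r *\<^sub>R u + s *\<^sub>R v)) (h *\<^sub>R u))) (at r)"
      by (rule has_derivative_compose[where f = "\<lambda>r. a + r *\<^sub>R u + s *\<^sub>R v", OF _ *])
         (auto intro!: derivative_eq_intros)
    then show ?thesis using linear_scale[OF has_derivative_linear[OF *]] by (simp add: fu_def)
  qed
  have d2: "((\<lambda>s. fu (a + r *\<^sub>R u + s *\<^sub>R v)) has_derivative
      (\<lambda>h. h * frechet_derivative fu (at (a + r *\<^sub>R u + s *\<^sub>R v)) v)) (at s)"
    if "0 \<le> r" "r \<le> t" "0 \<le> s" "s \<le> t" for r s
  proof -
    have *: "(fu has_derivative frechet_derivative fu (at (a + r *\<^sub>R u + s *\<^sub>R v))) (at (a + r *\<^sub>R u + s *\<^sub>R v))"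
      by (rule smooth_on_has_derivative[OF fu S[OF that]])
    have "((\<lambda>s. fu (a + r *\<^sub>R u + s *\<^sub>R v)) has_derivative
        (\<lambda>h. frechet_derivative fu (at (a + r *\<^sub>R u + s *\<^sub>R v)) (h *\<^sub>R v))) (at s)"
      by (rule has_derivative_compose[where f = "\<lambda>s. a + r *\<^sub>R u + s *\<^sub>R v", OF _ *])
         (auto intro!: derivative_eq_intros)
    then show ?thesis using linear_scale[OF has_derivative_linear[OF *]] by simp
  qed
  have "\<exists>r\<in>{0..t}. \<phi> t - \<phi> 0 = (t - 0) * (fu (a + r *\<^sub>R u + t *\<^sub>R v) - fu (a + r *\<^sub>R u))"
  proof -
    have "\<exists>r\<in>{0<..<t}. \<phi> t - \<phi> 0 = (\<lambda>h. h * fu (a + r *\<^sub>R u + t *\<^sub>R v) - h * fu (a + r *\<^sub>R u)) (t - 0)"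
    proof (rule mvt[OF \<open>t > 0\<close>])
      have d\<phi>: "(\<phi> has_derivative (\<lambda>h. h * fu (a + r *\<^sub>R u + t *\<^sub>R v) - h * fu (a + r *\<^sub>R u))) (at r)"
        if "0 \<le> r" "r \<le> t" for r
        unfolding \<phi>_def using d1[OF that, of t] d1[OF that, of 0] \<open>t > 0\<close>
        by (intro has_derivative_diff) auto
      show "continuous_on {0..t} \<phi>"
        by (intro continuous_at_imp_continuous_on ballI has_derivative_continuous[OF d\<phi>]) auto
      show "(\<phi> has_derivative (\<lambda>h. h * fu (a + r *\<^sub>R u + t *\<^sub>R v) - h * fu (a + r *\<^sub>R u))) (at r)"
        if "0 < r" "r < t" for r using d\<phi>[of r] that by simp
    qed auto
    then obtain r where "r \<in> {0<..<t}" "\<phi> t - \<phi> 0 = t * fu (a + r *\<^sub>R u + t *\<^sub>R v) - t * fu (a + r *\<^sub>R u)"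
      by auto
    then show ?thesis by (intro bexI[of _ r]) (auto simp: algebra_simps)
  qed
  then obtain r where r: "0 \<le> r" "r \<le> t"
    and r_eq: "\<phi> t - \<phi> 0 = t * (fu (a + r *\<^sub>R u + t *\<^sub>R v) - fu (a + r *\<^sub>R u))" by auto
  have "\<exists>s\<in>{0<..<t}. fu (a + r *\<^sub>R u + t *\<^sub>R v) - fu (a + r *\<^sub>R u + 0 *\<^sub>R v) =
      (\<lambda>h. h * frechet_derivative fu (at (a + r *\<^sub>R u + s *\<^sub>R v)) v) (t - 0)"
  proof (rule mvt[OF \<open>t > 0\<close>])
    show "continuous_on {0..t} (\<lambda>s. fu (a + r *\<^sub>R u + s *\<^sub>R v))"
      by (intro continuous_at_imp_continuous_on ballI has_derivative_continuous[OF d2[OF r]]) auto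
  qed (use d2[OF r] in auto)
  then obtain s where s: "0 < s" "s < t"
    and "fu (a + r *\<^sub>R u + t *\<^sub>R v) - fu (a + r *\<^sub>R u) =
      t * frechet_derivative fu (at (a + r *\<^sub>R u + s *\<^sub>R v)) v"
    by auto
  with r_eq have "\<phi> t - \<phi> 0 = t * t * frechet_derivative fu (at (a + r *\<^sub>R u + s *\<^sub>R v)) v" by simp
  with r s show ?thesis unfolding fu_def[symmetric]
    by (intro exI[of _ r] exI[of _ s]) (auto simp: \<phi>_def)
qed

lemma second_derivative_symmetric_real:
  fixes f :: "'a::euclidean_space \<Rightarrow> real"
  assumes "open S" "a \<in> S" and f: "smooth_on S f"
  shows "frechet_derivative (\<lambda>y. frechet_derivative f (at y) u) (at a) v =
    frechet_derivative (\<lambda>y. frechet_derivative f (at y) v) (at a) u"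
proof -
  define P where "P = (\<lambda>y. frechet_derivative (\<lambda>y. frechet_derivative f (at y) u) (at y) v)"
  define Q where "Q = (\<lambda>y. frechet_derivative (\<lambda>y. frechet_derivative f (at y) v) (at y) u)"
  have cP: "continuous_on S P" and cQ: "continuous_on S Q"
    unfolding P_def Q_def by (intro smooth_on_continuous_on smooth_on_frechet_derivative f)+
  have "\<bar>P a - Q a\<bar> < e" if "e > 0" for e
  proof -
    from cP \<open>a \<in> S\<close> \<open>open S\<close> have "isCont P a" using continuous_on_eq_continuous_at by blast
    then obtain d1 where d1: "d1 > 0" "\<And>y. dist y a < d1 \<Longrightarrow> dist (P y) (P a) < e/2"
      using \<open>e > 0\<close> unfolding continuous_at_eps_delta by (metis half_gt_zero)
    from cQ \<open>a \<in> S\<close> \<open>open S\<close> have "isCont Q a" using continuous_on_eq_continuous_at by blast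
    then obtain d2 where d2: "d2 > 0" "\<And>y. dist y a < d2 \<Longrightarrow> dist (Q y) (Q a) < e/2"
      using \<open>e > 0\<close> unfolding continuous_at_eps_delta by (metis half_gt_zero)
    obtain d3 where d3: "d3 > 0" "ball a d3 \<subseteq> S" using \<open>open S\<close> \<open>a \<in> S\<close> open_contains_ball by blast
    define d where "d = min d1 (min d2 d3)"
    \<comment> \<open>Chosen so that the whole parallelogram spanned by \<open>t u\<close> and \<open>t v\<close> stays within distance \<open>d\<close>
      of \<open>a\<close>.\<close>
    define t where "t = d / (2 * (norm u + norm v + 1))"
    have "d > 0" using d1 d2 d3 by (simp add: d_def)
    have den: "0 < norm u + norm v + 1" by (metis add_nonneg_pos norm_ge_zero add_nonneg_nonneg zero_less_one)
    have "t > 0" using \<open>d > 0\<close> den by (simp add: t_def)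
    have near: "dist (a + r *\<^sub>R u + s *\<^sub>R v) a < d" if "0 \<le> r" "r \<le> t" "0 \<le> s" "s \<le> t" for r s
    proof -
      have "dist (a + r *\<^sub>R u + s *\<^sub>R v) a = norm (r *\<^sub>R u + s *\<^sub>R v)" by (simp add: dist_norm)
      also have "\<dots> \<le> r * norm u + s * norm v" using norm_triangle_ineq[of "r *\<^sub>R u" "s *\<^sub>R v"] that by simp
      also have "\<dots> \<le> t * norm u + t * norm v" using that by (intro add_mono mult_right_mono) auto
      also have "\<dots> \<le> t * (norm u + norm v + 1)" using \<open>t > 0\<close> by (simp add: algebra_simps)
      also have "\<dots> = d / 2" using den by (simp add: t_def divide_simps)
      also have "\<dots> < d" using \<open>d > 0\<close> by simp
      finally show ?thesis .
    qed
    have inS: "a + r *\<^sub>R u + s *\<^sub>R v \<in> S" if "0 \<le> r" "r \<le> t" "0 \<le> s" "s \<le> t" for r s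
      using near[OF that] d3 by (auto simp: d_def mem_ball dist_commute)
    obtain r s where rs: "0 \<le> r" "r \<le> t" "0 \<le> s" "s \<le> t"
      "f (a + t *\<^sub>R u + t *\<^sub>R v) - f (a + t *\<^sub>R u) - f (a + t *\<^sub>R v) + f a = t * t * P (a + r *\<^sub>R u + s *\<^sub>R v)"
      using second_difference_mean_value[OF f \<open>t > 0\<close> inS] unfolding P_def by blast
    have inS': "a + r *\<^sub>R v + s *\<^sub>R u \<in> S" if "0 \<le> r" "r \<le> t" "0 \<le> s" "s \<le> t" for r s
      using inS[OF that(3,4,1,2)] by (simp add: add_ac)
    obtain s' r' where rs': "0 \<le> r'" "r' \<le> t" "0 \<le> s'" "s' \<le> t"
      "f (a + t *\<^sub>R v + t *\<^sub>R u) - f (a + t *\<^sub>R v) - f (a + t *\<^sub>R u) + f a = t * t * Q (a + s' *\<^sub>R v + r' *\<^sub>R u)"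
      using second_difference_mean_value[OF f \<open>t > 0\<close> inS'] unfolding Q_def by blast
    have "t * t * P (a + r *\<^sub>R u + s *\<^sub>R v) = t * t * Q (a + r' *\<^sub>R u + s' *\<^sub>R v)"
      using rs(5) rs'(5) by (simp add: algebra_simps)
    then have "P (a + r *\<^sub>R u + s *\<^sub>R v) = Q (a + r' *\<^sub>R u + s' *\<^sub>R v)" using \<open>t > 0\<close> by simp
    moreover have "dist (P (a + r *\<^sub>R u + s *\<^sub>R v)) (P a) < e/2"
      using d1(2) near[OF rs(1-4)] by (simp add: d_def)
    moreover have "dist (Q (a + r' *\<^sub>R u + s' *\<^sub>R v)) (Q a) < e/2"
      using d2(2) near[OF rs'(1-4)] by (simp add: d_def)
    ultimately show ?thesis unfolding dist_real_def by linarith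
  qed
  then have "P a = Q a" by (metis less_irrefl abs_le_zero_iff not_le right_minus_eq)
  then show ?thesis by (simp add: P_def Q_def)
qed

lemma second_derivative_symmetric:
  fixes f :: "'a::euclidean_space \<Rightarrow> 'b::euclidean_space"
  assumes "open S" "a \<in> S" and f: "smooth_on S f"
  shows "frechet_derivative (\<lambda>y. frechet_derivative f (at y) u) (at a) v =
    frechet_derivative (\<lambda>y. frechet_derivative f (at y) v) (at a) u"
proof (rule euclidean_eqI)
  fix b :: 'b assume "b \<in> Basis"
  have fb: "smooth_on S (\<lambda>y. f y \<bullet> b)"
    by (rule smooth_on_bounded_linear[OF bounded_linear_inner_left assms(1) f])
  have 1: "frechet_derivative (\<lambda>y. f y \<bullet> b) (at y) u = frechet_derivative f (at y) u \<bullet> b"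
    if "y \<in> S" for y u
    by (subst frechet_derivative_eqI[OF bounded_linear.has_derivative[OF bounded_linear_inner_left
          smooth_on_has_derivative[OF f that]]]) simp
  have 2: "frechet_derivative (\<lambda>y. frechet_derivative (\<lambda>y. f y \<bullet> b) (at y) u) (at a) v =
      frechet_derivative (\<lambda>y. frechet_derivative f (at y) u) (at a) v \<bullet> b" for u v
  proof -
    have "((\<lambda>y. frechet_derivative f (at y) u \<bullet> b) has_derivative
       (\<lambda>v. frechet_derivative (\<lambda>y. frechet_derivative f (at y) u) (at a) v \<bullet> b)) (at a)"
      by (rule bounded_linear.has_derivative[OF bounded_linear_inner_left
          smooth_on_has_derivative[OF smooth_on_frechet_derivative[OF f] assms(2)]])
    then have "((\<lambda>y. frechet_derivative (\<lambda>y. f y \<bullet> b) (at y) u) has_derivative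
       (\<lambda>v. frechet_derivative (\<lambda>y. frechet_derivative f (at y) u) (at a) v \<bullet> b)) (at a)"
      by (rule has_derivative_transform_within_open[OF _ assms(1,2)]) (simp add: 1)
    from frechet_derivative_eqI[OF this] show ?thesis by simp
  qed
  show "frechet_derivative (\<lambda>y. frechet_derivative f (at y) u) (at a) v \<bullet> b =
    frechet_derivative (\<lambda>y. frechet_derivative f (at y) v) (at a) u \<bullet> b"
    using second_derivative_symmetric_real[OF assms(1,2) fb, of u v] by (simp add: 2)
qed

section \<open>Complexified vectors\<close>

lemma cvec_eqI: "Re_vec w = Re_vec z \<Longrightarrow> Im_vec w = Im_vec z \<Longrightarrow> w = z"
  by (simp add: vec_eq_iff Re_vec_def Im_vec_def complex_eq_iff)

lemma Re_vec_simps [simp]: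
  "Re_vec (Complex_vec u v) = u" "Re_vec (w + z) = Re_vec w + Re_vec z"
  "Re_vec (w - z) = Re_vec w - Re_vec z" "Re_vec (- w) = - Re_vec w" "Re_vec 0 = 0"
  "Re_vec (r *\<^sub>R w) = r *\<^sub>R Re_vec w" "Re_vec (a *s w) = Re a *\<^sub>R Re_vec w - Im a *\<^sub>R Im_vec w"
  "Re_vec (cnj_vec w) = Re_vec w" "Re_vec (linear_ext L w) = L (Re_vec w)"
  by (simp_all add: vec_eq_iff Re_vec_def Im_vec_def Complex_vec_def cnj_vec_def linear_ext_def)

lemma Im_vec_simps [simp]:
  "Im_vec (Complex_vec u v) = v" "Im_vec (w + z) = Im_vec w + Im_vec z"
  "Im_vec (w - z) = Im_vec w - Im_vec z" "Im_vec (- w) = - Im_vec w" "Im_vec 0 = 0"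
  "Im_vec (r *\<^sub>R w) = r *\<^sub>R Im_vec w" "Im_vec (a *s w) = Re a *\<^sub>R Im_vec w + Im a *\<^sub>R Re_vec w"
  "Im_vec (cnj_vec w) = - Im_vec w" "Im_vec (linear_ext L w) = L (Im_vec w)"
  by (simp_all add: vec_eq_iff Re_vec_def Im_vec_def Complex_vec_def cnj_vec_def linear_ext_def)

lemma Complex_vec_Re_Im [simp]: "Complex_vec (Re_vec w) (Im_vec w) = w"
  by (rule cvec_eqI) simp_all

lemma bounded_linear_Re_vec: "bounded_linear (Re_vec :: complex^'d::finite \<Rightarrow> real^'d)"
  by (rule linear_conv_bounded_linear[THEN iffD1], rule linearI) simp_all

lemma bounded_linear_Im_vec: "bounded_linear (Im_vec :: complex^'d::finite \<Rightarrow> real^'d)"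
  by (rule linear_conv_bounded_linear[THEN iffD1], rule linearI) simp_all

lemma bounded_linear_Complex_vec_left:
  "bounded_linear (\<lambda>u. Complex_vec u (0 :: real^'d::finite))"
  by (rule linear_conv_bounded_linear[THEN iffD1], rule linearI) (rule cvec_eqI; simp)+

lemma bounded_linear_Complex_vec_right:
  "bounded_linear (\<lambda>v. Complex_vec (0 :: real^'d::finite) v)"
  by (rule linear_conv_bounded_linear[THEN iffD1], rule linearI) (rule cvec_eqI; simp)+

lemma bounded_linear_cnj_vec: "bounded_linear (cnj_vec :: complex^'d::finite \<Rightarrow> complex^'d)"
  by (rule linear_conv_bounded_linear[THEN iffD1], rule linearI) (rule cvec_eqI; simp)+

lemma bounded_linear_scale: "bounded_linear (\<lambda>w :: complex^'d::finite. a *s w)"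
  by (rule linear_conv_bounded_linear[THEN iffD1], rule linearI) (rule cvec_eqI; simp add: algebra_simps)+

lemma cnj_vec_simps [simp]:
  "cnj_vec (cnj_vec w) = w" "cnj_vec (w + z) = cnj_vec w + cnj_vec z"
  "cnj_vec (w - z) = cnj_vec w - cnj_vec z" "cnj_vec (- w) = - cnj_vec w"
  "cnj_vec 0 = 0" "cnj_vec (a *s w) = cnj a *s cnj_vec w" "cnj_vec (r *\<^sub>R w) = r *\<^sub>R cnj_vec w"
  by (rule cvec_eqI; simp)+

lemma scale_right_simps:
  fixes w z :: "complex^'d"
  shows "a *s (w + z) = a *s w + a *s z" "a *s (w - z) = a *s w - a *s z" "a *s (- w) = - (a *s w)"
    "a *s (b *s w) = (a * b) *s w" "(a + b) *s w = a *s w + b *s w" "(a - b) *s w = a *s w - b *s w"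
    "a *s (0 :: complex^'d) = 0" "0 *s w = 0" "1 *s w = w" "(- a) *s w = - (a *s w)"
    "a *s (r *\<^sub>R w) = r *\<^sub>R (a *s w)"
  by (simp_all add: vec_eq_iff algebra_simps)

text \<open>The complex bilinear extension, as for \<open>bilinear_ext\<close>, of a bilinear map with vector values.\<close>
definition bil_ext ::
    "(real^'d \<Rightarrow> real^'d \<Rightarrow> real^'d) \<Rightarrow> complex^'d \<Rightarrow> complex^'d \<Rightarrow> complex^'d" where
  "bil_ext B w z =
     Complex_vec (B (Re_vec w) (Re_vec z) - B (Im_vec w) (Im_vec z))
                 (B (Re_vec w) (Im_vec z) + B (Im_vec w) (Re_vec z))"

lemma Re_Im_bil_ext [simp]:
  "Re_vec (bil_ext B w z) = B (Re_vec w) (Re_vec z) - B (Im_vec w) (Im_vec z)"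
  "Im_vec (bil_ext B w z) = B (Re_vec w) (Im_vec z) + B (Im_vec w) (Re_vec z)"
  by (simp_all add: bil_ext_def)

lemmas linear_simps = linear_add linear_diff linear_neg linear_scale linear_0
lemmas bilinear_simps = bilinear_ladd bilinear_radd bilinear_lsub bilinear_rsub bilinear_lneg
  bilinear_rneg bilinear_lmul bilinear_rmul bilinear_lzero bilinear_rzero

lemma linear_ext_complex_linear:
  assumes "linear L"
  shows "linear_ext L (w + z) = linear_ext L w + linear_ext L z"
    "linear_ext L (w - z) = linear_ext L w - linear_ext L z"
    "linear_ext L (- w) = - linear_ext L w"
    "linear_ext L 0 = 0"
    "linear_ext L (a *s w) = a *s linear_ext L w"
    "linear_ext L (cnj_vec w) = cnj_vec (linear_ext L w)"
    "linear_ext L (r *\<^sub>R w) = r *\<^sub>R linear_ext L w"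
  by (rule cvec_eqI; simp add: linear_simps[OF assms])+

lemma linear_linear_ext: "linear L \<Longrightarrow> linear (linear_ext L)"
  by (rule linearI) (simp_all add: linear_ext_complex_linear)

lemma bil_ext_complex_bilinear:
  assumes "bilinear B"
  shows "bil_ext B (w + w') z = bil_ext B w z + bil_ext B w' z"
    "bil_ext B (w - w') z = bil_ext B w z - bil_ext B w' z"
    "bil_ext B (- w) z = - bil_ext B w z"
    "bil_ext B 0 z = 0"
    "bil_ext B (a *s w) z = a *s bil_ext B w z"
    "bil_ext B (r *\<^sub>R w) z = r *\<^sub>R bil_ext B w z"
    "bil_ext B w (z + z') = bil_ext B w z + bil_ext B w z'"
    "bil_ext B w (z - z') = bil_ext B w z - bil_ext B w z'"
    "bil_ext B w (- z) = - bil_ext B w z"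
    "bil_ext B w 0 = 0"
    "bil_ext B w (a *s z) = a *s bil_ext B w z"
    "bil_ext B w (r *\<^sub>R z) = r *\<^sub>R bil_ext B w z"
    "bil_ext B (cnj_vec w) (cnj_vec z) = cnj_vec (bil_ext B w z)"
  by (rule cvec_eqI; simp add: bilinear_simps[OF assms] algebra_simps)+

lemma bilinear_bil_ext: "bilinear B \<Longrightarrow> bilinear (bil_ext B)"
  by (simp add: bilinear_def linear_iff bil_ext_complex_bilinear)

lemma bilinear_ext_complex_bilinear:
  assumes "bilinear B"
  shows "bilinear_ext B (w + w') z = bilinear_ext B w z + bilinear_ext B w' z"
    "bilinear_ext B (w - w') z = bilinear_ext B w z - bilinear_ext B w' z"
    "bilinear_ext B (- w) z = - bilinear_ext B w z"
    "bilinear_ext B 0 z = 0"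
    "bilinear_ext B (a *s w) z = a * bilinear_ext B w z"
    "bilinear_ext B (r *\<^sub>R w) z = r *\<^sub>R bilinear_ext B w z"
    "bilinear_ext B w (z + z') = bilinear_ext B w z + bilinear_ext B w z'"
    "bilinear_ext B w (z - z') = bilinear_ext B w z - bilinear_ext B w z'"
    "bilinear_ext B w (- z) = - bilinear_ext B w z"
    "bilinear_ext B w 0 = 0"
    "bilinear_ext B w (a *s z) = a * bilinear_ext B w z"
    "bilinear_ext B w (r *\<^sub>R z) = r *\<^sub>R bilinear_ext B w z"
    "bilinear_ext B (cnj_vec w) (cnj_vec z) = cnj (bilinear_ext B w z)"
  by (auto simp: bilinear_ext_def complex_eq_iff bilinear_simps[OF assms] algebra_simps)

lemma bilinear_bilinear_ext: "bilinear B \<Longrightarrow> bilinear (bilinear_ext B)"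
  by (simp add: bilinear_def linear_iff bilinear_ext_complex_bilinear)

text \<open>Complex linear extension of a real linear map into a complex vector space. It extends derivatives
  from real to complex directions, whereas \<open>linear_ext\<close> and \<open>bil_ext\<close> extend operators on vectors.\<close>
definition cext :: "(real^'d \<Rightarrow> complex^'e) \<Rightarrow> complex^'d \<Rightarrow> complex^'e" where
  "cext f w = f (Re_vec w) + \<i> *s f (Im_vec w)"

lemma cext_simps:
  assumes "linear f"
  shows "cext f (w + z) = cext f w + cext f z" "cext f (w - z) = cext f w - cext f z"
    "cext f (- w) = - cext f w" "cext f 0 = 0" "cext f (a *s w) = a *s cext f w"
    "cext f (r *\<^sub>R w) = r *\<^sub>R cext f w"
proof -
  note lin = linear_simps[OF assms]
  show "cext f (w + z) = cext f w + cext f z" "cext f (w - z) = cext f w - cext f z"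
    "cext f (- w) = - cext f w" "cext f 0 = 0" "cext f (r *\<^sub>R w) = r *\<^sub>R cext f w"
    by (simp_all add: cext_def lin algebra_simps scale_right_simps)
  show "cext f (a *s w) = a *s cext f w"
    by (rule cvec_eqI) (simp_all add: cext_def lin algebra_simps)
qed

lemma cext_add: "cext (\<lambda>v. f v + g v) w = cext f w + cext g w"
  by (simp add: cext_def scale_right_simps)

lemma cext_diff: "cext (\<lambda>v. f v - g v) w = cext f w - cext g w"
  by (simp add: cext_def scale_right_simps)

lemma cext_scale: "cext (\<lambda>v. a *s f v) w = a *s cext f w"
  by (simp add: cext_def scale_right_simps mult.commute)

lemma cext_const_0 [simp]: "cext (\<lambda>v. 0) w = 0"
  by (simp add: cext_def scale_right_simps)

lemma cext_linear_ext: "linear L \<Longrightarrow> cext (\<lambda>v. linear_ext L (f v)) w = linear_ext L (cext f w)"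
  by (simp add: cext_def linear_ext_complex_linear)

lemma cext_linear_family:
  assumes "\<And>u. linear (B u)"
  shows "cext (\<lambda>u. linear_ext (B u) z) w = bil_ext B w z"
  by (rule cvec_eqI) (simp_all add: cext_def)

lemma has_derivative_Complex_vec:
  assumes "(f has_derivative f') F" "(g has_derivative g') F"
  shows "((\<lambda>y. Complex_vec (f y) (g y)) has_derivative (\<lambda>v. Complex_vec (f' v) (g' v :: real^'d::finite))) F"
proof -
  have *: "Complex_vec u v = Complex_vec u 0 + Complex_vec 0 v" for u v :: "real^'d"
    by (rule cvec_eqI) simp_all
  show ?thesis
    by (subst (1 2) *) (intro has_derivative_add
        bounded_linear.has_derivative[OF bounded_linear_Complex_vec_left assms(1)]
        bounded_linear.has_derivative[OF bounded_linear_Complex_vec_right assms(2)])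
qed

lemma smooth_on_Complex_vec:
  assumes "open S" "smooth_on S f" "smooth_on S g"
  shows "smooth_on S (\<lambda>y. Complex_vec (f y) (g y :: real^'d::finite))"
proof -
  have *: "Complex_vec u v = Complex_vec u 0 + Complex_vec 0 v" for u v :: "real^'d"
    by (rule cvec_eqI) simp_all
  show ?thesis
    by (subst *) (intro smooth_on_add assms
        smooth_on_bounded_linear[OF bounded_linear_Complex_vec_left]
        smooth_on_bounded_linear[OF bounded_linear_Complex_vec_right])
qed

lemma smooth_on_linear_ext:
  fixes L :: "'a::euclidean_space \<Rightarrow> real^'d \<Rightarrow> real^'d::finite"
  assumes "open S" "\<And>v. smooth_on S (\<lambda>y. L y v)"
  shows "smooth_on S (\<lambda>y. linear_ext (L y) z)"
  unfolding linear_ext_def by (intro smooth_on_Complex_vec assms)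

lemma smooth_on_bil_ext:
  fixes B :: "'a::euclidean_space \<Rightarrow> real^'d \<Rightarrow> real^'d \<Rightarrow> real^'d::finite"
  assumes "open S" "\<And>u v. smooth_on S (\<lambda>y. B y u v)"
  shows "smooth_on S (\<lambda>y. bil_ext (B y) w z)"
  unfolding bil_ext_def by (intro smooth_on_Complex_vec smooth_on_add smooth_on_diff assms)

section \<open>Covariant derivatives in a coordinate patch\<close>

text \<open>An almost Kaehler structure as seen in one chart: \<open>\<Gamma>\<close> are the Christoffel symbols of the Levi-Civita
  connection of the metric \<open>h\<close>. The form \<open>h(J\<cdot>, \<cdot>)\<close>, whose closedness is assumed, is the symplectic form up
  to sign.\<close>
locale almost_kaehler_patch =
  fixes S :: "(real^'d::finite) set"
    and \<Gamma> :: "real^'d \<Rightarrow> real^'d \<Rightarrow> real^'d \<Rightarrow> real^'d"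
    and h :: "real^'d \<Rightarrow> real^'d \<Rightarrow> real^'d \<Rightarrow> real"
    and J :: "real^'d \<Rightarrow> real^'d \<Rightarrow> real^'d"
  assumes open_S: "open S"
    and \<Gamma>_bilinear: "y \<in> S \<Longrightarrow> bilinear (\<Gamma> y)"
    and \<Gamma>_sym: "y \<in> S \<Longrightarrow> \<Gamma> y u v = \<Gamma> y v u"
    and \<Gamma>_smooth: "smooth_on S (\<lambda>y. \<Gamma> y u v)"
    and h_bilinear: "y \<in> S \<Longrightarrow> bilinear (h y)"
    and h_sym: "y \<in> S \<Longrightarrow> h y u v = h y v u"
    and h_pos: "y \<in> S \<Longrightarrow> v \<noteq> 0 \<Longrightarrow> h y v v > 0"
    and h_smooth: "smooth_on S (\<lambda>y. h y u v)"
    and J_linear: "y \<in> S \<Longrightarrow> linear (J y)"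
    and J_J: "y \<in> S \<Longrightarrow> J y (J y v) = - v"
    and J_smooth: "smooth_on S (\<lambda>y. J y v)"
    and h_J: "y \<in> S \<Longrightarrow> h y (J y u) (J y v) = h y u v"
    and h_parallel: "y \<in> S \<Longrightarrow>
      frechet_derivative (\<lambda>y. h y u v) (at y) w = h y (\<Gamma> y w u) v + h y u (\<Gamma> y w v)"
    and closed: "y \<in> S \<Longrightarrow>
      frechet_derivative (\<lambda>y. h y (J y v) w) (at y) u
      + frechet_derivative (\<lambda>y. h y (J y w) u) (at y) v
      + frechet_derivative (\<lambda>y. h y (J y u) v) (at y) w = 0"
begin

definition dJ :: "real^'d \<Rightarrow> real^'d \<Rightarrow> real^'d \<Rightarrow> real^'d" where
  "dJ y u v = frechet_derivative (\<lambda>y. J y v) (at y) u"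

text \<open>The tensor \<open>(\<nabla>\<^sub>u J)v\<close>.\<close>
definition nabla_J :: "real^'d \<Rightarrow> real^'d \<Rightarrow> real^'d \<Rightarrow> real^'d" where
  "nabla_J y u v = dJ y u v + \<Gamma> y u (J y v) - J y (\<Gamma> y u v)"

lemma J_has_derivative: "y \<in> S \<Longrightarrow> ((\<lambda>y. J y v) has_derivative (\<lambda>u. dJ y u v)) (at y)"
  unfolding dJ_def by (rule smooth_on_has_derivative[OF J_smooth])

lemma dJ_smooth: "smooth_on S (\<lambda>y. dJ y u v)"
  unfolding dJ_def by (rule smooth_on_frechet_derivative[OF J_smooth])

lemma dJ_bilinear:
  assumes y: "y \<in> S" shows "bilinear (dJ y)"
proof -
  have "linear (\<lambda>u. dJ y u v)" for v by (rule has_derivative_linear[OF J_has_derivative[OF y]])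
  moreover have "linear (\<lambda>v. dJ y u v)" for u
  proof (rule linearI)
    fix v v' :: "real^'d" and r :: real
    have "((\<lambda>y. J y (v + v')) has_derivative (\<lambda>u. dJ y u v + dJ y u v')) (at y)"
      by (rule has_derivative_transform_within_open[OF has_derivative_add[OF J_has_derivative[OF y]
            J_has_derivative[OF y]] open_S y]) (simp add: linear_add[OF J_linear])
    from has_derivative_unique[OF this J_has_derivative[OF y]]
    show "dJ y u (v + v') = dJ y u v + dJ y u v'" by metis
    have "((\<lambda>y. J y (r *\<^sub>R v)) has_derivative (\<lambda>u. r *\<^sub>R dJ y u v)) (at y)"
      by (rule has_derivative_transform_within_open[OF has_derivative_scaleR_right[OF J_has_derivative[OF y]]
            open_S y]) (simp add: linear_scale[OF J_linear])
    from has_derivative_unique[OF this J_has_derivative[OF y]]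
    show "dJ y u (r *\<^sub>R v) = r *\<^sub>R dJ y u v" by metis
  qed
  ultimately show ?thesis by (simp add: bilinear_def)
qed

lemma nabla_J_bilinear: "y \<in> S \<Longrightarrow> bilinear (nabla_J y)"
proof -
  assume y: "y \<in> S"
  show ?thesis
    unfolding bilinear_def nabla_J_def
    by (auto intro!: linearI simp: bilinear_simps[OF dJ_bilinear[OF y]] bilinear_simps[OF \<Gamma>_bilinear[OF y]]
        linear_simps[OF J_linear[OF y]] algebra_simps)
qed

lemma h_J_skew: "y \<in> S \<Longrightarrow> h y (J y u) v = - h y u (J y v)"
  using h_J[of y u "J y v"] by (simp add: J_J bilinear_rneg[OF h_bilinear])

text \<open>Covariant differentiation of \<open>J\<^sup>2 = -1\<close>.\<close>
lemma nabla_J_anticommutes: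
  assumes y: "y \<in> S" shows "nabla_J y u (J y v) = - J y (nabla_J y u v)"
proof -
  have "((\<lambda>y. J y (J y v)) has_derivative (\<lambda>u. dJ y u (J y v) + J y (dJ y u v))) (at y)"
    by (rule has_derivative_linear_apply[OF open_S y J_linear J_has_derivative[OF y] J_has_derivative[OF y]])
  moreover have "((\<lambda>y. J y (J y v)) has_derivative (\<lambda>u. 0)) (at y)"
    by (rule has_derivative_transform_within_open[OF has_derivative_const[of "- v"] open_S y]) (simp add: J_J)
  ultimately have "(\<lambda>u. dJ y u (J y v) + J y (dJ y u v)) = (\<lambda>u. 0)" by (rule has_derivative_unique)
  then have "dJ y u (J y v) + J y (dJ y u v) = 0" by metis
  then show ?thesis
    by (simp add: nabla_J_def linear_simps[OF J_linear[OF y]] J_J[OF y] bilinear_simps[OF \<Gamma>_bilinear[OF y]]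
       algebra_simps add_eq_0_iff)
qed

text \<open>Since \<open>h\<close> is parallel, the derivative of \<open>h(J v, w)\<close> falls on \<open>J\<close> and on the two constant fields, whose
  covariant derivatives are given by \<open>\<Gamma>\<close>.\<close>
lemma derivative_h_J:
  assumes y: "y \<in> S"
  shows "frechet_derivative (\<lambda>y. h y (J y v) w) (at y) u
    = h y (nabla_J y u v) w + h y (J y (\<Gamma> y u v)) w + h y (J y v) (\<Gamma> y u w)"
proof -
  have "((\<lambda>y. h y (J y v) w) has_derivative
     (\<lambda>u. (\<lambda>b. frechet_derivative (\<lambda>y. h y b w) (at y)) (J y v) u + h y (dJ y u v) w)) (at y)"
    by (rule has_derivative_linear_apply[where M = "\<lambda>y b. h y b w", OF open_S y _
          smooth_on_has_derivative[OF h_smooth y] J_has_derivative[OF y]])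
       (use h_bilinear in \<open>simp add: bilinear_def\<close>)
  from frechet_derivative_eqI[OF this] show ?thesis
    by (simp add: h_parallel[OF y] nabla_J_def bilinear_simps[OF h_bilinear[OF y]])
qed

text \<open>Closedness of \<open>h(J\<cdot>, \<cdot>)\<close>, with ordinary derivatives replaced by covariant ones: in the cyclic sum
  the Christoffel terms cancel because \<open>\<Gamma>\<close> is symmetric.\<close>
lemma h_nabla_J_cyclic:
  assumes y: "y \<in> S" shows "h y (nabla_J y u v) w + h y (nabla_J y v w) u + h y (nabla_J y w u) v = 0"
proof -
  have *: "h y (J y (\<Gamma> y u v)) w = - h y (J y w) (\<Gamma> y v u)" for u v w
    using h_J_skew[OF y] h_sym[OF y] \<Gamma>_sym[OF y] by metis
  show ?thesis
    using closed[OF y, of v w u] *[of u v w] *[of v w u] *[of w u v]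
    by (simp add: derivative_h_J[OF y])
qed

lemma h_nondegenerate: "y \<in> S \<Longrightarrow> (\<And>w. h y v w = 0) \<Longrightarrow> v = 0"
  using h_pos[of y v] by force

text \<open>Write \<open>a(u,v,w) = h((\<nabla>\<^sub>u J)v, w)\<close>. Then \<open>a(u,Jv,w) = a(u,v,Jw)\<close>, and the cyclic identity for
  \<open>(u,v,w)\<close> minus the one for \<open>(u,Jv,Jw)\<close> plus those for \<open>(Ju,Jv,w)\<close> and \<open>(Ju,v,Jw)\<close> leaves exactly twice
  \<open>a(u,v,w) + a(Ju,Jv,w)\<close>.\<close>
lemma quasi_kaehler:
  assumes y: "y \<in> S" shows "nabla_J y u v + nabla_J y (J y u) (J y v) = 0"
proof (rule h_nondegenerate[OF y])
  fix w
  define a where "a = (\<lambda>u v w. h y (nabla_J y u v) w)"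
  have cyc: "a u v w + a v w u + a w u v = 0" for u v w
    unfolding a_def by (rule h_nabla_J_cyclic[OF y])
  have J1: "a u (J y v) w = a u v (J y w)" for u v w
    by (simp add: a_def nabla_J_anticommutes[OF y] bilinear_lneg[OF h_bilinear[OF y]] h_J_skew[OF y])
  have J2: "a u (J y v) (J y w) = - a u v w" for u v w
    using J1[of u v "J y w"]
    by (simp add: a_def J_J[OF y] bilinear_rneg[OF h_bilinear[OF y]])
  have neg: "a u v (- w) = - a u v w" "a u (- v) w = - a u v w" "a (- u) v w = - a u v w" for u v w
    by (simp_all add: a_def bilinear_simps[OF h_bilinear[OF y]] bilinear_simps[OF nabla_J_bilinear[OF y]])
  have "2 * (a u v w + a (J y u) (J y v) w) = 0"
    using cyc[of u v w] cyc[of u "J y v" "J y w"] cyc[of "J y u" "J y v" w] cyc[of "J y u" v "J y w"]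
    by (simp add: J1 J_J[OF y] neg)
  then show "h y (nabla_J y u v + nabla_J y (J y u) (J y v)) w = 0"
    by (simp add: a_def bilinear_ladd[OF h_bilinear[OF y]])
qed

abbreviation Jc :: "real^'d \<Rightarrow> complex^'d \<Rightarrow> complex^'d" where "Jc y \<equiv> linear_ext (J y)"
abbreviation \<Gamma>c :: "real^'d \<Rightarrow> complex^'d \<Rightarrow> complex^'d \<Rightarrow> complex^'d" where "\<Gamma>c y \<equiv> bil_ext (\<Gamma> y)"
abbreviation nabla_Jc :: "real^'d \<Rightarrow> complex^'d \<Rightarrow> complex^'d \<Rightarrow> complex^'d" where "nabla_Jc y \<equiv> bil_ext (nabla_J y)"
abbreviation dJc :: "real^'d \<Rightarrow> complex^'d \<Rightarrow> complex^'d \<Rightarrow> complex^'d" where "dJc y \<equiv> bil_ext (dJ y)"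

lemmas Jc_simps = linear_ext_complex_linear[OF J_linear]
lemmas \<Gamma>c_simps = bil_ext_complex_bilinear[OF \<Gamma>_bilinear]
lemmas nabla_Jc_simps = bil_ext_complex_bilinear[OF nabla_J_bilinear]

lemma Jc_Jc: "y \<in> S \<Longrightarrow> Jc y (Jc y w) = - w"
  by (rule cvec_eqI) (simp_all add: J_J)

lemma nabla_Jc_eq: "y \<in> S \<Longrightarrow> nabla_Jc y u z = dJc y u z + \<Gamma>c y u (Jc y z) - Jc y (\<Gamma>c y u z)"
  by (rule cvec_eqI) (simp_all add: nabla_J_def linear_simps[OF J_linear])

text \<open>Here \<open>J\<close> acts on the two arguments by \<open>-\<i>\<close> and \<open>\<i>\<close>, whose product is 1, so \<open>quasi_kaehler\<close> says that twice
  the tensor vanishes.\<close>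
lemma nabla_Jc_T01_T10:
  assumes y: "y \<in> S" and u: "u \<in> T01 J y" and z: "z \<in> T10 J y"
  shows "nabla_Jc y u z = 0"
proof -
  have "nabla_Jc y u z + nabla_Jc y (Jc y u) (Jc y z) = 0"
    by (rule cvec_eqI) (use quasi_kaehler[OF y] in \<open>simp_all add: algebra_simps add_eq_0_iff\<close>)
  moreover have "nabla_Jc y (Jc y u) (Jc y z) = nabla_Jc y u z"
    using u z by (simp add: T10_def T01_def nabla_Jc_simps[OF y] scale_right_simps)
  ultimately have "(2::complex) *s nabla_Jc y u z = 0" by (simp add: vec_eq_iff)
  then show ?thesis by simp
qed

lemma nabla_Jc_T10_in_T01:
  assumes y: "y \<in> S" and z: "z \<in> T10 J y"
  shows "nabla_Jc y u z \<in> T01 J y"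
proof -
  have "nabla_Jc y u (Jc y z) = - Jc y (nabla_Jc y u z)"
    by (rule cvec_eqI) (simp_all add: nabla_J_anticommutes[OF y] linear_simps[OF J_linear[OF y]])
  then have "\<i> *s nabla_Jc y u z = - Jc y (nabla_Jc y u z)" using z by (simp add: T10_def nabla_Jc_simps[OF y])
  then have "Jc y (nabla_Jc y u z) = - (\<i> *s nabla_Jc y u z)" by simp
  then show ?thesis by (simp add: T01_def scale_right_simps)
qed

definition Pi10 :: "real^'d \<Rightarrow> complex^'d \<Rightarrow> complex^'d" where
  "Pi10 y w = (1/2) *s (w - \<i> *s Jc y w)"

definition Pi01 :: "real^'d \<Rightarrow> complex^'d \<Rightarrow> complex^'d" where
  "Pi01 y w = (1/2) *s (w + \<i> *s Jc y w)"

lemma Pi_simps: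
  assumes y: "y \<in> S"
  shows "Pi10 y (w + z) = Pi10 y w + Pi10 y z" "Pi10 y (a *s w) = a *s Pi10 y w" "Pi10 y 0 = 0"
    "Pi10 y (r *\<^sub>R w) = r *\<^sub>R Pi10 y w" "Pi10 y (- w) = - Pi10 y w"
    "Pi01 y (w + z) = Pi01 y w + Pi01 y z" "Pi01 y (a *s w) = a *s Pi01 y w" "Pi01 y 0 = 0"
    "Pi01 y (r *\<^sub>R w) = r *\<^sub>R Pi01 y w" "Pi01 y (- w) = - Pi01 y w"
  by (simp_all add: Pi10_def Pi01_def Jc_simps[OF y] scale_right_simps algebra_simps)

lemma linear_Pi10: "y \<in> S \<Longrightarrow> linear (Pi10 y)"
  by (rule linearI) (simp_all add: Pi_simps)

lemma Pi10_in_T10: "y \<in> S \<Longrightarrow> Pi10 y w \<in> T10 J y"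
  by (simp add: T10_def Pi10_def Jc_simps Jc_Jc scale_right_simps)

lemma Pi01_in_T01: "y \<in> S \<Longrightarrow> Pi01 y w \<in> T01 J y"
  by (simp add: T01_def Pi01_def Jc_simps Jc_Jc scale_right_simps)

lemma Pi10_T10: "w \<in> T10 J y \<Longrightarrow> Pi10 y w = w"
  by (simp add: T10_def Pi10_def vec_eq_iff)

lemma Pi01_T01: "w \<in> T01 J y \<Longrightarrow> Pi01 y w = w"
  by (simp add: T01_def Pi01_def vec_eq_iff)

lemma Pi10_T01: "w \<in> T01 J y \<Longrightarrow> Pi10 y w = 0"
  by (simp add: T01_def Pi10_def vec_eq_iff)

lemma Jc_smooth: "smooth_on S (\<lambda>y. Jc y z)"
  by (rule smooth_on_linear_ext[OF open_S J_smooth])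

lemma Pi_smooth: "smooth_on S (\<lambda>y. Pi10 y z)" "smooth_on S (\<lambda>y. Pi01 y z)"
  unfolding Pi10_def Pi01_def
  by (intro smooth_on_bounded_linear[OF bounded_linear_scale] smooth_on_diff smooth_on_add
      smooth_on_const open_S Jc_smooth)+

lemma Jc_has_derivative:
  assumes y: "y \<in> S" and F: "(F has_derivative F') (at y)"
  shows "((\<lambda>y. Jc y (F y)) has_derivative (\<lambda>v. linear_ext (dJ y v) (F y) + Jc y (F' v))) (at y)"
proof (rule has_derivative_linear_apply[where M = "Jc", OF open_S y linear_linear_ext[OF J_linear] _ F])
  show "((\<lambda>y. Jc y b) has_derivative (\<lambda>v. linear_ext (dJ y v) b)) (at y)" for b
    unfolding linear_ext_def by (intro has_derivative_Complex_vec J_has_derivative[OF y])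
qed

lemma Pi_has_derivative:
  assumes y: "y \<in> S" and F: "(F has_derivative F') (at y)"
  shows "((\<lambda>y. Pi10 y (F y)) has_derivative
      (\<lambda>v. (- (\<i>/2)) *s linear_ext (dJ y v) (F y) + Pi10 y (F' v))) (at y)" (is ?A)
    and "((\<lambda>y. Pi01 y (F y)) has_derivative
      (\<lambda>v. (\<i>/2) *s linear_ext (dJ y v) (F y) + Pi01 y (F' v))) (at y)" (is ?B)
proof -
  note J' = Jc_has_derivative[OF y F]
  have "((\<lambda>y. Pi10 y (F y)) has_derivative
      (\<lambda>v. (1/2) *s (F' v - \<i> *s (linear_ext (dJ y v) (F y) + Jc y (F' v))))) (at y)"
    unfolding Pi10_def
    by (intro bounded_linear.has_derivative[OF bounded_linear_scale] has_derivative_diff F J')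
  then show ?A by (simp add: Pi10_def scale_right_simps algebra_simps)
  have "((\<lambda>y. Pi01 y (F y)) has_derivative
      (\<lambda>v. (1/2) *s (F' v + \<i> *s (linear_ext (dJ y v) (F y) + Jc y (F' v))))) (at y)"
    unfolding Pi01_def
    by (intro bounded_linear.has_derivative[OF bounded_linear_scale] has_derivative_add F J')
  then show ?B by (simp add: Pi01_def scale_right_simps algebra_simps)
qed

text \<open>The covariant derivative of a complex field along a complex vector; it is complex linear in
  the vector and, over constants, in the field.\<close>
definition cnabla :: "real^'d \<Rightarrow> complex^'d \<Rightarrow> (real^'d \<Rightarrow> complex^'d) \<Rightarrow> complex^'d" where
  "cnabla y w F = cext (frechet_derivative F (at y)) w + \<Gamma>c y w (F y)"

lemma cnabla_eq: "(F has_derivative F') (at y) \<Longrightarrow> cnabla y w F = cext F' w + \<Gamma>c y w (F y)"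
  by (simp add: cnabla_def frechet_derivative_eqI)

lemma cnabla_direction:
  assumes "y \<in> S" "(F has_derivative F') (at y)"
  shows "cnabla y (w + z) F = cnabla y w F + cnabla y z F" "cnabla y (a *s w) F = a *s cnabla y w F"
    "cnabla y (r *\<^sub>R w) F = r *\<^sub>R cnabla y w F" "cnabla y (- w) F = - cnabla y w F"
  by (simp_all add: cnabla_eq[OF assms(2)] cext_simps[OF has_derivative_linear[OF assms(2)]]
      \<Gamma>c_simps[OF assms(1)] scale_right_simps algebra_simps)

lemma linear_cnabla: "y \<in> S \<Longrightarrow> (F has_derivative F') (at y) \<Longrightarrow> linear (\<lambda>w. cnabla y w F)"
  by (rule linearI) (simp_all add: cnabla_direction)

lemma cnabla_add:
  assumes "y \<in> S" "(F has_derivative F') (at y)" "(G has_derivative G') (at y)"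
  shows "cnabla y w (\<lambda>y. F y + G y) = cnabla y w F + cnabla y w G"
  by (simp add: cnabla_eq[OF assms(2)] cnabla_eq[OF assms(3)] cnabla_eq[OF has_derivative_add[OF assms(2,3)]]
     cext_add \<Gamma>c_simps[OF assms(1)])

lemma cnabla_scale:
  assumes "y \<in> S" "(F has_derivative F') (at y)"
  shows "cnabla y w (\<lambda>y. a *s F y) = a *s cnabla y w F"
  by (simp add: cnabla_eq[OF assms(2)] cnabla_eq[OF bounded_linear.has_derivative[OF bounded_linear_scale assms(2)]]
     cext_scale \<Gamma>c_simps[OF assms(1)] scale_right_simps)

lemma cnabla_cong:
  assumes "open V" "y \<in> V" "\<And>z. z \<in> V \<Longrightarrow> F z = G z" "(F has_derivative F') (at y)"
  shows "cnabla y w F = cnabla y w G"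
  using cnabla_eq[OF has_derivative_transform_within_open[OF assms(4,1,2,3)]] cnabla_eq[OF assms(4)] assms(2,3)
  by metis

lemma cnabla_J:
  assumes y: "y \<in> S" and F: "(F has_derivative F') (at y)"
  shows "cnabla y w (\<lambda>y. Jc y (F y)) = nabla_Jc y w (F y) + Jc y (cnabla y w F)"
proof -
  have "cext (\<lambda>v. linear_ext (dJ y v) (F y)) w = dJc y w (F y)"
    by (rule cext_linear_family) (use dJ_bilinear[OF y] in \<open>auto simp: bilinear_def\<close>)
  then show ?thesis
    by (simp add: cnabla_eq[OF F] cnabla_eq[OF Jc_has_derivative[OF y F]] cext_add
        cext_linear_ext[OF J_linear[OF y]] nabla_Jc_eq[OF y] Jc_simps[OF y])
qed

lemma cnabla_smooth:
  assumes F: "smooth_on S F" and W: "smooth_on S W"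
  shows "smooth_on S (\<lambda>y. cnabla y (W y) F)"
proof (rule smooth_on_linear_apply[where M = "\<lambda>y w. cnabla y w F", OF open_S _ _ W])
  show "linear (\<lambda>w. cnabla y w F)" if "y \<in> S" for y
    by (rule linear_cnabla[OF that smooth_on_has_derivative[OF F that]])
  show "smooth_on S (\<lambda>y. cnabla y w F)" for w
  proof -
    have "smooth_on S (\<lambda>y. \<Gamma>c y w (F y))"
      by (rule smooth_on_bilinear_apply[where B = \<Gamma>c, OF open_S bilinear_bil_ext[OF \<Gamma>_bilinear]
            smooth_on_bil_ext[OF open_S \<Gamma>_smooth] smooth_on_const[OF open_S] F])
    then show ?thesis
      unfolding cnabla_def cext_def
      by (intro smooth_on_add open_S smooth_on_bounded_linear[OF bounded_linear_scale]
         smooth_on_frechet_derivative F)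
  qed
qed

text \<open>Differentiating \<open>J F = \<i> F\<close> gives \<open>(\<nabla>\<^sub>w J)F + J \<nabla>\<^sub>w F = \<i> \<nabla>\<^sub>w F\<close>. The first term vanishes when \<open>w\<close> is of
  type (0,1), and also where \<open>F\<close> vanishes.\<close>
lemma cnabla_T10_section:
  assumes y: "y \<in> S" and F: "(F has_derivative F') (at y)" and T: "\<And>z. z \<in> S \<Longrightarrow> F z \<in> T10 J z"
    and "nabla_Jc y w (F y) = 0"
  shows "cnabla y w F \<in> T10 J y"
proof -
  have "cnabla y w (\<lambda>z. \<i> *s F z) = cnabla y w (\<lambda>z. Jc z (F z))"
    by (rule cnabla_cong[OF open_S y _ bounded_linear.has_derivative[OF bounded_linear_scale F]])
       (use T in \<open>simp add: T10_def\<close>)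
  then show ?thesis
    by (simp add: cnabla_scale[OF y F] cnabla_J[OF y F] assms(4) T10_def)
qed

section \<open>Sections of type (1,0) with prescribed derivatives\<close>

text \<open>The section is the projection to type (1,0) of a field whose components are affine functions, the
  linear part being chosen so that the (1,0) part of its covariant derivative at \<open>p\<close> is zero. What
  remains is the (0,1) part, which the tensor \<open>\<nabla>J\<close> dictates; in particular the derivative vanishes in
  (0,1) directions.\<close>
lemma first_order_section:
  assumes p: "p \<in> S" and w: "w \<in> T10 J p"
  shows "\<exists>W. smooth_on S W \<and> (\<forall>y\<in>S. W y \<in> T10 J y) \<and> W p = w \<and>
    (\<forall>u. cnabla p u W = (- (\<i>/2)) *s nabla_Jc p u w)"
proof -
  \<comment> \<open>The (1,0) part of the connection term, which the derivative of the affine field must cancel.\<close>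
  define L where "L v = - Pi10 p (\<Gamma>c p (Complex_vec v 0) w)" for v
  have linL: "linear L" unfolding L_def
  proof (rule linearI)
    fix u v :: "real^'d" and r :: real
    have a: "Complex_vec (u + v) 0 = Complex_vec u 0 + Complex_vec v 0"
      and b: "Complex_vec (r *\<^sub>R v) 0 = r *\<^sub>R Complex_vec v 0" by (rule cvec_eqI; simp)+
    show "- Pi10 p (\<Gamma>c p (Complex_vec (u + v) 0) w) =
      - Pi10 p (\<Gamma>c p (Complex_vec u 0) w) + - Pi10 p (\<Gamma>c p (Complex_vec v 0) w)"
      by (simp add: a \<Gamma>c_simps[OF p] Pi_simps[OF p])
    show "- Pi10 p (\<Gamma>c p (Complex_vec (r *\<^sub>R v) 0) w) = r *\<^sub>R - Pi10 p (\<Gamma>c p (Complex_vec v 0) w)"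
      by (simp add: b \<Gamma>c_simps[OF p] Pi_simps[OF p])
  qed
  then have bL: "bounded_linear L" by (simp add: linear_conv_bounded_linear)
  define F where "F y = w + L (y - p)" for y
  have F': "(F has_derivative L) (at y)" for y
    unfolding F_def by (rule derivative_eq_intros bounded_linear.has_derivative[OF bL] refl | simp)+
  have Fp: "F p = w" by (simp add: F_def linear_0[OF linL])
  define W where "W y = Pi10 y (F y)" for y
  have sF: "smooth_on S F" unfolding F_def
    by (intro smooth_on_add smooth_on_const smooth_on_bounded_linear[OF bL] smooth_on_diff smooth_on_ident open_S)
  have "smooth_on S W" unfolding W_def
    by (rule smooth_on_linear_apply[where M = Pi10, OF open_S linear_Pi10 Pi_smooth(1) sF])
  moreover have "\<forall>y\<in>S. W y \<in> T10 J y" by (simp add: W_def Pi10_in_T10)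
  moreover have Wp: "W p = w" by (simp add: W_def Fp Pi10_T10[OF w])
  moreover have "cnabla p u W = (- (\<i>/2)) *s nabla_Jc p u w" for u
  proof -
    have W': "(W has_derivative (\<lambda>v. (- (\<i>/2)) *s linear_ext (dJ p v) w + Pi10 p (L v))) (at p)"
      using Pi_has_derivative(1)[OF p F'] by (simp add: W_def[abs_def] Fp)
    have dj: "cext (\<lambda>v. linear_ext (dJ p v) w) u = dJc p u w"
      by (rule cext_linear_family) (use dJ_bilinear[OF p] in \<open>auto simp: bilinear_def\<close>)
    have "Pi10 p (L v) = - Pi10 p (\<Gamma>c p (Complex_vec v 0) w)" for v
      by (simp add: L_def Pi_simps[OF p] Pi10_T10[OF Pi10_in_T10[OF p]])
    moreover have "u = Complex_vec (Re_vec u) 0 + \<i> *s Complex_vec (Im_vec u) 0" by (rule cvec_eqI) simp_all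
    then have "\<Gamma>c p u w = \<Gamma>c p (Complex_vec (Re_vec u) 0) w + \<i> *s \<Gamma>c p (Complex_vec (Im_vec u) 0) w"
      using \<Gamma>c_simps(1,5)[OF p] by metis
    ultimately have "cext (\<lambda>v. Pi10 p (L v)) u = - Pi10 p (\<Gamma>c p u w)"
      by (simp add: cext_def Pi_simps[OF p] scale_right_simps)
    then have "cnabla p u W = (- (\<i>/2)) *s dJc p u w - Pi10 p (\<Gamma>c p u w) + \<Gamma>c p u w"
      by (simp add: cnabla_eq[OF W'] cext_add cext_diff cext_scale dj Wp)
    also have "\<dots> = (- (\<i>/2)) *s nabla_Jc p u w"
    proof -
      have Jw: "Jc p w = \<i> *s w" using w by (simp add: T10_def)
      show ?thesis unfolding nabla_Jc_eq[OF p] Pi10_def Jw \<Gamma>c_simps(11)[OF p]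
        by (simp add: vec_eq_iff field_simps)
    qed
    finally show ?thesis .
  qed
  ultimately show ?thesis by blast
qed

text \<open>Two fields of type (0,1) with the same value at \<open>p\<close> have derivatives at \<open>p\<close> that differ by a vector of type
  (0,1), as differentiating \<open>X = Pi01 X\<close> shows, and the covariant derivative of \<open>W\<close> vanishes in such directions.
  So the iterated derivative depends on \<open>X\<close> only through its value at \<open>p\<close>.\<close>
lemma cnabla_constant_direction:
  assumes p: "p \<in> S" and W: "smooth_on S W" and X: "(X has_derivative X') (at p)"
    and X01: "\<And>y. y \<in> S \<Longrightarrow> X y \<in> T01 J y"
    and W0: "\<And>u. u \<in> T01 J p \<Longrightarrow> cnabla p u W = 0"
  shows "cnabla p u (\<lambda>y. cnabla y (X y) W) = cnabla p u (\<lambda>y. cnabla y (Pi01 y (X p)) W)"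
    and "(\<lambda>y. cnabla y (X y) W) differentiable (at p)"
proof -
  define M where "M = (\<lambda>y z. cnabla y z W)"
  let ?M' = "\<lambda>z. frechet_derivative (\<lambda>y. M y z) (at p)"
  have linM: "linear (M y)" if "y \<in> S" for y
    unfolding M_def by (rule linear_cnabla[OF that smooth_on_has_derivative[OF W that]])
  have M': "((\<lambda>y. M y z) has_derivative ?M' z) (at p)" for z
    unfolding M_def by (rule smooth_on_has_derivative[OF cnabla_smooth[OF W smooth_on_const[OF open_S]] p])
  define P' where "P' v = (\<i>/2) *s linear_ext (dJ p v) (X p) + Pi01 p 0" for v
  have 1: "((\<lambda>y. M y (X y)) has_derivative (\<lambda>v. ?M' (X p) v + M p (X' v))) (at p)"
    by (rule has_derivative_linear_apply[OF open_S p linM M' X])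
  have P': "((\<lambda>y. Pi01 y (X p)) has_derivative P') (at p)"
    unfolding P'_def by (rule Pi_has_derivative(2)[OF p has_derivative_const])
  have 2: "((\<lambda>y. M y (Pi01 y (X p))) has_derivative (\<lambda>v. ?M' (X p) v + M p (P' v))) (at p)"
    using has_derivative_linear_apply[OF open_S p linM M' P'] Pi01_T01[OF X01[OF p]] by simp
  have "(X has_derivative (\<lambda>v. (\<i>/2) *s linear_ext (dJ p v) (X p) + Pi01 p (X' v))) (at p)"
    by (rule has_derivative_transform_within_open[OF Pi_has_derivative(2)[OF p X] open_S p])
       (simp add: Pi01_T01[OF X01])
  \<comment> \<open>\<open>P'\<close> is the derivative at \<open>p\<close> of the projected constant field, so \<open>X'\<close> and \<open>P'\<close> differ by a
    vector of type (0,1).\<close>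
  from has_derivative_unique[OF X this]
  have "X' v = P' v + Pi01 p (X' v)" for v
    by (simp add: P'_def Pi_simps[OF p]) metis
  then have "M p (X' v) = M p (P' v) + M p (Pi01 p (X' v))" for v
    using linear_add[OF linM[OF p]] by metis
  then have "M p (X' v) = M p (P' v)" for v
    using W0[OF Pi01_in_T01[OF p]] by (simp add: M_def)
  then show "cnabla p u (\<lambda>y. cnabla y (X y) W) = cnabla p u (\<lambda>y. cnabla y (Pi01 y (X p)) W)"
    using cnabla_eq[OF 1, of u] cnabla_eq[OF 2, of u] Pi01_T01[OF X01[OF p]] by (simp add: M_def)
  show "(\<lambda>y. cnabla y (X y) W) differentiable (at p)"
    using 1 by (auto simp: M_def differentiable_def)
qed

text \<open>Let \<open>R\<close> be the (1,0) part of the quadratic field \<open>C(Pi10 v, Pi01 v)\<close> with \<open>v = y - p\<close>. It vanishes to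
  second order, so its iterated covariant derivative at \<open>p\<close> along \<open>u\<close> and \<open>X\<close> is an ordinary second
  derivative, the polarisation \<open>C(Pi10 u, Pi01 X) + C(Pi10 X, Pi01 u)\<close>. For \<open>u\<close> of type (1,0) and \<open>X\<close> of
  type (0,1) only \<open>C(u, X)\<close> survives. As the field is complex valued, any complex bilinear \<open>C\<close> with
  values of type (1,0) can be reached in this way.\<close>
lemma quadratic_correction:
  fixes C :: "complex^'d \<Rightarrow> complex^'d \<Rightarrow> complex^'d"
  assumes p: "p \<in> S"
    and C_left: "\<And>u u' w. C (u + u') w = C u w + C u' w" "\<And>a u w. C (a *s u) w = a *s C u w"
    and C_right: "\<And>u w w'. C u (w + w') = C u w + C u w'" "\<And>a u w. C u (a *s w) = a *s C u w"
    and C10: "\<And>u w. C u w \<in> T10 J p"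
  shows "\<exists>R. smooth_on S R \<and> (\<forall>y\<in>S. R y \<in> T10 J y) \<and> R p = 0 \<and> (R has_derivative (\<lambda>v. 0)) (at p) \<and>
    (\<forall>X X'. (X has_derivative X') (at p) \<longrightarrow> X p \<in> T01 J p \<longrightarrow>
      (\<lambda>y. cnabla y (X y) R) differentiable (at p) \<and>
      (\<forall>u\<in>T10 J p. cnabla p u (\<lambda>y. cnabla y (X y) R) = C u (X p)))"
proof -
  define \<beta> where "\<beta> a b = C (Pi10 p (Complex_vec a 0)) (Pi01 p (Complex_vec b 0))" for a b
  have cv: "Complex_vec (a + b) 0 = Complex_vec a 0 + Complex_vec b 0"
    "Complex_vec (r *\<^sub>R a) 0 = complex_of_real r *s Complex_vec a 0" for a b :: "real^'d" and r
    by (rule cvec_eqI; simp)+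
  have rs: "complex_of_real r *s z = r *\<^sub>R z" for r and z :: "complex^'d"
    by (rule cvec_eqI) simp_all
  have CR: "C (r *\<^sub>R u) z = r *\<^sub>R C u z" "C u (r *\<^sub>R z) = r *\<^sub>R C u z" for r u z
    using C_left(2)[of "complex_of_real r" u z] C_right(2)[of u "complex_of_real r" z] by (simp_all add: rs)
  have "bilinear \<beta>"
    unfolding bilinear_def \<beta>_def
    by (auto intro!: linearI simp: cv Pi_simps[OF p] C_left C_right CR rs)
  then have \<beta>: "bounded_bilinear \<beta>" by (simp add: bilinear_conv_bounded_bilinear)
  interpret \<beta>: bounded_bilinear \<beta> by (rule \<beta>)
  define Q where "Q y = \<beta> (y - p) (y - p)" for y
  define Q' where "Q' y v = \<beta> (y - p) v + \<beta> v (y - p)" for y v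
  have Q': "(Q has_derivative Q' y) (at y)" for y
  proof -
    have "((\<lambda>y. y - p) has_derivative (\<lambda>v. v)) (at y)"
      by (rule derivative_eq_intros refl | simp)+
    from \<beta>.FDERIV[OF this this] show ?thesis by (simp add: Q_def[abs_def] Q'_def[abs_def])
  qed
  have Qp: "Q p = 0" "Q' p = (\<lambda>v. 0)" by (auto simp: Q_def Q'_def \<beta>.zero_left \<beta>.zero_right)
  have sQ: "smooth_on S Q" unfolding Q_def
    by (rule smooth_on_bilinear_apply[OF open_S _ smooth_on_const])
       (intro \<open>bilinear \<beta>\<close> smooth_on_diff smooth_on_ident smooth_on_const open_S)+
  define R where "R y = Pi10 y (Q y)" for y
  define R' where "R' y v = (- (\<i>/2)) *s linear_ext (dJ y v) (Q y) + Pi10 y (Q' y v)" for y v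
  have R': "(R has_derivative R' y) (at y)" if "y \<in> S" for y
    unfolding R_def[abs_def] R'_def[abs_def] by (rule Pi_has_derivative(1)[OF that Q'])
  have sR: "smooth_on S R" unfolding R_def
    by (rule smooth_on_linear_apply[where M = Pi10, OF open_S linear_Pi10 Pi_smooth(1) sQ])
  have Rp: "R p = 0" by (simp add: R_def Qp Pi_simps[OF p])
  have "linear_ext (dJ p v) 0 = 0" for v
    by (rule cvec_eqI) (simp_all add: bilinear_rzero[OF dJ_bilinear[OF p]])
  then have R'p: "R' p = (\<lambda>v. 0)"
    by (auto simp: R'_def Qp Pi_simps[OF p])
  have main: "(\<lambda>y. cnabla y (X y) R) differentiable (at p)"
    "u \<in> T10 J p \<Longrightarrow> cnabla p u (\<lambda>y. cnabla y (X y) R) = C u (X p)"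
    if X: "(X has_derivative X') (at p)" and X01: "X p \<in> T01 J p" for X X' u
  proof -
    \<comment> \<open>The derivative of \<open>Q\<close> along the complex vector \<open>X y\<close>. The remaining terms of the covariant
      derivative of \<open>R\<close> contain \<open>Q\<close> or \<open>R\<close> undifferentiated and so vanish to second order at \<open>p\<close>.\<close>
    define K where "K y = Q' y (Re_vec (X y)) + \<i> *s Q' y (Im_vec (X y))" for y
    have exp: "cnabla y (X y) R = (- (\<i>/2)) *s dJc y (X y) (Q y) + Pi10 y (K y) + \<Gamma>c y (X y) (R y)"
      if y: "y \<in> S" for y
    proof -
      have "cext (\<lambda>v. linear_ext (dJ y v) (Q y)) (X y) = dJc y (X y) (Q y)"
        by (rule cext_linear_family) (use dJ_bilinear[OF y] in \<open>auto simp: bilinear_def\<close>)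
      moreover have "cext (\<lambda>v. Pi10 y (Q' y v)) (X y) = Pi10 y (K y)"
        by (simp add: cext_def K_def Pi_simps[OF y])
      ultimately show ?thesis
        by (simp add: cnabla_eq[OF R'[OF y]] R'_def[abs_def] cext_add cext_diff cext_scale)
    qed
    define K' where "K' v = \<beta> v (Re_vec (X p)) + \<beta> (Re_vec (X p)) v
       + \<i> *s (\<beta> v (Im_vec (X p)) + \<beta> (Im_vec (X p)) v)" for v
    have id': "((\<lambda>y. y - p) has_derivative (\<lambda>v. v)) (at p)"
      by (rule derivative_eq_intros refl | simp)+
    have Q'': "((\<lambda>y. Q' y (f y)) has_derivative (\<lambda>v. \<beta> v (f p) + \<beta> (f p) v)) (at p)"
      if f: "(f has_derivative f') (at p)" for f f'
      unfolding Q'_def using has_derivative_add[OF \<beta>.FDERIV[OF id' f] \<beta>.FDERIV[OF f id']]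
      by (simp add: \<beta>.zero_left \<beta>.zero_right)
    have K': "(K has_derivative K') (at p)"
      unfolding K_def[abs_def] K'_def[abs_def]
      by (intro has_derivative_add bounded_linear.has_derivative[OF bounded_linear_scale]
          Q''[OF bounded_linear.has_derivative[OF bounded_linear_Re_vec X]]
          Q''[OF bounded_linear.has_derivative[OF bounded_linear_Im_vec X]])
    have Kp: "K p = 0" by (simp add: K_def Qp scale_right_simps)
    have K'_eq: "K' v = C (Pi10 p (Complex_vec v 0)) (X p)" for v
    proof -
      have X_eq: "X p = Complex_vec (Re_vec (X p)) 0 + \<i> *s Complex_vec (Im_vec (X p)) 0"
        by (rule cvec_eqI) simp_all
      have "K' v = C (Pi10 p (Complex_vec v 0)) (Pi01 p (X p))
         + C (Pi10 p (X p)) (Pi01 p (Complex_vec v 0))"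
        by (subst (1 2) X_eq) (simp add: K'_def \<beta>_def Pi_simps[OF p] C_left C_right scale_right_simps algebra_simps)
      moreover have "C 0 z = 0" for z using C_left(2)[of 0 0 z] by (simp add: scale_right_simps)
      ultimately show ?thesis using X01 by (simp add: Pi01_T01 Pi10_T01)
    qed
    have "linear_ext (dJ p v) 0 = 0" for v
      by (rule cvec_eqI) (simp_all add: bilinear_rzero[OF dJ_bilinear[OF p]])
    then have PK: "((\<lambda>y. Pi10 y (K y)) has_derivative (\<lambda>v. Pi10 p (K' v))) (at p)"
      using Pi_has_derivative(1)[OF p K'] by (simp add: Kp scale_right_simps)
    have "Pi10 p (K' v) = K' v" for v using C10 by (simp add: K'_eq Pi10_T10)
    note PK = PK[unfolded this]
    have d1: "((\<lambda>y. dJc y (X y) (Q y)) has_derivative (\<lambda>v. 0)) (at p)"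
      by (rule has_derivative_bilinear_vanishing[OF open_S p bilinear_bil_ext[OF dJ_bilinear]
          smooth_on_bil_ext[OF open_S dJ_smooth] X Q'[of p, unfolded Qp] Qp(1)])
    have d2: "((\<lambda>y. \<Gamma>c y (X y) (R y)) has_derivative (\<lambda>v. 0)) (at p)"
      by (rule has_derivative_bilinear_vanishing[OF open_S p bilinear_bil_ext[OF \<Gamma>_bilinear]
          smooth_on_bil_ext[OF open_S \<Gamma>_smooth] X R'[OF p, unfolded R'p] Rp])
    have "((\<lambda>y. (- (\<i>/2)) *s dJc y (X y) (Q y) + Pi10 y (K y) + \<Gamma>c y (X y) (R y)) has_derivative
       (\<lambda>v. (- (\<i>/2)) *s 0 + K' v + 0)) (at p)"
      by (intro has_derivative_add bounded_linear.has_derivative[OF bounded_linear_scale d1] PK d2)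
    then have D: "((\<lambda>y. cnabla y (X y) R) has_derivative K') (at p)"
      by (rule has_derivative_transform_within_open[OF _ open_S p, THEN has_derivative_eq_rhs])
         (auto simp: exp scale_right_simps)
    then show "(\<lambda>y. cnabla y (X y) R) differentiable (at p)" by (auto simp: differentiable_def)
    assume u: "u \<in> T10 J p"
    have "cnabla p (X p) R = 0"
      using R'[OF p] by (simp add: R'p cnabla_eq[OF R'[OF p]] Rp \<Gamma>c_simps[OF p])
    then have "cnabla p u (\<lambda>y. cnabla y (X y) R) = cext K' u"
      by (simp add: cnabla_eq[OF D] \<Gamma>c_simps[OF p])
    also have "\<dots> = C (Pi10 p u) (X p)"
    proof -
      have "u = Complex_vec (Re_vec u) 0 + \<i> *s Complex_vec (Im_vec u) 0" by (rule cvec_eqI) simp_all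
      then have "Pi10 p u = Pi10 p (Complex_vec (Re_vec u) 0) + \<i> *s Pi10 p (Complex_vec (Im_vec u) 0)"
        using Pi_simps(1,2)[OF p] by metis
      then show ?thesis by (simp add: cext_def K'_eq C_left)
    qed
    finally show "cnabla p u (\<lambda>y. cnabla y (X y) R) = C u (X p)" by (simp add: Pi10_T10[OF u])
  qed
  show ?thesis
    using sR Rp R'[OF p] main
    by (intro exI[of _ R]) (auto simp: R_def Pi10_in_T10 R'p)
qed

text \<open>Let \<open>W\<close> be the section of \<open>first_order_section\<close>. Its derivative along a field of type (0,1) is a
  section of type (1,0) that vanishes at \<open>p\<close>; hence the iterated derivative that has to be removed is of
  type (1,0) and complex bilinear in the two directions, and \<open>quadratic_correction\<close> removes it.\<close>
lemma second_order_section: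
  assumes p: "p \<in> S" and w: "w \<in> T10 J p"
  shows "\<exists>W. smooth_on S W \<and> (\<forall>y\<in>S. W y \<in> T10 J y) \<and> W p = w \<and>
    (\<forall>u. cnabla p u W = (- (\<i>/2)) *s nabla_Jc p u w) \<and>
    (\<forall>X X'. (X has_derivative X') (at p) \<longrightarrow> (\<forall>y\<in>S. X y \<in> T01 J y) \<longrightarrow>
      (\<forall>u\<in>T10 J p. cnabla p u (\<lambda>y. cnabla y (X y) W) = 0))"
proof -
  obtain W where W: "smooth_on S W" "\<And>y. y \<in> S \<Longrightarrow> W y \<in> T10 J y" "W p = w"
    and Wd: "\<And>u. cnabla p u W = (- (\<i>/2)) *s nabla_Jc p u w"
    using first_order_section[OF p w] by blast
  have W0: "cnabla p u W = 0" if "u \<in> T01 J p" for u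
    by (simp add: Wd nabla_Jc_T01_T10[OF p that w] scale_right_simps)
  have W': "(W has_derivative frechet_derivative W (at y)) (at y)" if "y \<in> S" for y
    by (rule smooth_on_has_derivative[OF W(1) that])
  define V where "V z = (\<lambda>y. cnabla y (Pi01 y z) W)" for z
  have sV: "smooth_on S (V z)" for z
    unfolding V_def by (rule cnabla_smooth[OF W(1) Pi_smooth(2)])
  note V' = smooth_on_has_derivative[OF sV p]
  have Vp: "V z p = 0" for z unfolding V_def by (rule W0[OF Pi01_in_T01[OF p]])
  have V10: "V z y \<in> T10 J y" if y: "y \<in> S" for y z
    unfolding V_def
    by (rule cnabla_T10_section[OF y W'[OF y] W(2)])
       (auto intro!: nabla_Jc_T01_T10 y Pi01_in_T01 W(2))
  \<comment> \<open>The sign makes \<open>C\<close> the iterated derivative that the correction must have.\<close>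
  define C where "C u z = - cnabla p u (V z)" for u z
  have C_right: "C u (z + z') = C u z + C u z'" for u z z'
  proof -
    have "cnabla p u (V (z + z')) = cnabla p u (\<lambda>y. V z y + V z' y)"
      by (rule cnabla_cong[OF open_S p _ V'])
         (simp add: V_def Pi_simps cnabla_direction[OF _ W'])
    then show ?thesis by (simp add: C_def cnabla_add[OF p V' V'])
  qed
  have C_right_scale: "C u (a *s z) = a *s C u z" for u a z
  proof -
    have "cnabla p u (V (a *s z)) = cnabla p u (\<lambda>y. a *s V z y)"
      by (rule cnabla_cong[OF open_S p _ V'])
         (simp add: V_def Pi_simps cnabla_direction[OF _ W'])
    then show ?thesis by (simp add: C_def cnabla_scale[OF p V'] scale_right_simps)
  qed
  have C10: "C u z \<in> T10 J p" for u z
  proof -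
    have "cnabla p u (V z) \<in> T10 J p"
      by (rule cnabla_T10_section[OF p V' V10]) (assumption, simp only: Vp nabla_Jc_simps[OF p])
    then show ?thesis by (simp add: C_def T10_def Jc_simps[OF p] scale_right_simps)
  qed
  obtain R where R: "smooth_on S R" "\<And>y. y \<in> S \<Longrightarrow> R y \<in> T10 J y" "R p = 0"
    "(R has_derivative (\<lambda>v. 0)) (at p)"
    and RX: "\<And>X X'. (X has_derivative X') (at p) \<Longrightarrow> X p \<in> T01 J p \<Longrightarrow>
      (\<lambda>y. cnabla y (X y) R) differentiable (at p) \<and>
      (\<forall>u\<in>T10 J p. cnabla p u (\<lambda>y. cnabla y (X y) R) = C u (X p))"
    using quadratic_correction[OF p, of C] C_right C_right_scale C10
    by (fastforce simp: C_def cnabla_direction[OF p V'] scale_right_simps)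
  have R': "(R has_derivative frechet_derivative R (at y)) (at y)" if "y \<in> S" for y
    by (rule smooth_on_has_derivative[OF R(1) that])
  define Z where "Z y = W y + R y" for y
  have "smooth_on S Z" unfolding Z_def by (rule smooth_on_add[OF open_S W(1) R(1)])
  moreover have "\<forall>y\<in>S. Z y \<in> T10 J y"
    using W(2) R(2) by (simp add: Z_def T10_def Jc_simps scale_right_simps)
  moreover have "Z p = w" by (simp add: Z_def W R)
  moreover have "cnabla p u Z = (- (\<i>/2)) *s nabla_Jc p u w" for u
    unfolding Z_def cnabla_add[OF p W'[OF p] R(4)]
    by (simp add: Wd cnabla_eq[OF R(4)] R(3) \<Gamma>c_simps[OF p])
  moreover have "cnabla p u (\<lambda>y. cnabla y (X y) Z) = 0"
    if X: "(X has_derivative X') (at p)" and X01: "\<forall>y\<in>S. X y \<in> T01 J y" and u: "u \<in> T10 J p" for X X' u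
  proof -
    have c: "cnabla p u (\<lambda>y. cnabla y (X y) W) = cnabla p u (V (X p))"
      "(\<lambda>y. cnabla y (X y) W) differentiable (at p)"
      using cnabla_constant_direction[OF p W(1) X _ W0] X01 by (simp_all add: V_def)
    have r: "(\<lambda>y. cnabla y (X y) R) differentiable (at p)"
      "cnabla p u (\<lambda>y. cnabla y (X y) R) = C u (X p)"
      using RX[OF X] X01 p u by auto
    note c' = has_derivative_frechet[OF c(2)] and r' = has_derivative_frechet[OF r(1)]
    have "cnabla p u (\<lambda>y. cnabla y (X y) W + cnabla y (X y) R) = cnabla p u (\<lambda>y. cnabla y (X y) Z)"
      by (rule cnabla_cong[OF open_S p _ has_derivative_add[OF c' r']])
         (simp_all add: Z_def[abs_def] cnabla_add[OF _ W' R'])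
    then show ?thesis
      by (simp add: cnabla_add[OF p c' r'] c r C_def)
  qed
  ultimately show ?thesis by blast
qed

end

section \<open>Linear algebra of the type decomposition\<close>

lemma subspace_T10: "linear (J y) \<Longrightarrow> vec.subspace (T10 J y)"
  by (rule vec.subspaceI) (simp_all add: T10_def linear_ext_complex_linear scale_right_simps mult.commute)

lemma subspace_T01: "linear (J y) \<Longrightarrow> vec.subspace (T01 J y)"
  by (rule vec.subspaceI) (simp_all add: T01_def linear_ext_complex_linear scale_right_simps mult.commute)

lemma cnj_vec_T10: "linear (J y) \<Longrightarrow> w \<in> T10 J y \<Longrightarrow> cnj_vec w \<in> T01 J y"
  by (simp add: T10_def T01_def linear_ext_complex_linear)

lemma cnj_vec_T01: "linear (J y) \<Longrightarrow> w \<in> T01 J y \<Longrightarrow> cnj_vec w \<in> T10 J y"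
  by (simp add: T10_def T01_def linear_ext_complex_linear)

lemma cnj_vec_sum: "cnj_vec (\<Sum>i\<in>I. f i) = (\<Sum>i\<in>I. cnj_vec (f i))"
  by (induction I rule: infinite_finite_induct) simp_all

lemma inj_cnj_vec: "inj_on cnj_vec B"
  by (metis cnj_vec_simps(1) inj_onI)

text \<open>Conjugation is only antilinear, but it takes independent sets to independent sets.\<close>
lemma dim_le_of_cnj_image:
  fixes X Y :: "(complex^'d::finite) set"
  assumes "cnj_vec ` X \<subseteq> Y"
  shows "vec.dim X \<le> vec.dim Y"
proof -
  obtain B where B: "B \<subseteq> X" "vec.independent B" "X \<subseteq> vec.span B" "card B = vec.dim X"
    using vec.basis_exists by metis
  have fin: "finite B" using vec.finiteI_independent[OF B(2)] .
  have "vec.independent (cnj_vec ` B)"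
  proof
    assume "vec.dependent (cnj_vec ` B)"
    then obtain u v where u: "v \<in> cnj_vec ` B" "u v \<noteq> 0" "(\<Sum>z\<in>cnj_vec ` B. u z *s z) = 0"
      using vec.dependent_finite[of "cnj_vec ` B"] fin by auto
    then have "cnj_vec (\<Sum>b\<in>B. u (cnj_vec b) *s cnj_vec b) = 0"
      by (simp add: sum.reindex[OF inj_cnj_vec])
    then have "(\<Sum>b\<in>B. cnj (u (cnj_vec b)) *s b) = 0" by (simp add: cnj_vec_sum)
    moreover obtain b where "b \<in> B" "v = cnj_vec b" using u(1) by blast
    ultimately have "vec.dependent B"
      using u(2) vec.dependent_finite[OF fin]
      by (auto intro!: exI[of _ "\<lambda>b. cnj (u (cnj_vec b))"])
    then show False using B(2) by simp
  qed
  moreover have "cnj_vec ` B \<subseteq> Y" using B(1) assms by blast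
  moreover have "card (cnj_vec ` B) = card B" by (rule card_image[OF inj_cnj_vec])
  ultimately show ?thesis using vec.independent_card_le_dim B(4) by metis
qed

text \<open>The complexified space is the direct sum of the two types, and conjugation exchanges them.\<close>
lemma dim_T10:
  fixes J :: "'a \<Rightarrow> real^'d \<Rightarrow> real^'d::finite"
  assumes lin: "linear (J y)" and JJ: "\<And>v. J y (J y v) = - v"
  shows "2 * vec.dim (T10 J y) = CARD('d)"
proof -
  have "vec.dim (T10 J y) \<le> vec.dim (T01 J y)" "vec.dim (T01 J y) \<le> vec.dim (T10 J y)"
    by (rule dim_le_of_cnj_image; use cnj_vec_T10[where J = J, OF lin] cnj_vec_T01[where J = J, OF lin] in blast)+
  then have eq: "vec.dim (T10 J y) = vec.dim (T01 J y)" by simp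
  have "{a + b |a b. a \<in> T10 J y \<and> b \<in> T01 J y} = UNIV"
  proof (intro set_eqI iffI UNIV_I CollectI)
    fix w :: "complex^'d"
    have LL: "linear_ext (J y) (linear_ext (J y) w) = - w" by (rule cvec_eqI) (simp_all add: JJ)
    have "w = (1/2) *s (w - \<i> *s linear_ext (J y) w) + (1/2) *s (w + \<i> *s linear_ext (J y) w)"
      by (simp add: vec_eq_iff field_simps)
    moreover have "(1/2) *s (w - \<i> *s linear_ext (J y) w) \<in> T10 J y"
      "(1/2) *s (w + \<i> *s linear_ext (J y) w) \<in> T01 J y"
      by (simp_all add: T10_def T01_def linear_ext_complex_linear[OF lin] LL scale_right_simps)
    ultimately show "\<exists>a b. w = a + b \<and> a \<in> T10 J y \<and> b \<in> T01 J y" by blast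
  qed
  moreover have "T10 J y \<inter> T01 J y = {0}"
    using vec.subspace_0[OF subspace_T10[where J = J, OF lin]] vec.subspace_0[OF subspace_T01[where J = J, OF lin]]
    by (auto simp: T10_def T01_def vec_eq_iff)
  ultimately show ?thesis
    using vec.dim_sums_Int[OF subspace_T10[where J = J, OF lin] subspace_T01[where J = J, OF lin]] eq
    by (simp add: vec_dim_card del: vec.dim_UNIV)
qed

lemma linearly_independent_family:
  fixes w :: "nat \<Rightarrow> complex^'d::finite"
  assumes I: "finite I" and indep: "\<And>a. (\<Sum>i\<in>I. a i *s w i) = 0 \<Longrightarrow> (\<forall>i\<in>I. a i = 0)"
  shows "inj_on w I" "vec.independent (w ` I)"
proof -
  show inj: "inj_on w I"
  proof (rule inj_onI, rule ccontr)
    fix i j assume ij: "i \<in> I" "j \<in> I" "w i = w j" "i \<noteq> j"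
    let ?a = "\<lambda>k. if k = i then 1 else if k = j then -1 else (0::complex)"
    have "(\<Sum>k\<in>I. ?a k *s w k) = (\<Sum>k\<in>{i,j}. ?a k *s w k)"
      by (rule sum.mono_neutral_right) (use ij I in auto)
    also have "\<dots> = 0" using ij by (simp add: scale_right_simps)
    finally have "?a i = 0" using indep[of ?a] ij(1) by blast
    then show False by simp
  qed
  show "vec.independent (w ` I)"
  proof
    assume "vec.dependent (w ` I)"
    then obtain u v where u: "v \<in> w ` I" "u v \<noteq> 0" "(\<Sum>z\<in>w ` I. u z *s z) = 0"
      using vec.dependent_finite[of "w ` I"] I by auto
    then have "(\<Sum>i\<in>I. u (w i) *s w i) = 0" by (simp add: sum.reindex[OF inj])
    with indep[of "\<lambda>i. u (w i)"] u(1,2) show False by auto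
  qed
qed

section \<open>The normal frame in coordinates\<close>

context almost_kaehler_patch
begin

abbreviation hc :: "real^'d \<Rightarrow> complex^'d \<Rightarrow> complex^'d \<Rightarrow> complex" where
  "hc y \<equiv> bilinear_ext (h y)"

lemmas hc_simps = bilinear_ext_complex_bilinear[OF h_bilinear]

lemma hc_sum_left: "y \<in> S \<Longrightarrow> hc y (\<Sum>i\<in>I. f i) z = (\<Sum>i\<in>I. hc y (f i) z)"
  by (induction I rule: infinite_finite_induct) (simp_all add: hc_simps)

lemma hc_cnj_sym: "y \<in> S \<Longrightarrow> hc y z (cnj_vec w) = cnj (hc y w (cnj_vec z))"
  by (simp add: bilinear_ext_def complex_eq_iff bilinear_simps[OF h_bilinear])
     (metis h_sym)

lemma hc_pos:
  assumes "y \<in> S" "w \<noteq> 0"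
  shows "\<exists>r>0. hc y w (cnj_vec w) = complex_of_real r"
proof -
  have "Re_vec w \<noteq> 0 \<or> Im_vec w \<noteq> 0" using cvec_eqI[of w 0] assms(2) by auto
  moreover have "h y v v \<ge> 0" for v
    using h_pos[OF assms(1), of v] bilinear_lzero[OF h_bilinear[OF assms(1)]] by (cases "v = 0") auto
  ultimately have "h y (Re_vec w) (Re_vec w) + h y (Im_vec w) (Im_vec w) > 0"
    using h_pos[OF assms(1)] by (meson add_nonneg_pos add_pos_nonneg)
  then show ?thesis
    by (intro exI[of _ "h y (Re_vec w) (Re_vec w) + h y (Im_vec w) (Im_vec w)"])
       (use h_sym[OF assms(1), of "Re_vec w" "Im_vec w"] in
         \<open>simp add: bilinear_ext_def complex_eq_iff bilinear_simps[OF h_bilinear[OF assms(1)]]\<close>)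
qed

lemma hc_Jc: "y \<in> S \<Longrightarrow> hc y (Jc y u) (Jc y z) = hc y u z"
  by (simp add: bilinear_ext_def h_J)

text \<open>The metric is invariant under \<open>J\<close>, which multiplies both arguments by \<open>\<i>\<close> or both by \<open>-\<i>\<close>.\<close>
lemma hc_same_type:
  assumes y: "y \<in> S"
  shows "u \<in> T10 J y \<Longrightarrow> z \<in> T10 J y \<Longrightarrow> hc y u z = 0"
    and "u \<in> T01 J y \<Longrightarrow> z \<in> T01 J y \<Longrightarrow> hc y u z = 0"
  using hc_Jc[OF y, of u z] by (auto simp: T10_def T01_def hc_simps[OF y])

text \<open>The metric is parallel. Directions are real here, and \<open>Complex_vec v 0\<close> is the real vector \<open>v\<close> viewed
  as a complex one.\<close>
lemma hc_has_derivative: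
  assumes y: "y \<in> S" and F: "(F has_derivative F') (at y)" and G: "(G has_derivative G') (at y)"
  shows "((\<lambda>y. hc y (F y) (G y)) has_derivative
    (\<lambda>v. hc y (cnabla y (Complex_vec v 0) F) (G y) + hc y (F y) (cnabla y (Complex_vec v 0) G))) (at y)"
proof -
  have h': "((\<lambda>y. h y u v) has_derivative (\<lambda>x. h y (\<Gamma> y x u) v + h y u (\<Gamma> y x v))) (at y)" for u v
  proof -
    have "frechet_derivative (\<lambda>y. h y u v) (at y) = (\<lambda>x. h y (\<Gamma> y x u) v + h y u (\<Gamma> y x v))"
      by (rule ext) (rule h_parallel[OF y])
    then show ?thesis using smooth_on_has_derivative[OF h_smooth y, of u v] by simp
  qed
  have B: "((\<lambda>y. hc y w z) has_derivative
     (\<lambda>v. hc y (\<Gamma>c y (Complex_vec v 0) w) z + hc y w (\<Gamma>c y (Complex_vec v 0) z))) (at y)" for w z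
    unfolding bilinear_ext_def Complex_eq
    by (rule derivative_eq_intros h' refl)+
       (auto simp: fun_eq_iff complex_eq_iff bilinear_simps[OF h_bilinear[OF y]] bilinear_simps[OF \<Gamma>_bilinear[OF y]])
  have c: "cext F' (Complex_vec v 0) = F' v" "cext G' (Complex_vec v 0) = G' v" for v
    using has_derivative_linear[OF F] has_derivative_linear[OF G]
    by (simp_all add: cext_def linear_0 scale_right_simps)
  show ?thesis
    using has_derivative_bilinear_apply[OF open_S y bilinear_bilinear_ext[OF h_bilinear] B F G]
    by (simp add: cnabla_eq[OF F] cnabla_eq[OF G] c hc_simps[OF y] algebra_simps)
qed

lemma cnabla_cnj:
  assumes y: "y \<in> S" and F: "(F has_derivative F') (at y)"
  shows "cnabla y (cnj_vec w) (\<lambda>y. cnj_vec (F y)) = cnj_vec (cnabla y w F)"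
  using linear_neg[OF has_derivative_linear[OF F]]
  by (simp add: cnabla_eq[OF F] cnabla_eq[OF bounded_linear.has_derivative[OF bounded_linear_cnj_vec F]]
      \<Gamma>c_simps[OF y] cext_def scale_right_simps)

lemma hc_continuous:
  assumes "smooth_on S F" "smooth_on S G"
  shows "continuous_on S (\<lambda>y. hc y (F y) (G y))"
  by (intro continuous_at_imp_continuous_on ballI
      has_derivative_continuous[OF hc_has_derivative[OF _ smooth_on_has_derivative[OF assms(1)]
        smooth_on_has_derivative[OF assms(2)]]])

text \<open>Gram-Schmidt orthonormalisation; by \<open>dim_T10\<close>, fewer than \<open>n\<close> vectors never span the space of vectors of
  type (1,0).\<close>
lemma unitary_basis_exists:
  assumes n: "CARD('d) = 2 * n" and y: "y \<in> S" and "m \<le> n"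
  shows "\<exists>w. (\<forall>i\<in>{1..m}. w i \<in> T10 J y) \<and>
    (\<forall>r\<in>{1..m}. \<forall>s\<in>{1..m}. hc y (w r) (cnj_vec (w s)) = (if r = s then 1 else 0))"
  using \<open>m \<le> n\<close>
proof (induction m)
  case (Suc m)
  then have "m \<le> n" by simp
  from Suc.IH[OF this] obtain w :: "nat \<Rightarrow> complex^'d" where w: "\<And>i. i \<in> {1..m} \<Longrightarrow> w i \<in> T10 J y"
    and on: "\<And>r s. r \<in> {1..m} \<Longrightarrow> s \<in> {1..m} \<Longrightarrow> hc y (w r) (cnj_vec (w s)) = (if r = s then 1 else 0)"
    by blast
  have "vec.dim (vec.span (w ` {1..m})) \<le> m"
    using vec.dim_le_card[of "vec.span (w ` {1..m})" "w ` {1..m}"] card_image_le[of "{1..m}" w] by auto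
  moreover have "vec.dim (T10 J y) = n" using dim_T10[where J = J, OF J_linear[OF y] J_J[OF y]] n by simp
  ultimately have "\<not> T10 J y \<subseteq> vec.span (w ` {1..m})"
    using vec.dim_subset Suc.prems by (metis Suc_le_lessD leD le_trans)
  then obtain z where z: "z \<in> T10 J y" "z \<notin> vec.span (w ` {1..m})" by blast
  define q where "q = (\<Sum>j\<in>{1..m}. hc y z (cnj_vec (w j)) *s w j)"
  have q: "q \<in> vec.span (w ` {1..m})" unfolding q_def
    by (intro vec.span_sum vec.span_scale vec.span_base) auto
  have q10: "q \<in> T10 J y" unfolding q_def
    by (intro vec.subspace_sum vec.subspace_scale subspace_T10 J_linear y w)
  define v where "v = z - q"
  have "v \<noteq> 0" using q z by (auto simp: v_def)
  then obtain r where r: "r > 0" "hc y v (cnj_vec v) = complex_of_real r" using hc_pos[OF y] by blast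
  have vw: "hc y v (cnj_vec (w s)) = 0" if s: "s \<in> {1..m}" for s
  proof -
    have "hc y q (cnj_vec (w s)) = (\<Sum>j\<in>{1..m}. hc y z (cnj_vec (w j)) * (if j = s then 1 else 0))"
      unfolding q_def hc_sum_left[OF y] by (rule sum.cong[OF refl]) (simp only: hc_simps(5)[OF y] on[OF _ s])
    also have "\<dots> = hc y z (cnj_vec (w s))" using s by (simp add: if_distrib cong: if_cong)
    finally show ?thesis by (simp add: v_def hc_simps[OF y])
  qed
  define u where "u = complex_of_real (1 / sqrt r) *s v"
  have u10: "u \<in> T10 J y" unfolding u_def v_def
    by (intro vec.subspace_scale vec.subspace_diff subspace_T10 J_linear y z(1) q10)
  have uu: "hc y u (cnj_vec u) = 1"
    using r by (simp add: u_def hc_simps[OF y] flip: of_real_mult)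
  have uw: "hc y u (cnj_vec (w s)) = 0" "hc y (w s) (cnj_vec u) = 0" if s: "s \<in> {1..m}" for s
    using vw[OF s] hc_cnj_sym[OF y, of "w s" u] by (simp_all add: u_def hc_simps[OF y])
  show ?case
  proof (intro exI[of _ "w(Suc m := u)"] conjI ballI)
    fix i s assume i: "i \<in> {1..Suc m}"
    show "(w(Suc m := u)) i \<in> T10 J y" using i u10 w[of i] by (cases "i = Suc m") auto
    assume s: "s \<in> {1..Suc m}"
    have "i = Suc m \<or> i \<in> {1..m}" "s = Suc m \<or> s \<in> {1..m}" using i s by auto
    then show "hc y ((w(Suc m := u)) i) (cnj_vec ((w(Suc m := u)) s)) = (if i = s then 1 else 0)"
      using uu uw on by auto
  qed
qed auto

text \<open>The Gram matrix is strictly diagonally dominant: in a linear relation, compare the coefficient of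
  largest modulus with the others after pairing with the corresponding vector.\<close>
lemma nearly_unitary_independent:
  fixes w :: "nat \<Rightarrow> complex^'d"
  assumes y: "y \<in> S" and near: "\<And>r s. r \<in> {1..n} \<Longrightarrow> s \<in> {1..n} \<Longrightarrow>
    cmod (hc y (w r) (cnj_vec (w s)) - (if r = s then 1 else 0)) < 1 / (real n + 1)"
    and lin: "(\<Sum>i\<in>{1..n}. a i *s w i) = 0"
  shows "\<forall>i\<in>{1..n}. a i = 0"
proof (cases "n = 0")
  case False
  define M where "M = Max ((\<lambda>i. cmod (a i)) ` {1..n})"
  have fin: "finite ((\<lambda>i. cmod (a i)) ` {1..n})" "(\<lambda>i. cmod (a i)) ` {1..n} \<noteq> {}" using False by auto
  have le: "cmod (a i) \<le> M" if "i \<in> {1..n}" for i unfolding M_def by (rule Max_ge[OF fin(1)]) (use that in auto)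
  obtain s where s: "s \<in> {1..n}" "M = cmod (a s)" using Max_in[OF fin] by (auto simp: M_def)
  define E where "E = (\<Sum>i\<in>{1..n}. a i * (hc y (w i) (cnj_vec (w s)) - (if i = s then 1 else 0)))"
  have "0 = hc y (\<Sum>i\<in>{1..n}. a i *s w i) (cnj_vec (w s))" by (simp only: lin hc_simps(4)[OF y])
  also have "\<dots> = (\<Sum>i\<in>{1..n}. a i * hc y (w i) (cnj_vec (w s)))"
    by (simp add: hc_sum_left[OF y] hc_simps[OF y])
  also have "\<dots> = (\<Sum>i\<in>{1..n}. a i * (if i = s then 1 else 0)) + E"
    by (simp add: E_def sum.distrib[symmetric] algebra_simps)
  also have "(\<Sum>i\<in>{1..n}. a i * (if i = s then 1 else 0)) = a s" using s by (simp add: if_distrib cong: if_cong)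
  finally have "a s + E = 0" by (rule sym)
  then have "cmod (a s) = cmod E" by (simp add: add_eq_0_iff)
  also have "cmod E = cmod (\<Sum>i\<in>{1..n}. a i * (hc y (w i) (cnj_vec (w s)) - (if i = s then 1 else 0)))"
    by (simp only: E_def)
  also have "\<dots> \<le> (\<Sum>i\<in>{1..n}. M * (1 / (real n + 1)))"
  proof (rule sum_norm_le)
    fix i assume i: "i \<in> {1..n}"
    show "cmod (a i * (hc y (w i) (cnj_vec (w s)) - (if i = s then 1 else 0))) \<le> M * (1 / (real n + 1))"
      unfolding norm_mult
      by (rule mult_mono[OF le[OF i] less_imp_le[OF near[OF i s(1)]]]) (simp_all add: s(2))
  qed
  also have "\<dots> = M * (real n / (real n + 1))" by simp
  finally have "M * (1 - real n / (real n + 1)) \<le> 0" by (simp add: s(2) algebra_simps)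
  moreover have "1 - real n / (real n + 1) > 0" by (simp add: field_simps)
  ultimately have "M \<le> 0" by (simp add: mult_le_0_iff)
  then show ?thesis using le norm_le_zero_iff order_trans by blast
qed auto

text \<open>Apply \<open>second_order_section\<close> to a unitary basis at \<open>p\<close>. The derivatives of all the sections at \<open>p\<close> are
  of type (0,1), and those of their conjugates of type (1,0), so that each term in the derivative of
  the Gram matrix pairs two vectors of the same type. Near \<open>p\<close> the Gram matrix stays close to the
  identity, which keeps the sections independent, and they span by the dimension count.\<close>
theorem normal_frame_in_coordinates:
  assumes n: "CARD('d) = 2 * n" and p: "p \<in> S"
  obtains V W where "open V" "p \<in> V" "V \<subseteq> S"
    "\<And>i. i \<in> {1..n} \<Longrightarrow> smooth_on S (W i)"
    "\<And>y. y \<in> V \<Longrightarrow> inj_on (\<lambda>i. W i y) {1..n}"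
    "\<And>y. y \<in> V \<Longrightarrow> vec.independent ((\<lambda>i. W i y) ` {1..n})"
    "\<And>y. y \<in> V \<Longrightarrow> vec.span ((\<lambda>i. W i y) ` {1..n}) = T10 J y"
    "\<And>k i. k \<in> {1..n} \<Longrightarrow> i \<in> {1..n} \<Longrightarrow> cnabla p (W k p) (\<lambda>y. cnj_vec (W i y)) = 0"
    "\<And>k i. k \<in> {1..n} \<Longrightarrow> i \<in> {1..n} \<Longrightarrow> cnabla p (W k p) (W i) \<in> T01 J p"
    "\<And>r s. r \<in> {1..n} \<Longrightarrow> s \<in> {1..n} \<Longrightarrow> hc p (W r p) (cnj_vec (W s p)) = (if r = s then 1 else 0)"
    "\<And>r s. r \<in> {1..n} \<Longrightarrow> s \<in> {1..n} \<Longrightarrow>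
       ((\<lambda>y. hc y (W r y) (cnj_vec (W s y))) has_derivative (\<lambda>v. 0)) (at p)"
    "\<And>r k i. r \<in> {1..n} \<Longrightarrow> k \<in> {1..n} \<Longrightarrow> i \<in> {1..n} \<Longrightarrow>
       cnabla p (W r p) (\<lambda>y. cnabla y (cnj_vec (W k y)) (W i)) = 0"
proof -
  obtain w :: "nat \<Rightarrow> complex^'d" where w: "\<And>i. i \<in> {1..n} \<Longrightarrow> w i \<in> T10 J p"
    and on: "\<And>r s. r \<in> {1..n} \<Longrightarrow> s \<in> {1..n} \<Longrightarrow> hc p (w r) (cnj_vec (w s)) = (if r = s then 1 else 0)"
    using unitary_basis_exists[OF n p order_refl] by blast
  have "\<exists>W. \<forall>i\<in>{1..n}. smooth_on S (W i) \<and> (\<forall>y\<in>S. W i y \<in> T10 J y) \<and> W i p = w i \<and>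
    (\<forall>u. cnabla p u (W i) = (- (\<i>/2)) *s nabla_Jc p u (w i)) \<and>
    (\<forall>X X'. (X has_derivative X') (at p) \<longrightarrow> (\<forall>y\<in>S. X y \<in> T01 J y) \<longrightarrow>
      (\<forall>u\<in>T10 J p. cnabla p u (\<lambda>y. cnabla y (X y) (W i)) = 0))"
    by (rule bchoice) (use second_order_section[OF p w] in blast)
  then obtain W where W: "\<And>i. i \<in> {1..n} \<Longrightarrow> smooth_on S (W i)"
      "\<And>i y. i \<in> {1..n} \<Longrightarrow> y \<in> S \<Longrightarrow> W i y \<in> T10 J y" "\<And>i. i \<in> {1..n} \<Longrightarrow> W i p = w i"
    and W1: "\<And>i u. i \<in> {1..n} \<Longrightarrow> cnabla p u (W i) = (- (\<i>/2)) *s nabla_Jc p u (w i)"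
    and W2: "\<And>i X X' u. i \<in> {1..n} \<Longrightarrow> (X has_derivative X') (at p) \<Longrightarrow> (\<And>y. y \<in> S \<Longrightarrow> X y \<in> T01 J y) \<Longrightarrow>
      u \<in> T10 J p \<Longrightarrow> cnabla p u (\<lambda>y. cnabla y (X y) (W i)) = 0"
    by blast
  have W': "(W i has_derivative frechet_derivative (W i) (at p)) (at p)" if "i \<in> {1..n}" for i
    by (rule smooth_on_has_derivative[OF W(1)[OF that] p])
  have cW: "smooth_on S (\<lambda>y. cnj_vec (W i y))" if "i \<in> {1..n}" for i
    by (rule smooth_on_bounded_linear[OF bounded_linear_cnj_vec open_S W(1)[OF that]])
  note cW' = smooth_on_has_derivative[OF cW p]
  have W01: "cnabla p u (W i) \<in> T01 J p" if "i \<in> {1..n}" for i u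
    unfolding W1[OF that]
    by (intro vec.subspace_scale subspace_T01 J_linear p nabla_Jc_T10_in_T01 w that)
  have W0: "cnabla p u (W i) = 0" if "i \<in> {1..n}" "u \<in> T01 J p" for i u
    by (simp add: W1[OF that(1)] nabla_Jc_T01_T10[OF p that(2) w[OF that(1)]] scale_right_simps)
  define G where "G r s y = hc y (W r y) (cnj_vec (W s y))" for r s y
  have Gp: "G r s p = (if r = s then 1 else 0)" if "r \<in> {1..n}" "s \<in> {1..n}" for r s
    using on[OF that] by (simp only: G_def W(3)[OF that(1)] W(3)[OF that(2)])
  have "\<forall>\<^sub>F y in nhds p. \<forall>r\<in>{1..n}. \<forall>s\<in>{1..n}. cmod (G r s y - (if r = s then 1 else 0)) < 1 / (real n + 1)"
  proof (intro eventually_ball_finite ballI finite_atLeastAtMost)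
    fix r s assume rs: "r \<in> {1..n}" "s \<in> {1..n}"
    have "isCont (G r s) p"
      using hc_continuous[OF W(1)[OF rs(1)] cW[OF rs(2)]] open_S p
      by (simp add: G_def[abs_def] continuous_on_eq_continuous_at)
    then have "((G r s) \<longlongrightarrow> G r s p) (nhds p)" by (simp add: isCont_def tendsto_at_iff_tendsto_nhds)
    then show "\<forall>\<^sub>F y in nhds p. cmod (G r s y - (if r = s then 1 else 0)) < 1 / (real n + 1)"
      using tendstoD[of "G r s" "G r s p" "nhds p" "1 / (real n + 1)"] Gp[OF rs] by (simp add: dist_norm)
  qed
  moreover have "\<forall>\<^sub>F y in nhds p. y \<in> S" using eventually_nhds_in_open[OF open_S p] .
  ultimately have "\<forall>\<^sub>F y in nhds p. y \<in> S \<and>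
      (\<forall>r\<in>{1..n}. \<forall>s\<in>{1..n}. cmod (G r s y - (if r = s then 1 else 0)) < 1 / (real n + 1))"
    by (rule eventually_conj[rotated])
  then obtain V where V: "open V" "p \<in> V" "\<And>y. y \<in> V \<Longrightarrow> y \<in> S"
    "\<And>y r s. y \<in> V \<Longrightarrow> r \<in> {1..n} \<Longrightarrow> s \<in> {1..n} \<Longrightarrow> cmod (G r s y - (if r = s then 1 else 0)) < 1 / (real n + 1)"
    unfolding eventually_nhds by blast
  have frame: "inj_on (\<lambda>i. W i y) {1..n}" "vec.independent ((\<lambda>i. W i y) ` {1..n})"
    "vec.span ((\<lambda>i. W i y) ` {1..n}) = T10 J y" if y: "y \<in> V" for y
  proof -
    have yS: "y \<in> S" by (rule V(3)[OF y])
    note ind = linearly_independent_family[OF finite_atLeastAtMost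
        nearly_unitary_independent[OF yS V(4)[OF y, unfolded G_def]]]
    show inj: "inj_on (\<lambda>i. W i y) {1..n}" by (rule ind(1))
    show indep: "vec.independent ((\<lambda>i. W i y) ` {1..n})" by (rule ind(2))
    have sub: "(\<lambda>i. W i y) ` {1..n} \<subseteq> T10 J y" using W(2) yS by blast
    have "card ((\<lambda>i. W i y) ` {1..n}) = vec.dim (T10 J y)"
      using card_image[OF inj] dim_T10[where J = J, OF J_linear[OF yS] J_J[OF yS]] n by simp
    then have "T10 J y \<subseteq> vec.span ((\<lambda>i. W i y) ` {1..n})"
      using vec.card_eq_dim[OF sub] indep by blast
    moreover have "vec.span ((\<lambda>i. W i y) ` {1..n}) \<subseteq> T10 J y"
      by (rule vec.span_minimal[OF sub subspace_T10[where J = J, OF J_linear[OF yS]]])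
    ultimately show "vec.span ((\<lambda>i. W i y) ` {1..n}) = T10 J y" by blast
  qed
  show thesis
  proof (rule that[OF V(1,2) _ W(1) frame])
    show "V \<subseteq> S" using V(3) by blast
    fix r k i assume rki: "r \<in> {1..n}" "k \<in> {1..n}" "i \<in> {1..n}"
    have "cnabla p (W r p) (\<lambda>y. cnj_vec (W i y)) = cnj_vec (cnabla p (cnj_vec (W r p)) (W i))"
      using cnabla_cnj[OF p W'[OF rki(3)], of "cnj_vec (W r p)"] by simp
    then show "cnabla p (W r p) (\<lambda>y. cnj_vec (W i y)) = 0"
      using W0[OF rki(3) cnj_vec_T10[where J = J, OF J_linear[OF p] W(2)[OF rki(1) p]]] by simp
    show "cnabla p (W r p) (W i) \<in> T01 J p" by (rule W01[OF rki(3)])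
    show "hc p (W r p) (cnj_vec (W i p)) = (if r = i then 1 else 0)"
      using Gp[OF rki(1,3)] by (simp add: G_def)
    have "cnabla p (Complex_vec v 0) (\<lambda>y. cnj_vec (W i y)) \<in> T10 J p" for v
    proof -
      have "cnj_vec (Complex_vec v 0) = Complex_vec v 0" by (rule cvec_eqI) simp_all
      then show ?thesis
        using cnabla_cnj[OF p W'[OF rki(3)], of "Complex_vec v 0"]
          cnj_vec_T01[where J = J, OF J_linear[OF p] W01[OF rki(3)]] by metis
    qed
    then show "((\<lambda>y. hc y (W r y) (cnj_vec (W i y))) has_derivative (\<lambda>v. 0)) (at p)"
      using hc_has_derivative[OF p W'[OF rki(1)] cW'[OF rki(3)]]
        hc_same_type[OF p] W01[OF rki(1)] W(2)[OF rki(1) p]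
        cnj_vec_T10[where J = J, OF J_linear[OF p] W(2)[OF rki(3) p]] by simp
    show "cnabla p (W r p) (\<lambda>y. cnabla y (cnj_vec (W k y)) (W i)) = 0"
      by (rule W2[OF rki(3) cW'[OF rki(2)] _ W(2)[OF rki(1) p]])
         (rule cnj_vec_T10[where J = J, OF J_linear W(2)[OF rki(2)]])
  qed
qed

end

section \<open>Charts and transition maps\<close>

locale smooth_manifold =
  fixes A :: "('m::{t2_space,second_countable_topology}, 'd::finite) chart set"
  assumes atlas: "smooth_atlas A"
begin

lemma chart_facts:
  assumes "c \<in> A"
  shows "open (dom_of c)" "open (coord c ` dom_of c)"
    "p \<in> dom_of c \<Longrightarrow> param c (coord c p) = p"
    "y \<in> coord c ` dom_of c \<Longrightarrow> param c y \<in> dom_of c"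
    "y \<in> coord c ` dom_of c \<Longrightarrow> coord c (param c y) = y"
    "continuous_on (dom_of c) (coord c)" "continuous_on (coord c ` dom_of c) (param c)"
proof -
  have "is_chart c" using atlas assms by (auto simp: smooth_atlas_def)
  then have *: "open (dom_of c)" "open (coord c ` dom_of c)"
    "homeomorphism (dom_of c) (coord c ` dom_of c) (coord c) (param c)"
    by (auto simp: is_chart_def)
  then show "open (dom_of c)" "open (coord c ` dom_of c)"
    "p \<in> dom_of c \<Longrightarrow> param c (coord c p) = p"
    "y \<in> coord c ` dom_of c \<Longrightarrow> param c y \<in> dom_of c"
    "y \<in> coord c ` dom_of c \<Longrightarrow> coord c (param c y) = y"
    "continuous_on (dom_of c) (coord c)" "continuous_on (coord c ` dom_of c) (param c)"
    unfolding homeomorphism_def by auto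
qed

lemma coord_image_eq:
  assumes "c \<in> A"
  shows "coord c ` (dom_of c \<inter> U) = {y \<in> coord c ` dom_of c. param c y \<in> U}"
  using chart_facts[OF assms] by force

lemma open_coord_image:
  assumes c: "c \<in> A" and U: "open U"
  shows "open (coord c ` (dom_of c \<inter> U))"
proof -
  have "coord c ` (dom_of c \<inter> U) = coord c ` dom_of c \<inter> param c -` U"
    using coord_image_eq[OF c] by auto
  then show ?thesis
    using continuous_on_open_vimage[OF chart_facts(2)[OF c]] chart_facts(7)[OF c] U by (metis Int_commute)
qed

lemma chart_at_in: "chart_at A p \<in> A" and chart_at_dom: "p \<in> dom_of (chart_at A p)"
proof -
  have "p \<in> (\<Union>c\<in>A. dom_of c)" using atlas by (simp add: smooth_atlas_def)
  then have "\<exists>c. c \<in> A \<and> p \<in> dom_of c" by blast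
  then have "chart_at A p \<in> A \<and> p \<in> dom_of (chart_at A p)" unfolding chart_at_def by (rule someI_ex)
  then show "chart_at A p \<in> A" "p \<in> dom_of (chart_at A p)" by auto
qed

lemma transition_smooth:
  "c \<in> A \<Longrightarrow> c' \<in> A \<Longrightarrow> smooth_on (coord c ` (dom_of c \<inter> dom_of c')) (coord c' \<circ> param c)"
  using atlas by (auto simp: smooth_atlas_def)

text \<open>Both \<open>tcoord\<close> and \<open>tvec\<close> are instances, with the preferred chart at \<open>p\<close> on one side.\<close>
definition trans_deriv :: "('m, 'd) chart \<Rightarrow> ('m, 'd) chart \<Rightarrow> 'm \<Rightarrow> real^'d \<Rightarrow> real^'d" where
  "trans_deriv c c' p = frechet_derivative (coord c' \<circ> param c) (at (coord c p))"

lemma tcoord_eq: "tcoord A c p = trans_deriv (chart_at A p) c p"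
  and tvec_eq: "tvec A c p = trans_deriv c (chart_at A p) p"
  by (simp_all add: tcoord_def tvec_def trans_deriv_def)

lemma trans_has_derivative:
  assumes "c \<in> A" "c' \<in> A" "p \<in> dom_of c" "p \<in> dom_of c'"
  shows "((coord c' \<circ> param c) has_derivative trans_deriv c c' p) (at (coord c p))"
  unfolding trans_deriv_def
  by (rule smooth_on_has_derivative[OF transition_smooth]) (use assms in auto)

lemma trans_deriv_linear:
  "c \<in> A \<Longrightarrow> c' \<in> A \<Longrightarrow> p \<in> dom_of c \<Longrightarrow> p \<in> dom_of c' \<Longrightarrow> linear (trans_deriv c c' p)"
  using trans_has_derivative has_derivative_linear by blast

text \<open>The chain rule for three charts.\<close>
lemma trans_deriv_trans:
  assumes c: "c \<in> A" "c' \<in> A" "c'' \<in> A" and p: "p \<in> dom_of c" "p \<in> dom_of c'" "p \<in> dom_of c''"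
  shows "trans_deriv c' c'' p (trans_deriv c c' p v) = trans_deriv c c'' p v"
proof -
  have "((coord c'' \<circ> param c') has_derivative trans_deriv c' c'' p) (at ((coord c' \<circ> param c) (coord c p)))"
    using trans_has_derivative[OF c(2,3) p(2,3)] chart_facts(3)[OF c(1) p(1)] by simp
  from has_derivative_compose[OF trans_has_derivative[OF c(1,2) p(1,2)] this]
  have "((\<lambda>y. (coord c'' \<circ> param c') ((coord c' \<circ> param c) y)) has_derivative
      (\<lambda>v. trans_deriv c' c'' p (trans_deriv c c' p v))) (at (coord c p))" .
  then have "((coord c'' \<circ> param c) has_derivative (\<lambda>v. trans_deriv c' c'' p (trans_deriv c c' p v))) (at (coord c p))"
  proof (rule has_derivative_transform_within_open)
    show "open (coord c ` (dom_of c \<inter> dom_of c'))" by (intro open_coord_image c chart_facts)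
    show "coord c p \<in> coord c ` (dom_of c \<inter> dom_of c')" using p by auto
    show "(coord c'' \<circ> param c') ((coord c' \<circ> param c) y) = (coord c'' \<circ> param c) y"
      if "y \<in> coord c ` (dom_of c \<inter> dom_of c')" for y
      using that chart_facts(3)[OF c(1)] chart_facts(3)[OF c(2)] by auto
  qed
  from has_derivative_unique[OF this trans_has_derivative[OF c(1,3) p(1,3)]] show ?thesis by metis
qed

lemma trans_deriv_self:
  assumes "c \<in> A" "p \<in> dom_of c" shows "trans_deriv c c p v = v"
proof -
  have "((coord c \<circ> param c) has_derivative (\<lambda>v. v)) (at (coord c p))"
    by (rule has_derivative_transform_within_open[OF has_derivative_ident chart_facts(2)[OF assms(1)]])
       (use assms chart_facts(3,5)[OF assms(1)] in auto)
  from frechet_derivative_eqI[OF this] show ?thesis by (simp add: trans_deriv_def)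
qed

lemma tcoord_tvec: "c \<in> A \<Longrightarrow> p \<in> dom_of c \<Longrightarrow> tcoord A c p (tvec A c p v) = v"
  and tvec_tcoord: "c \<in> A \<Longrightarrow> p \<in> dom_of c \<Longrightarrow> tvec A c p (tcoord A c p v) = v"
  by (simp_all add: tcoord_eq tvec_eq trans_deriv_trans chart_at_in chart_at_dom trans_deriv_self)

lemma linear_tcoord: "c \<in> A \<Longrightarrow> p \<in> dom_of c \<Longrightarrow> linear (tcoord A c p)"
  and linear_tvec: "c \<in> A \<Longrightarrow> p \<in> dom_of c \<Longrightarrow> linear (tvec A c p)"
  by (simp_all add: tcoord_eq tvec_eq trans_deriv_linear chart_at_in chart_at_dom)

lemma trans_deriv_tcoord:
  assumes "c \<in> A" "c' \<in> A" "p \<in> dom_of c" "p \<in> dom_of c'"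
  shows "trans_deriv c c' p (tcoord A c p v) = tcoord A c' p v"
  by (simp add: tcoord_eq trans_deriv_trans chart_at_in chart_at_dom assms)

text \<open>One chart that covers \<open>U\<close> suffices: the components in another chart arise by applying the
  derivative of the transition map.\<close>
lemma smooth_field_onI:
  assumes c: "c \<in> A" and U: "open U" "U \<subseteq> dom_of c"
    and X: "smooth_on (coord c ` U) (field_rep A c X)"
  shows "smooth_field_on A U X"
  unfolding smooth_field_on_def
proof
  fix c' assume c': "c' \<in> A"
  let ?D = "coord c' ` (dom_of c' \<inter> U)" and ?T = "coord c ` (dom_of c \<inter> dom_of c')"
  let ?\<phi> = "coord c \<circ> param c'" and ?\<psi> = "coord c' \<circ> param c"
  have D: "open ?D" by (rule open_coord_image[OF c' U(1)])
  have T: "open ?T" by (intro open_coord_image c chart_facts c')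
  have cU: "open (coord c ` U)" using open_coord_image[OF c U(1)] U(2) by (simp add: Int_absorb1)
  have "?D \<subseteq> coord c' ` (dom_of c' \<inter> dom_of c)" using U(2) by blast
  from smooth_on_subset[OF transition_smooth[OF c' c] this]
  have \<phi>: "smooth_on ?D ?\<phi>" .
  have \<phi>U: "?\<phi> ` ?D \<subseteq> coord c ` U" and \<phi>T: "?\<phi> ` ?D \<subseteq> ?T"
    using U(2) chart_facts(3)[OF c'] by auto
  have "smooth_on ?D (\<lambda>y. frechet_derivative ?\<psi> (at (?\<phi> y)) (field_rep A c X (?\<phi> y)))"
  proof (rule smooth_on_linear_apply[where M = "\<lambda>y. frechet_derivative ?\<psi> (at (?\<phi> y))", OF D])
    show "linear (frechet_derivative ?\<psi> (at (?\<phi> y)))" if "y \<in> ?D" for y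
      using smooth_on_has_derivative[OF transition_smooth[OF c c']] \<phi>T that has_derivative_linear by blast
    show "smooth_on ?D (\<lambda>y. frechet_derivative ?\<psi> (at (?\<phi> y)) b)" for b
      by (rule smooth_on_compose[OF D T smooth_on_frechet_derivative[OF transition_smooth[OF c c']] \<phi> \<phi>T])
    show "smooth_on ?D (\<lambda>y. field_rep A c X (?\<phi> y))"
      by (rule smooth_on_compose[OF D cU X \<phi> \<phi>U])
  qed
  then show "smooth_on ?D (field_rep A c' X)"
  proof (rule smooth_on_cong[OF D, rotated])
    fix y assume "y \<in> ?D"
    then obtain q where q: "q \<in> U" "q \<in> dom_of c'" "y = coord c' q" by blast
    with U(2) have qc: "q \<in> dom_of c" by blast
    show "frechet_derivative ?\<psi> (at (?\<phi> y)) (field_rep A c X (?\<phi> y)) = field_rep A c' X y"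
      using trans_deriv_tcoord[OF c c' qc q(2), of "X q"]
      by (simp add: q(3) field_rep_def chart_facts(3)[OF c' q(2)] chart_facts(3)[OF c qc] trans_deriv_def)
  qed
qed

lemma smooth_fun_onI:
  assumes c: "c \<in> A" and U: "open U" "U \<subseteq> dom_of c"
    and f: "smooth_on (coord c ` U) (f \<circ> param c)"
  shows "smooth_fun_on A U f"
  unfolding smooth_fun_on_def
proof
  fix c' assume c': "c' \<in> A"
  let ?D = "coord c' ` (dom_of c' \<inter> U)"
  have D: "open ?D" by (rule open_coord_image[OF c' U(1)])
  have cU: "open (coord c ` U)" using open_coord_image[OF c U(1)] U(2) by (simp add: Int_absorb1)
  have "?D \<subseteq> coord c' ` (dom_of c' \<inter> dom_of c)" using U(2) by blast
  from smooth_on_subset[OF transition_smooth[OF c' c] this]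
  have "smooth_on ?D (\<lambda>y. (f \<circ> param c) ((coord c \<circ> param c') y))"
    by (intro smooth_on_compose[OF D cU f]) (use U(2) chart_facts(3)[OF c'] in \<open>auto simp: comp_def\<close>)
  then show "smooth_on ?D (f \<circ> param c')"
    by (rule smooth_on_cong[OF D, rotated])
       (use U(2) chart_facts(3)[OF c'] chart_facts(3)[OF c] in auto)
qed

lemma smooth_field_on_subset: "smooth_field_on A U X \<Longrightarrow> V \<subseteq> U \<Longrightarrow> smooth_field_on A V X"
  unfolding smooth_field_on_def by (meson smooth_on_subset image_mono Int_mono order_refl)

lemma smooth_field_on_cong:
  assumes "open U" "\<And>q. q \<in> U \<Longrightarrow> X q = Y q" "smooth_field_on A U X"
  shows "smooth_field_on A U Y"
  unfolding smooth_field_on_def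
proof
  fix c assume c: "c \<in> A"
  show "smooth_on (coord c ` (dom_of c \<inter> U)) (field_rep A c Y)"
    by (rule smooth_on_cong[OF open_coord_image[OF c assms(1)], of "field_rep A c X"])
       (use assms(2,3) chart_facts(3)[OF c] c in \<open>auto simp: field_rep_def smooth_field_on_def\<close>)
qed

lemma smooth_field_on_add:
  assumes "open U" "smooth_field_on A U X" "smooth_field_on A U Y"
  shows "smooth_field_on A U (\<lambda>q. X q + Y q)"
  unfolding smooth_field_on_def
proof
  fix c assume c: "c \<in> A"
  show "smooth_on (coord c ` (dom_of c \<inter> U)) (field_rep A c (\<lambda>q. X q + Y q))"
    by (rule smooth_on_cong[OF open_coord_image[OF c assms(1)] _
          smooth_on_add[OF open_coord_image[OF c assms(1)], of "field_rep A c X" "field_rep A c Y"]])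
       (use assms(2,3) chart_facts(3)[OF c] linear_add[OF linear_tcoord[OF c]] c
         in \<open>auto simp: field_rep_def smooth_field_on_def\<close>)
qed

text \<open>The differential, defined through the preferred chart, can be computed in any chart.\<close>
lemma differential_eq:
  assumes c: "c \<in> A" and p: "p \<in> dom_of c" and U: "open U" "p \<in> U"
    and f: "\<And>q. q \<in> dom_of c \<Longrightarrow> q \<in> U \<Longrightarrow> f q = G (coord c q)"
    and G: "(G has_derivative G') (at (coord c p))"
  shows "differential A f p v = G' (tcoord A c p v)"
proof -
  let ?c = "chart_at A p"
  note c0 = chart_at_in[of p] chart_at_dom[of p]
  have "(G has_derivative G') (at ((coord c \<circ> param ?c) (coord ?c p)))"
    using G by (simp add: chart_facts(3)[OF c0])
  from has_derivative_compose[OF trans_has_derivative[OF c0(1) c c0(2) p] this]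
  have "((\<lambda>y. G ((coord c \<circ> param ?c) y)) has_derivative (\<lambda>v. G' (trans_deriv ?c c p v))) (at (coord ?c p))" .
  then have "((f \<circ> param ?c) has_derivative (\<lambda>v. G' (trans_deriv ?c c p v))) (at (coord ?c p))"
  proof (rule has_derivative_transform_within_open)
    show "open (coord ?c ` (dom_of ?c \<inter> (dom_of c \<inter> U)))"
      by (intro open_coord_image c0 open_Int chart_facts c U)
    show "coord ?c p \<in> coord ?c ` (dom_of ?c \<inter> (dom_of c \<inter> U))" using c0 p U by auto
    show "G ((coord c \<circ> param ?c) y) = (f \<circ> param ?c) y" if "y \<in> coord ?c ` (dom_of ?c \<inter> (dom_of c \<inter> U))" for y
      using that f chart_facts(3)[OF c0(1)] by auto
  qed
  from frechet_derivative_eqI[OF this] show ?thesis by (simp add: differential_def tcoord_eq)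
qed

end

section \<open>The coordinate form of a connection\<close>

locale chart_connection = smooth_manifold A
  for A :: "('m::{t2_space,second_countable_topology}, 'd::finite) chart set" +
  fixes c :: "('m, 'd) chart" and nabla :: "('m, 'd) connection"
  assumes c: "c \<in> A" and connection: "affine_connection A nabla"
begin

abbreviation S :: "(real^'d) set" where "S \<equiv> coord c ` dom_of c"

text \<open>The vector field whose components in the chart are \<open>F\<close>; constant \<open>F\<close> gives the coordinate fields.\<close>
definition chart_field :: "(real^'d \<Rightarrow> real^'d) \<Rightarrow> 'm \<Rightarrow> real^'d" where
  "chart_field F q = tvec A c q (F (coord c q))"

text \<open>Only the basis coordinate fields are differentiated, so that linearity in \<open>v\<close> is built in;
  \<open>nabla_coordinate_field\<close> shows that the other coordinate fields behave accordingly.\<close>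
definition christoffel :: "real^'d \<Rightarrow> real^'d \<Rightarrow> real^'d \<Rightarrow> real^'d" where
  "christoffel y u v = (\<Sum>b\<in>Basis. (v \<bullet> b) *\<^sub>R
     tcoord A c (param c y) (nabla (param c y) (tvec A c (param c y) u) (chart_field (\<lambda>_. b))))"

definition chart_preimage :: "(real^'d) set \<Rightarrow> 'm set" where
  "chart_preimage V = {q \<in> dom_of c. coord c q \<in> V}"

lemmas open_dom = chart_facts(1)[OF c]
lemmas open_S = chart_facts(2)[OF c]
lemmas param_coord [simp] = chart_facts(3)[OF c]
lemmas param_dom [simp] = chart_facts(4)[OF c]
lemmas coord_param [simp] = chart_facts(5)[OF c]
lemmas tcoord_tvec_c [simp] = tcoord_tvec[OF c]
lemmas tvec_tcoord_c [simp] = tvec_tcoord[OF c]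
lemmas lin_tcoord = linear_tcoord[OF c]
lemmas lin_tvec = linear_tvec[OF c]

lemma open_chart_preimage: "open V \<Longrightarrow> open (chart_preimage V)"
proof -
  assume V: "open V"
  have "chart_preimage V = coord c -` V \<inter> dom_of c" by (auto simp: chart_preimage_def)
  then show ?thesis using continuous_on_open_vimage[OF open_dom] chart_facts(6)[OF c] V by metis
qed

lemma coord_chart_preimage: "V \<subseteq> S \<Longrightarrow> coord c ` chart_preimage V = V"
  by (force simp: chart_preimage_def)

lemma chart_preimage_subset: "chart_preimage V \<subseteq> dom_of c" by (auto simp: chart_preimage_def)

lemma field_rep_chart_field: "y \<in> S \<Longrightarrow> field_rep A c (chart_field F) y = F y"
  by (simp add: field_rep_def chart_field_def)

lemma smooth_chart_field:
  assumes V: "open V" "V \<subseteq> S" and F: "smooth_on V F"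
  shows "smooth_field_on A (chart_preimage V) (chart_field F)"
proof (rule smooth_field_onI[OF c open_chart_preimage[OF V(1)] chart_preimage_subset])
  show "smooth_on (coord c ` chart_preimage V) (field_rep A c (chart_field F))"
    unfolding coord_chart_preimage[OF V(2)]
    by (rule smooth_on_cong[OF V(1) _ F]) (use V(2) in \<open>auto simp: field_rep_chart_field\<close>)
qed

lemma chart_preimage_S: "chart_preimage S = dom_of c"
  by (auto simp: chart_preimage_def)

lemma smooth_coordinate_field: "smooth_field_on A (dom_of c) (chart_field (\<lambda>_. v))"
  using smooth_chart_field[OF open_S order_refl smooth_on_const[OF open_S]] by (simp add: chart_preimage_S)

lemma
  assumes U: "open U"
  shows nabla_linear: "smooth_field_on A U Y \<Longrightarrow> p \<in> U \<Longrightarrow> linear (\<lambda>v. nabla p v Y)"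
    and nabla_add: "smooth_field_on A U Y \<Longrightarrow> smooth_field_on A U Z \<Longrightarrow> p \<in> U \<Longrightarrow>
      nabla p v (\<lambda>q. Y q + Z q) = nabla p v Y + nabla p v Z"
    and nabla_leibniz: "smooth_fun_on A U f \<Longrightarrow> smooth_field_on A U Y \<Longrightarrow> p \<in> U \<Longrightarrow>
      nabla p v (\<lambda>q. f q *\<^sub>R Y q) = differential A f p v *\<^sub>R Y p + f p *\<^sub>R nabla p v Y"
    and nabla_cong: "smooth_field_on A U Y \<Longrightarrow> smooth_field_on A U Z \<Longrightarrow> (\<And>q. q \<in> U \<Longrightarrow> Y q = Z q) \<Longrightarrow>
      p \<in> U \<Longrightarrow> nabla p v Y = nabla p v Z"
    and nabla_smooth: "smooth_field_on A U X \<Longrightarrow> smooth_field_on A U Y \<Longrightarrow>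
      smooth_field_on A U (\<lambda>p. nabla p (X p) Y)"
  using connection[unfolded affine_connection_def, THEN spec, of U] U by simp_all

lemma christoffel_bilinear:
  assumes y: "y \<in> S" shows "bilinear (christoffel y)"
proof -
  have "linear (\<lambda>u. tcoord A c (param c y) (nabla (param c y) (tvec A c (param c y) u) (chart_field (\<lambda>_. b))))" for b
  proof -
    have "linear (\<lambda>u. nabla (param c y) (tvec A c (param c y) u) (chart_field (\<lambda>_. b)))"
      using linear_compose[OF lin_tvec nabla_linear[OF open_dom smooth_coordinate_field], of "param c y"] y
      by (simp add: comp_def)
    from linear_compose[OF this lin_tcoord[of "param c y"]] show ?thesis using y by (simp add: comp_def)
  qed
  then have "linear (\<lambda>u. christoffel y u v)" for v
    unfolding christoffel_def by (intro linear_compose_sum ballI linear_compose_scale_right)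
  moreover have "linear (christoffel y u)" for u
    unfolding christoffel_def
    by (rule linearI) (simp_all add: inner_add_left scaleR_add_left sum.distrib scaleR_sum_right)
  ultimately show ?thesis by (simp add: bilinear_def)
qed

lemma christoffel_smooth: "smooth_on S (\<lambda>y. christoffel y u v)"
proof -
  have "smooth_on S (\<lambda>y. tcoord A c (param c y) (nabla (param c y) (tvec A c (param c y) u) (chart_field (\<lambda>_. b))))" for b
  proof (rule smooth_on_cong[OF open_S])
    have "smooth_field_on A (dom_of c) (\<lambda>p. nabla p (chart_field (\<lambda>_. u) p) (chart_field (\<lambda>_. b)))"
      by (rule nabla_smooth[OF open_dom smooth_coordinate_field smooth_coordinate_field])
    then show "smooth_on S (field_rep A c (\<lambda>p. nabla p (chart_field (\<lambda>_. u) p) (chart_field (\<lambda>_. b))))"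
      using c by (auto simp: smooth_field_on_def)
  qed (simp add: field_rep_def chart_field_def)
  then show ?thesis unfolding christoffel_def
    by (intro smooth_on_sum open_S smooth_on_scaleR smooth_on_const)
qed

lemma smooth_zero_field: "smooth_field_on A U (\<lambda>q. 0)" if "open U"
  unfolding smooth_field_on_def
proof
  fix c' assume c': "c' \<in> A"
  show "smooth_on (coord c' ` (dom_of c' \<inter> U)) (field_rep A c' (\<lambda>q. 0))"
    by (rule smooth_on_cong[OF open_coord_image[OF c' that] _ smooth_on_const[OF open_coord_image[OF c' that], of 0]])
       (use chart_facts(3)[OF c'] linear_0[OF linear_tcoord[OF c']] in \<open>auto simp: field_rep_def\<close>)
qed

lemma nabla_sum:
  assumes U: "open U" and p: "p \<in> U" and "finite I" and Y: "\<And>i. i \<in> I \<Longrightarrow> smooth_field_on A U (Y i)"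
  shows "smooth_field_on A U (\<lambda>q. \<Sum>i\<in>I. Y i q) \<and> nabla p v (\<lambda>q. \<Sum>i\<in>I. Y i q) = (\<Sum>i\<in>I. nabla p v (Y i))"
  using assms(3) Y
proof (induction I rule: finite_induct)
  case empty
  have "nabla p v (\<lambda>q. 0 + 0) = nabla p v (\<lambda>q. 0) + nabla p v (\<lambda>q. 0)"
    by (rule nabla_add[OF U smooth_zero_field[OF U] smooth_zero_field[OF U] p])
  then show ?case by (simp add: smooth_zero_field[OF U])
next
  case (insert i I)
  then have "smooth_field_on A U (Y i)" "smooth_field_on A U (\<lambda>q. \<Sum>i\<in>I. Y i q)"
    "nabla p v (\<lambda>q. \<Sum>i\<in>I. Y i q) = (\<Sum>i\<in>I. nabla p v (Y i))" by simp_all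
  with smooth_field_on_add[OF U this(1,2)] nabla_add[OF U this(1,2) p] insert.hyps show ?case by simp
qed

text \<open>Near \<open>p\<close> the field is a finite sum of functions times basis coordinate fields, to which additivity and
  the Leibniz rule apply. The identity holds only on the domain of the chart, so locality of the
  connection enters.\<close>
lemma nabla_chart_field:
  assumes V: "open V" "V \<subseteq> S" and F: "smooth_on V F" and p: "p \<in> dom_of c" "coord c p \<in> V"
  shows "nabla p (tvec A c p u) (chart_field F) =
    tvec A c p (frechet_derivative F (at (coord c p)) u + christoffel (coord c p) u (F (coord c p)))"
proof -
  let ?U = "chart_preimage V" and ?y = "coord c p" and ?F' = "frechet_derivative F (at (coord c p))"
  have U: "open ?U" "p \<in> ?U" using open_chart_preimage[OF V(1)] p by (auto simp: chart_preimage_def)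
  have U': "?U \<subseteq> dom_of c" by (rule chart_preimage_subset)
  define f where "f b q = F (coord c q) \<bullet> b" for b q
  let ?Y = "\<lambda>b q. f b q *\<^sub>R chart_field (\<lambda>_. b) q"
  have Fb: "smooth_on V (\<lambda>y. F y \<bullet> b)" for b
    by (rule smooth_on_bounded_linear[OF bounded_linear_inner_left V(1) F])
  have f: "smooth_fun_on A ?U (f b)" for b
  proof (rule smooth_fun_onI[OF c U(1) U'])
    show "smooth_on (coord c ` ?U) (f b \<circ> param c)"
      unfolding coord_chart_preimage[OF V(2)]
      by (rule smooth_on_cong[OF V(1) _ Fb[of b]]) (use V(2) in \<open>auto simp: f_def\<close>)
  qed
  have e: "smooth_field_on A ?U (chart_field (\<lambda>_. b))" for b
    by (rule smooth_field_on_subset[OF smooth_coordinate_field U'])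
  have Y: "smooth_field_on A ?U (?Y b)" for b
  proof (rule smooth_field_on_cong[OF U(1)])
    show "smooth_field_on A ?U (chart_field (\<lambda>y. (F y \<bullet> b) *\<^sub>R b))"
      by (rule smooth_chart_field[OF V smooth_on_scaleR[OF V(1) Fb smooth_on_const[OF V(1)]]])
    show "chart_field (\<lambda>y. (F y \<bullet> b) *\<^sub>R b) q = ?Y b q" if "q \<in> ?U" for q
      using U' that linear_scale[OF lin_tvec] by (auto simp: chart_field_def f_def)
  qed
  have sum: "chart_field F q = (\<Sum>b\<in>Basis. ?Y b q)" if "q \<in> ?U" for q
    using linear_eq_sum_Basis[OF lin_tvec, of q "F (coord c q)"] U' that
    by (auto simp: chart_field_def f_def)
  have df: "differential A (f b) p (tvec A c p u) = ?F' u \<bullet> b" for b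
    using differential_eq[OF c p(1) open_UNIV UNIV_I, of "f b" "\<lambda>y. F y \<bullet> b"
       "\<lambda>v. ?F' v \<bullet> b" "tvec A c p u"]
       bounded_linear.has_derivative[OF bounded_linear_inner_left smooth_on_has_derivative[OF F p(2)]] p(1)
    by (simp add: f_def)
  have sumY: "smooth_field_on A ?U (\<lambda>q. \<Sum>b\<in>Basis. ?Y b q) \<and>
      nabla p (tvec A c p u) (\<lambda>q. \<Sum>b\<in>Basis. ?Y b q) = (\<Sum>b\<in>Basis. nabla p (tvec A c p u) (?Y b))"
    by (rule nabla_sum[OF U finite_Basis Y])
  have "nabla p (tvec A c p u) (chart_field F) = nabla p (tvec A c p u) (\<lambda>q. \<Sum>b\<in>Basis. ?Y b q)"
    by (rule nabla_cong[OF U(1) smooth_chart_field[OF V F] _ _ U(2)]) (use sumY sum in auto)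
  also have "\<dots> = (\<Sum>b\<in>Basis. nabla p (tvec A c p u) (?Y b))"
    using sumY by simp
  also have "\<dots> = (\<Sum>b\<in>Basis. (?F' u \<bullet> b) *\<^sub>R tvec A c p b + (F ?y \<bullet> b) *\<^sub>R nabla p (tvec A c p u) (chart_field (\<lambda>_. b)))"
    by (simp add: nabla_leibniz[OF U(1) f e U(2)] df) (simp add: f_def chart_field_def)
  also have "\<dots> = tvec A c p (?F' u) + tvec A c p (christoffel ?y u (F ?y))"
    using p by (simp add: sum.distrib linear_eq_sum_Basis[OF lin_tvec[OF p(1)], of "?F' u"] christoffel_def
       linear_sum[OF lin_tvec] linear_scale[OF lin_tvec])
  also have "\<dots> = tvec A c p (?F' u + christoffel ?y u (F ?y))" by (simp add: linear_add[OF lin_tvec] p)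
  finally show ?thesis .
qed

lemma nabla_coordinate_field:
  assumes p: "p \<in> dom_of c"
  shows "nabla p (tvec A c p u) (chart_field (\<lambda>_. v)) = tvec A c p (christoffel (coord c p) u v)"
  using nabla_chart_field[OF open_S order_refl smooth_on_const[OF open_S] p]  p
  by (simp add: frechet_derivative_const)

text \<open>The bracket is evaluated in the preferred chart at \<open>p\<close>, where the components of coordinate fields of
  \<open>c\<close> are first derivatives of the transition map. It is thus an antisymmetrised second derivative.\<close>
lemma lie_bracket_coordinate_fields:
  assumes p: "p \<in> dom_of c"
  shows "lie_bracket A (chart_field (\<lambda>_. u)) (chart_field (\<lambda>_. v)) p = 0"
proof -
  let ?c = "chart_at A p"
  note c0 = chart_at_in[of p] chart_at_dom[of p]
  let ?\<phi> = "coord c \<circ> param ?c" and ?\<psi> = "coord ?c \<circ> param c"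
  let ?T = "coord c ` (dom_of c \<inter> dom_of ?c)"
  have T: "open ?T" "coord c p \<in> ?T"
    by (intro open_coord_image c chart_facts c0, use c0 p in auto)
  have \<psi>: "smooth_on ?T ?\<psi>" by (rule transition_smooth[OF c c0(1)])
  have rep: "frechet_derivative (field_rep A ?c (chart_field (\<lambda>_. v))) (at (coord ?c p)) w =
     frechet_derivative (\<lambda>y. frechet_derivative ?\<psi> (at y) v) (at (coord c p)) (tcoord A c p w)" for v w
  proof -
    have "((\<lambda>y. frechet_derivative ?\<psi> (at y) v) has_derivative
       frechet_derivative (\<lambda>y. frechet_derivative ?\<psi> (at y) v) (at (coord c p))) (at (?\<phi> (coord ?c p)))"
      using smooth_on_has_derivative[OF smooth_on_frechet_derivative[OF \<psi>] T(2)] by (simp add: chart_facts(3)[OF c0])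
    from has_derivative_compose[OF trans_has_derivative[OF c0(1) c c0(2) p] this]
    have "(field_rep A ?c (chart_field (\<lambda>_. v)) has_derivative
      (\<lambda>w. frechet_derivative (\<lambda>y. frechet_derivative ?\<psi> (at y) v) (at (coord c p)) (trans_deriv ?c c p w))) (at (coord ?c p))"
    proof (rule has_derivative_transform_within_open)
      show "open (coord ?c ` (dom_of ?c \<inter> dom_of c))" by (intro open_coord_image c0 open_dom)
      show "coord ?c p \<in> coord ?c ` (dom_of ?c \<inter> dom_of c)" using c0 p by auto
      fix y assume "y \<in> coord ?c ` (dom_of ?c \<inter> dom_of c)"
      then obtain q where q: "q \<in> dom_of ?c" "q \<in> dom_of c" "y = coord ?c q" by blast
      have "frechet_derivative ?\<psi> (at (coord c q)) v = tcoord A ?c q (tvec A c q v)"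
        using trans_deriv_tcoord[OF c c0(1) q(2,1), of "tvec A c q v"] q by (simp add: trans_deriv_def)
      then show "frechet_derivative ?\<psi> (at (?\<phi> y)) v = field_rep A ?c (chart_field (\<lambda>_. v)) y"
        using q by (simp add: field_rep_def chart_field_def chart_facts(3)[OF c0(1)])
    qed
    from frechet_derivative_eqI[OF this] show ?thesis by (simp add: tcoord_eq)
  qed
  show ?thesis
    unfolding lie_bracket_def Let_def rep
    using second_derivative_symmetric[OF T \<psi>, of u v] p by (simp add: chart_field_def)
qed

end

section \<open>Complex fields in a chart\<close>

context chart_connection
begin

definition complex_chart_field :: "(real^'d \<Rightarrow> complex^'d) \<Rightarrow> 'm \<Rightarrow> complex^'d" where
  "complex_chart_field F q = linear_ext (tvec A c q) (F (coord c q))"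

lemma complex_chart_field_parts:
  "(\<lambda>q. Re_vec (complex_chart_field F q)) = chart_field (\<lambda>y. Re_vec (F y))"
  "(\<lambda>q. Im_vec (complex_chart_field F q)) = chart_field (\<lambda>y. Im_vec (F y))"
  by (simp_all add: complex_chart_field_def chart_field_def fun_eq_iff)

lemma smooth_complex_chart_field:
  assumes V: "open V" "V \<subseteq> S" and F: "smooth_on V F"
  shows "smooth_complex_field_on A (chart_preimage V) (complex_chart_field F)"
  unfolding smooth_complex_field_on_def complex_chart_field_parts
  by (intro conjI smooth_chart_field[OF V] smooth_on_bounded_linear[OF bounded_linear_Re_vec V(1) F]
      smooth_on_bounded_linear[OF bounded_linear_Im_vec V(1) F])

lemma connection_ext_chart_field:
  assumes V: "open V" "V \<subseteq> S" and F: "smooth_on V F" and p: "p \<in> dom_of c" "coord c p \<in> V"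
  shows "connection_ext nabla p (linear_ext (tvec A c p) w) (complex_chart_field F) =
    linear_ext (tvec A c p) (cext (frechet_derivative F (at (coord c p))) w
      + bil_ext (christoffel (coord c p)) w (F (coord c p)))"
proof -
  note F' = smooth_on_has_derivative[OF F p(2)]
  note parts = bounded_linear.has_derivative[OF bounded_linear_Re_vec F', THEN frechet_derivative_eqI]
    bounded_linear.has_derivative[OF bounded_linear_Im_vec F', THEN frechet_derivative_eqI]
  note N = nabla_chart_field[OF V smooth_on_bounded_linear[OF bounded_linear_Re_vec V(1) F] p]
    nabla_chart_field[OF V smooth_on_bounded_linear[OF bounded_linear_Im_vec V(1) F] p]
  show ?thesis
    by (rule cvec_eqI)
       (simp_all add: connection_ext_def complex_chart_field_parts N parts cext_def
         linear_add[OF lin_tvec[OF p(1)]] linear_diff[OF lin_tvec[OF p(1)]] algebra_simps)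
qed

text \<open>A connection depends only on germs, and smoothness of \<open>Y\<close> passes to \<open>Z\<close> on the open set where the two
  agree.\<close>
lemma connection_ext_cong:
  assumes U: "open U" "p \<in> U" and Y: "smooth_complex_field_on A U Y" and YZ: "\<And>q. q \<in> U \<Longrightarrow> Y q = Z q"
  shows "connection_ext nabla p w Y = connection_ext nabla p w Z"
proof -
  have Re: "smooth_field_on A U (\<lambda>q. Re_vec (Y q))" and Im: "smooth_field_on A U (\<lambda>q. Im_vec (Y q))"
    using Y by (auto simp: smooth_complex_field_on_def)
  have "nabla p v (\<lambda>q. Re_vec (Y q)) = nabla p v (\<lambda>q. Re_vec (Z q))" for v
    by (rule nabla_cong[OF U(1) Re smooth_field_on_cong[OF U(1) _ Re] _ U(2)]) (simp_all add: YZ)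
  moreover have "nabla p v (\<lambda>q. Im_vec (Y q)) = nabla p v (\<lambda>q. Im_vec (Z q))" for v
    by (rule nabla_cong[OF U(1) Im smooth_field_on_cong[OF U(1) _ Im] _ U(2)]) (simp_all add: YZ)
  ultimately show ?thesis by (simp add: connection_ext_def)
qed

end

section \<open>The almost Kaehler structure in a chart\<close>

locale almost_kaehler_chart = chart_connection A c nabla
  for A :: "('m::{t2_space,second_countable_topology}, 'd::finite) chart set"
    and c :: "('m, 'd) chart" and nabla :: "('m, 'd) connection" +
  fixes \<kappa> :: "'m \<Rightarrow> real^'d \<Rightarrow> real^'d \<Rightarrow> real" and J :: "'m \<Rightarrow> real^'d \<Rightarrow> real^'d"
  assumes symplectic: "symplectic_form A \<kappa>" and complex: "complex_structure A J"
    and calibrated: "calibrated \<kappa> J" and levi_civita: "levi_civita A (g_of \<kappa> J) nabla"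
begin

definition chart_J :: "real^'d \<Rightarrow> real^'d \<Rightarrow> real^'d" where
  "chart_J y u = tcoord A c (param c y) (J (param c y) (tvec A c (param c y) u))"

definition chart_g :: "real^'d \<Rightarrow> real^'d \<Rightarrow> real^'d \<Rightarrow> real" where
  "chart_g y u v = g_of \<kappa> J (param c y) (tvec A c (param c y) u) (tvec A c (param c y) v)"

lemma kappa_bilinear: "bilinear (\<kappa> p)"
  and kappa_closed: "closed_two_form A \<kappa>"
  using symplectic by (auto simp: symplectic_form_def closed_two_form_def two_form_def)

lemma kappa_skew: "\<kappa> p u v = - \<kappa> p v u"
proof -
  have "\<kappa> p w w = 0" for w
    using symplectic by (auto simp: symplectic_form_def closed_two_form_def two_form_def)
  from this[of "u + v"] this[of u] this[of v] show ?thesis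
    by (simp add: bilinear_simps[OF kappa_bilinear])
qed

lemma kappa_J: "\<kappa> p (J p u) (J p v) = \<kappa> p u v"
  and g_pos: "v \<noteq> 0 \<Longrightarrow> g_of \<kappa> J p v v > 0"
  using calibrated by (auto simp: calibrated_def)

lemma J_linear: "linear (J p)" and J_J: "J p (J p v) = - v"
  using complex by (auto simp: complex_structure_def)

lemma g_bilinear: "bilinear (g_of \<kappa> J p)"
  unfolding bilinear_def g_of_def
  by (auto intro!: linearI simp: linear_simps[OF J_linear] bilinear_simps[OF kappa_bilinear])

lemma g_sym: "g_of \<kappa> J p u v = g_of \<kappa> J p v u"
  using kappa_J[of p "J p u" v] kappa_skew[of p u "J p v"]
  by (simp add: g_of_def J_J bilinear_simps[OF kappa_bilinear])

lemma g_J: "g_of \<kappa> J p (J p u) (J p v) = g_of \<kappa> J p u v"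
  by (simp add: g_of_def kappa_J)

lemma tvec_chart_J: "p \<in> dom_of c \<Longrightarrow> tvec A c p (chart_J (coord c p) u) = J p (tvec A c p u)"
  by (simp add: chart_J_def)

lemma chart_g_coord: "p \<in> dom_of c \<Longrightarrow> chart_g (coord c p) u v = g_of \<kappa> J p (tvec A c p u) (tvec A c p v)"
  by (simp add: chart_g_def)

lemma chart_J_linear: "y \<in> S \<Longrightarrow> linear (chart_J y)"
  using linear_compose[OF linear_compose[OF lin_tvec J_linear] lin_tcoord, of "param c y" "param c y" "param c y"]
  by (simp add: chart_J_def[abs_def] comp_def)

lemma chart_J_smooth: "smooth_on S (\<lambda>y. chart_J y u)"
  using complex c by (simp add: complex_structure_def chart_J_def)

lemma form_rep_smooth: "smooth_on S (form_rep A c \<kappa> u v)"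
  using kappa_closed c by (simp add: closed_two_form_def two_form_def)

lemma chart_g_eq: "y \<in> S \<Longrightarrow> chart_g y u v = form_rep A c \<kappa> (chart_J y u) v y"
  by (simp add: chart_g_def g_of_def form_rep_def chart_J_def)

lemma chart_g_bilinear: "y \<in> S \<Longrightarrow> bilinear (chart_g y)"
  unfolding bilinear_def chart_g_def
  by (auto intro!: linearI simp: linear_simps[OF lin_tvec] bilinear_simps[OF g_bilinear])

lemma chart_g_smooth: "smooth_on S (\<lambda>y. chart_g y u v)"
proof (rule smooth_on_cong[OF open_S chart_g_eq[symmetric]])
  show "smooth_on S (\<lambda>y. form_rep A c \<kappa> (chart_J y u) v y)"
  proof (rule smooth_on_linear_apply[where M = "\<lambda>y b. form_rep A c \<kappa> b v y", OF open_S _ form_rep_smooth chart_J_smooth])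
    show "linear (\<lambda>b. form_rep A c \<kappa> b v y)" if "y \<in> S" for y
      unfolding form_rep_def
      by (rule linearI) (use that in \<open>simp_all add: linear_simps[OF lin_tvec] bilinear_simps[OF kappa_bilinear]\<close>)
  qed
qed

text \<open>Torsion-freeness for two coordinate fields, whose bracket is zero.\<close>
lemma christoffel_symmetric:
  assumes y: "y \<in> S" shows "christoffel y u v = christoffel y v u"
proof -
  let ?p = "param c y"
  have p: "?p \<in> dom_of c" using y by simp
  have "nabla ?p (chart_field (\<lambda>_. u) ?p) (chart_field (\<lambda>_. v)) - nabla ?p (chart_field (\<lambda>_. v) ?p) (chart_field (\<lambda>_. u))
    = lie_bracket A (chart_field (\<lambda>_. u)) (chart_field (\<lambda>_. v)) ?p"
    using levi_civita open_dom smooth_coordinate_field p unfolding levi_civita_def by blast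
  also have "\<dots> = 0" by (rule lie_bracket_coordinate_fields[OF p])
  finally have "tvec A c ?p (christoffel y u v) = tvec A c ?p (christoffel y v u)"
    using y nabla_coordinate_field[OF p] by (simp add: chart_field_def)
  then show ?thesis using tcoord_tvec_c[OF p] by metis
qed

lemma chart_g_parallel:
  assumes y: "y \<in> S"
  shows "frechet_derivative (\<lambda>y. chart_g y u v) (at y) w =
    chart_g y (christoffel y w u) v + chart_g y u (christoffel y w v)"
proof -
  let ?p = "param c y" and ?e = "\<lambda>v. chart_field (\<lambda>_. v)"
  have p: "?p \<in> dom_of c" using y by simp
  have "differential A (\<lambda>q. g_of \<kappa> J q (?e u q) (?e v q)) ?p (tvec A c ?p w) =
      g_of \<kappa> J ?p (nabla ?p (tvec A c ?p w) (?e u)) (?e v ?p) + g_of \<kappa> J ?p (?e u ?p) (nabla ?p (tvec A c ?p w) (?e v))"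
    using levi_civita open_dom smooth_coordinate_field p unfolding levi_civita_def by blast
  moreover have "differential A (\<lambda>q. g_of \<kappa> J q (?e u q) (?e v q)) ?p (tvec A c ?p w) =
      frechet_derivative (\<lambda>y. chart_g y u v) (at y) (tcoord A c ?p (tvec A c ?p w))"
  proof (rule differential_eq[OF c p open_UNIV UNIV_I])
    show "((\<lambda>y. chart_g y u v) has_derivative frechet_derivative (\<lambda>y. chart_g y u v) (at y)) (at (coord c ?p))"
      using y smooth_on_has_derivative[OF chart_g_smooth y] by simp
    show "g_of \<kappa> J q (?e u q) (?e v q) = chart_g (coord c q) u v" if "q \<in> dom_of c" for q
      using that by (simp add: chart_g_coord chart_field_def)
  qed
  ultimately show ?thesis
    using y p by (simp add: nabla_coordinate_field chart_field_def chart_g_def)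
qed

text \<open>By \<open>J\<^sup>2 = -1\<close>, the form \<open>g(J\<cdot>, \<cdot>)\<close> is \<open>-\<kappa>\<close>.\<close>
lemma chart_g_closed:
  assumes y: "y \<in> S"
  shows "frechet_derivative (\<lambda>y. chart_g y (chart_J y v) w) (at y) u
      + frechet_derivative (\<lambda>y. chart_g y (chart_J y w) u) (at y) v
      + frechet_derivative (\<lambda>y. chart_g y (chart_J y u) v) (at y) w = 0"
proof -
  have "frechet_derivative (\<lambda>y. chart_g y (chart_J y v) w) (at y) = (\<lambda>u. - frechet_derivative (form_rep A c \<kappa> v w) (at y) u)"
    for v w
  proof (rule frechet_derivative_eqI, rule has_derivative_transform_within_open[OF _ open_S y])
    show "((\<lambda>y. - form_rep A c \<kappa> v w y) has_derivative (\<lambda>u. - frechet_derivative (form_rep A c \<kappa> v w) (at y) u)) (at y)"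
      by (rule has_derivative_minus[OF smooth_on_has_derivative[OF form_rep_smooth y]])
    show "- form_rep A c \<kappa> v w y = chart_g y (chart_J y v) w" if "y \<in> S" for y
      using that by (simp add: chart_g_def chart_J_def form_rep_def g_of_def J_J bilinear_simps[OF kappa_bilinear])
  qed
  moreover have "frechet_derivative (form_rep A c \<kappa> v w) (at y) u + frechet_derivative (form_rep A c \<kappa> w u) (at y) v
      + frechet_derivative (form_rep A c \<kappa> u v) (at y) w = 0"
    using kappa_closed c y unfolding closed_two_form_def by blast
  ultimately show ?thesis by simp
qed

sublocale patch: almost_kaehler_patch S christoffel chart_g chart_J
proof (rule almost_kaehler_patch.intro)
  show "chart_g y v v > 0" if "y \<in> S" "v \<noteq> 0" for y v
  proof -
    have "tvec A c (param c y) v \<noteq> 0"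
      using tcoord_tvec_c[OF param_dom[OF that(1)], of v] that(2)
        linear_0[OF lin_tcoord[OF param_dom[OF that(1)]]] by metis
    then show ?thesis by (simp add: chart_g_def g_pos)
  qed
  show "chart_J y (chart_J y v) = - v" if "y \<in> S" for y v
    using that by (simp add: chart_J_def J_J linear_simps[OF lin_tvec] linear_simps[OF lin_tcoord])
  show "chart_g y u v = chart_g y v u" for y u v by (simp add: chart_g_def g_sym)
  show "chart_g y (chart_J y u) (chart_J y v) = chart_g y u v" if "y \<in> S" for y u v
    using that by (simp add: chart_g_def chart_J_def g_J)
qed (fact open_S christoffel_bilinear christoffel_symmetric christoffel_smooth chart_g_bilinear chart_g_smooth
   chart_J_linear chart_J_smooth chart_g_parallel chart_g_closed)+

lemma linear_ext_tvec_J: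
  "p \<in> dom_of c \<Longrightarrow> linear_ext (J p) (linear_ext (tvec A c p) w) = linear_ext (tvec A c p) (linear_ext (chart_J (coord c p)) w)"
  by (rule cvec_eqI) (simp_all add: tvec_chart_J)

lemma linear_ext_tcoord_tvec: "p \<in> dom_of c \<Longrightarrow> linear_ext (tcoord A c p) (linear_ext (tvec A c p) w) = w"
  and linear_ext_tvec_tcoord: "p \<in> dom_of c \<Longrightarrow> linear_ext (tvec A c p) (linear_ext (tcoord A c p) w) = w"
  by (rule cvec_eqI; simp)+

lemma inj_linear_ext_tvec: "p \<in> dom_of c \<Longrightarrow> inj (linear_ext (tvec A c p))"
  by (rule inj_on_inverseI[of _ "linear_ext (tcoord A c p)"]) (simp add: linear_ext_tcoord_tvec)

lemma tvec_T10:
  assumes p: "p \<in> dom_of c"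
  shows "linear_ext (tvec A c p) w \<in> T10 J p \<longleftrightarrow> w \<in> T10 chart_J (coord c p)"
  and "linear_ext (tvec A c p) w \<in> T01 J p \<longleftrightarrow> w \<in> T01 chart_J (coord c p)"
  using inj_eq[OF inj_linear_ext_tvec[OF p]]
  by (simp_all add: T10_def T01_def linear_ext_tvec_J[OF p]
      linear_ext_complex_linear(3,5)[OF lin_tvec[OF p], symmetric])

lemma tvec_T10_image:
  assumes p: "p \<in> dom_of c"
  shows "linear_ext (tvec A c p) ` T10 chart_J (coord c p) = T10 J p"
proof (intro set_eqI iffI)
  fix w assume "w \<in> T10 J p"
  then have "linear_ext (tcoord A c p) w \<in> T10 chart_J (coord c p)"
    by (simp add: tvec_T10(1)[OF p, symmetric] linear_ext_tvec_tcoord[OF p])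
  then show "w \<in> linear_ext (tvec A c p) ` T10 chart_J (coord c p)"
    using linear_ext_tvec_tcoord[OF p, of w] by (metis imageI)
qed (auto simp: tvec_T10(1)[OF p])

lemma connection_ext_cnabla:
  assumes "smooth_on S F" "p \<in> dom_of c"
  shows "connection_ext nabla p (linear_ext (tvec A c p) w) (complex_chart_field F) =
    linear_ext (tvec A c p) (patch.cnabla (coord c p) w F)"
  unfolding patch.cnabla_def by (rule connection_ext_chart_field[OF open_S order_refl assms(1,2)]) (use assms in simp)

lemma cnj_chart_field:
  "q \<in> dom_of c \<Longrightarrow> cnj_vec (complex_chart_field F q) = complex_chart_field (\<lambda>y. cnj_vec (F y)) q"
  by (simp add: complex_chart_field_def linear_ext_complex_linear[OF lin_tvec])

lemma g_ext_chart_field: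
  "q \<in> dom_of c \<Longrightarrow> bilinear_ext (g_of \<kappa> J q) (complex_chart_field F q) (complex_chart_field G q) =
    bilinear_ext (chart_g (coord c q)) (F (coord c q)) (G (coord c q))"
  by (simp add: bilinear_ext_def complex_chart_field_def chart_g_coord)

text \<open>The frame found in coordinates is transported by \<open>tvec\<close>. For the iterated derivative, the inner
  covariant derivative is itself the field with components \<open>cnabla\<close>, but only on the domain of the
  chart, whence \<open>connection_ext_cong\<close>.\<close>
theorem normal_frame:
  assumes n: "CARD('d) = 2 * n" and x: "x \<in> dom_of c"
  shows "\<exists>U W. local_10_frame A J n x U W \<and>
    (\<forall>k\<in>{1..n}. \<forall>i\<in>{1..n}. connection_ext nabla x (W k x) (\<lambda>q. cnj_vec (W i q)) = 0) \<and>
    (\<forall>k\<in>{1..n}. \<forall>i\<in>{1..n}. connection_ext nabla x (W k x) (W i) \<in> T01 J x) \<and>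
    (let G = (\<lambda>r s q. bilinear_ext (g_of \<kappa> J q) (W r q) (cnj_vec (W s q))) in
       \<forall>r\<in>{1..n}. \<forall>s\<in>{1..n}.
         G r s x = (if r = s then 1 else 0) \<and> differential A (G r s) x = (\<lambda>v. 0)) \<and>
    (\<forall>r\<in>{1..n}. \<forall>k\<in>{1..n}. \<forall>i\<in>{1..n}.
       connection_ext nabla x (W r x) (\<lambda>q. connection_ext nabla q (cnj_vec (W k q)) (W i)) = 0)"
proof -
  let ?y = "coord c x" and ?L = "\<lambda>q. linear_ext (tvec A c q)"
  have y: "?y \<in> S" using x by simp
  obtain V F where V: "open V" "?y \<in> V" "V \<subseteq> S"
    and F: "\<And>i. i \<in> {1..n} \<Longrightarrow> smooth_on S (F i)"
    and inj: "\<And>y. y \<in> V \<Longrightarrow> inj_on (\<lambda>i. F i y) {1..n}"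
    and ind: "\<And>y. y \<in> V \<Longrightarrow> vec.independent ((\<lambda>i. F i y) ` {1..n})"
    and span: "\<And>y. y \<in> V \<Longrightarrow> vec.span ((\<lambda>i. F i y) ` {1..n}) = T10 chart_J y"
    and F1: "\<And>k i. k \<in> {1..n} \<Longrightarrow> i \<in> {1..n} \<Longrightarrow> patch.cnabla ?y (F k ?y) (\<lambda>y. cnj_vec (F i y)) = 0"
    and F2: "\<And>k i. k \<in> {1..n} \<Longrightarrow> i \<in> {1..n} \<Longrightarrow> patch.cnabla ?y (F k ?y) (F i) \<in> T01 chart_J ?y"
    and F3: "\<And>r s. r \<in> {1..n} \<Longrightarrow> s \<in> {1..n} \<Longrightarrow>
        bilinear_ext (chart_g ?y) (F r ?y) (cnj_vec (F s ?y)) = (if r = s then 1 else 0)"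
    and F3': "\<And>r s. r \<in> {1..n} \<Longrightarrow> s \<in> {1..n} \<Longrightarrow>
       ((\<lambda>y. bilinear_ext (chart_g y) (F r y) (cnj_vec (F s y))) has_derivative (\<lambda>v. 0)) (at ?y)"
    and F4: "\<And>r k i. r \<in> {1..n} \<Longrightarrow> k \<in> {1..n} \<Longrightarrow> i \<in> {1..n} \<Longrightarrow>
       patch.cnabla ?y (F r ?y) (\<lambda>y. patch.cnabla y (cnj_vec (F k y)) (F i)) = 0"
    using patch.normal_frame_in_coordinates[OF n y] by blast
  define W where "W i = complex_chart_field (F i)" for i
  have W_at: "W i q = ?L q (F i (coord c q))" for i q by (simp add: W_def complex_chart_field_def)
  define U where "U = chart_preimage V"
  have U: "open U" "x \<in> U" "U \<subseteq> dom_of c"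
    using open_chart_preimage[OF V(1)] x V(2) chart_preimage_subset by (auto simp: U_def chart_preimage_def)
  have cF: "smooth_on S (\<lambda>y. cnj_vec (F i y))" if "i \<in> {1..n}" for i
    by (rule smooth_on_bounded_linear[OF bounded_linear_cnj_vec open_S F[OF that]])
  have L0: "?L x 0 = 0" by (rule linear_ext_complex_linear(4)[OF lin_tvec[OF x]])
  have smooth_dom: "smooth_complex_field_on A (dom_of c) (complex_chart_field G)" if "smooth_on S G" for G
    using smooth_complex_chart_field[OF open_S order_refl that] by (simp add: chart_preimage_S)
  have frame: "local_10_frame A J n x U W"
    unfolding local_10_frame_def
  proof (intro conjI ballI U(1,2))
    show "smooth_complex_field_on A U (W i)" if "i \<in> {1..n}" for i
      unfolding U_def W_def by (rule smooth_complex_chart_field[OF V(1,3) smooth_on_subset[OF F[OF that] V(3)]])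
    fix q assume "q \<in> U"
    then have q: "q \<in> dom_of c" "coord c q \<in> V" by (auto simp: U_def chart_preimage_def)
    have Wq: "(\<lambda>i. W i q) = ?L q \<circ> (\<lambda>i. F i (coord c q))" by (auto simp: W_at)
    have lin: "Vector_Spaces.linear (*s) (*s) (?L q)"
      by (simp add: Vector_Spaces.linear_iff vec.vector_space_axioms linear_ext_complex_linear[OF lin_tvec[OF q(1)]])
    have injL: "inj (?L q)" by (rule inj_linear_ext_tvec[OF q(1)])
    show "inj_on (\<lambda>i. W i q) {1..n}"
      unfolding Wq by (rule comp_inj_on[OF inj[OF q(2)] inj_on_subset[OF injL subset_UNIV]])
    show "vec.independent ((\<lambda>i. W i q) ` {1..n})"
      unfolding Wq image_comp[symmetric]
      by (rule vec.linear_independent_injective_image[OF lin ind[OF q(2)] inj_on_subset[OF injL subset_UNIV]])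
    show "vec.span ((\<lambda>i. W i q) ` {1..n}) = T10 J q"
      unfolding Wq image_comp[symmetric] vec.linear_span_image[OF lin] span[OF q(2)]
      by (rule tvec_T10_image[OF q(1)])
  qed
  have first: "connection_ext nabla x (W k x) (\<lambda>q. cnj_vec (W i q)) = 0"
    if "k \<in> {1..n}" "i \<in> {1..n}" for k i
  proof -
    have "connection_ext nabla x (W k x) (\<lambda>q. cnj_vec (W i q)) =
        connection_ext nabla x (W k x) (complex_chart_field (\<lambda>y. cnj_vec (F i y)))"
      by (rule connection_ext_cong[OF open_dom x smooth_dom[OF cF[OF that(2)]], symmetric])
         (simp add: W_def cnj_chart_field)
    then show ?thesis
      by (simp add: W_at connection_ext_cnabla[OF cF[OF that(2)] x] F1[OF that] L0)
  qed
  have second: "connection_ext nabla x (W k x) (W i) \<in> T01 J x" if "k \<in> {1..n}" "i \<in> {1..n}" for k i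
    using F2[OF that] by (simp add: W_at W_def[of i] connection_ext_cnabla[OF F[OF that(2)] x] tvec_T10(2)[OF x])
  define G where "G = (\<lambda>r s q. bilinear_ext (g_of \<kappa> J q) (W r q) (cnj_vec (W s q)))"
  have G: "G r s q = bilinear_ext (chart_g (coord c q)) (F r (coord c q)) (cnj_vec (F s (coord c q)))"
    if "q \<in> dom_of c" for r s q
    using that by (simp add: G_def W_def cnj_chart_field g_ext_chart_field)
  have third: "G r s x = (if r = s then 1 else 0) \<and> differential A (G r s) x = (\<lambda>v. 0)"
    if "r \<in> {1..n}" "s \<in> {1..n}" for r s
    using differential_eq[OF c x open_UNIV UNIV_I G F3'[OF that]] G[OF x] F3[OF that] by auto
  have fourth: "connection_ext nabla x (W r x) (\<lambda>q. connection_ext nabla q (cnj_vec (W k q)) (W i)) = 0"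
    if rki: "r \<in> {1..n}" "k \<in> {1..n}" "i \<in> {1..n}" for r k i
  proof -
    let ?V = "\<lambda>y. patch.cnabla y (cnj_vec (F k y)) (F i)"
    have V: "smooth_on S ?V" by (rule patch.cnabla_smooth[OF F[OF rki(3)] cF[OF rki(2)]])
    have "connection_ext nabla x (W r x) (\<lambda>q. connection_ext nabla q (cnj_vec (W k q)) (W i)) =
        connection_ext nabla x (W r x) (complex_chart_field ?V)"
    proof (rule connection_ext_cong[OF open_dom x smooth_dom[OF V], symmetric])
      fix q assume q: "q \<in> dom_of c"
      have "cnj_vec (W k q) = ?L q (cnj_vec (F k (coord c q)))"
        using q by (simp add: W_def cnj_chart_field) (simp add: complex_chart_field_def)
      then show "complex_chart_field ?V q = connection_ext nabla q (cnj_vec (W k q)) (W i)"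
        by (simp add: W_def[of i] connection_ext_cnabla[OF F[OF rki(3)] q]) (simp add: complex_chart_field_def)
    qed
    then show ?thesis
      by (simp add: W_at connection_ext_cnabla[OF V x] F4[OF rki] L0)
  qed
  show ?thesis
    using frame first second third fourth unfolding Let_def G_def by blast
qed

end

theorem theorem3p2:
  fixes A :: "('m::{t2_space,second_countable_topology}, 'd::finite) chart set"
    and \<kappa> :: "'m \<Rightarrow> real^'d \<Rightarrow> real^'d \<Rightarrow> real"
    and J :: "'m \<Rightarrow> real^'d \<Rightarrow> real^'d"
    and nabla :: "('m, 'd) connection"
    and n :: nat
    and x :: 'm
  assumes dim: "CARD('d) = 2 * n"
    and manifold: "smooth_atlas A"
    and symplectic: "symplectic_form A \<kappa>"
    and J: "complex_structure A J" "calibrated \<kappa> J"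
    and nabla: "levi_civita A (g_of \<kappa> J) nabla"
  shows "\<exists>U W. local_10_frame A J n x U W \<and>
    (\<forall>k\<in>{1..n}. \<forall>i\<in>{1..n}. connection_ext nabla x (W k x) (\<lambda>q. cnj_vec (W i q)) = 0) \<and>
    (\<forall>k\<in>{1..n}. \<forall>i\<in>{1..n}. connection_ext nabla x (W k x) (W i) \<in> T01 J x) \<and>
    (let G = (\<lambda>r s q. bilinear_ext (g_of \<kappa> J q) (W r q) (cnj_vec (W s q))) in
       \<forall>r\<in>{1..n}. \<forall>s\<in>{1..n}.
         G r s x = (if r = s then 1 else 0) \<and> differential A (G r s) x = (\<lambda>v. 0)) \<and>
    (\<forall>r\<in>{1..n}. \<forall>k\<in>{1..n}. \<forall>i\<in>{1..n}.
       connection_ext nabla x (W r x) (\<lambda>q. connection_ext nabla q (cnj_vec (W k q)) (W i)) = 0)"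
proof -
  interpret smooth_manifold A by unfold_locales (rule manifold)
  have "affine_connection A nabla" using nabla by (simp add: levi_civita_def)
  then interpret almost_kaehler_chart A "chart_at A x" nabla \<kappa> J
    using symplectic J nabla by unfold_locales (auto intro: chart_at_in)
  show ?thesis by (rule normal_frame[OF dim chart_at_dom])
qed

end
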